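(* Let $V : f=0$ be a hypersurface in the complex projective space $\mathbb{P}^n$, where $f$ is a homogeneous polynomial of degree $N>1$ in $S=\mathbb{C}[x_0,\dots,x_n]$, and assume that $V$ has only isolated singularities. Then $$ER(f)_m=0 \quad\text{for any } m \leq n(N-2)-\tau(V),$$ where $\tau(V)$, the Tjurina number of $V$, is the sum of the Tjurina numbers of all the singularities of $V$.
   Context: $S=\mathbb{C}[x_0,\dots,x_n]=\oplus_k S_k$ with the standard grading, and $f_{x_j}=\partial f/\partial x_j$. $AR(f)$ is the graded $S$-module of all Jacobian relations: $AR(f)_m$ is the space of $(a_0,\dots,a_n)\in S_m^{n+1}$ with $a_0f_{x_0}+\dots+a_nf_{x_n}=0$. $KR(f)\subset AR(f)$ is the graded submodule of Koszul relations, generated by the relations $f_{x_j}f_{x_i}+(-f_{x_i})f_{x_j}=0$ for $i<j$ (i.e. the tuple with $f_{x_j}$ in position $i$, $-f_{x_i}$ in position $j$, and $0$ elsewhere). The graded module of essential relations is $ER(f)=AR(f)/KR(f)$. (Equivalently, up to identification, $AR(f)=\ker\{df\wedge:\Omega^n\to\Omega^{n+1}\}$ and $KR(f)=\operatorname{im}\{df\wedge:\Omega^{n-1}\to\Omega^n\}$, where $\Omega^k$ denotes the global regular $k$-forms on $\mathbb{C}^{n+1}$.) If $g=0$ is a local analytic equation of $(V,p)$ at a singular point $p$, with $g\in\mathcal{O}_n$ (the ring of holomorphic function germs at the origin of $\mathbb{C}^n$), the Tjurina number of the singularity is $\tau(g)=\dim_{\mathbb{C}}\mathcal{O}_n/(J_g+(g))$,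 where $J_g$ is the ideal generated by the first partial derivatives of $g$. *)

theory Defs
  imports
    "HOL-Analysis.Analysis"
    "HOL-Library.Poly_Mapping"
    "HOL-Library.Set_Algebras"
    "HOL-Library.Option_ord"
    "HOL-Library.Extended_Nat"
begin

text \<open>
  The dimension $n$ is \<open>CARD('n)\<close> for an ordered finite index type \<open>'n\<close>. Affine coordinates
  $y_1,\dots,y_n$ on $C^n$ are indexed by \<open>'n\<close>; homogeneous coordinates $x_0,\dots,x_n$ are
  indexed by \<open>'n option\<close>, with \<open>None\<close> (the least element) in the role of the index $0$.
\<close>

section \<open>Polynomials\<close>

type_synonym 'v mpoly = "('v \<Rightarrow>\<^sub>0 nat) \<Rightarrow>\<^sub>0 complex"

definition monom_degree :: "('v::finite \<Rightarrow>\<^sub>0 nat) \<Rightarrow> nat" where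
  "monom_degree a = (\<Sum>i\<in>UNIV. Poly_Mapping.lookup a i)"

definition homogeneous_part :: "nat \<Rightarrow> ('v::finite) mpoly set" where
  "homogeneous_part m = {p. \<forall>a\<in>Poly_Mapping.keys p. monom_degree a = m}"

definition poly_eval :: "('v::finite) mpoly \<Rightarrow> complex ^ 'v \<Rightarrow> complex" where
  "poly_eval p x =
     (\<Sum>a\<in>Poly_Mapping.keys p. Poly_Mapping.lookup p a * (\<Prod>i\<in>UNIV. (x $ i) ^ Poly_Mapping.lookup a i))"

text \<open>Monomials not involving the variable \<open>i\<close> get the coefficient 0 below, so the truncated
  subtraction of exponents is harmless.\<close>

definition poly_partial :: "'v \<Rightarrow> ('v::finite) mpoly \<Rightarrow> 'v mpoly" where
  "poly_partial i p =
     (\<Sum>a\<in>Poly_Mapping.keys p.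
        Poly_Mapping.single (a - Poly_Mapping.single i 1)
          (of_nat (Poly_Mapping.lookup a i) * Poly_Mapping.lookup p a))"

section \<open>Jacobian, Koszul and essential relations\<close>

definition AR :: "('v::finite) mpoly \<Rightarrow> ('v mpoly ^ 'v) set" where
  "AR f = {a. (\<Sum>i\<in>UNIV. a $ i * poly_partial i f) = 0}"

definition AR_part :: "('v::finite) mpoly \<Rightarrow> nat \<Rightarrow> ('v mpoly ^ 'v) set" where
  "AR_part f m = {a \<in> AR f. \<forall>i. a $ i \<in> homogeneous_part m}"

definition koszul_relation :: "('v::finite) mpoly \<Rightarrow> 'v \<Rightarrow> 'v \<Rightarrow> 'v mpoly ^ 'v" where
  "koszul_relation f i j =
     (\<chi> k. if k = i then poly_partial j f else if k = j then - poly_partial i f else 0)"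

definition KR :: "'v mpoly \<Rightarrow> ('v mpoly ^ ('v::{finite,linorder})) set" where
  "KR f = module.span (*s) {koszul_relation f i j | i j. i < j}"

text \<open>An element of $ER(f) = AR(f)/KR(f)$ is a coset of \<open>KR f\<close>, and the zero element is the coset
  \<open>KR f\<close> itself. The homogeneous component of degree \<open>m\<close> is the image of \<open>AR_part f m\<close>.\<close>

definition ER_part :: "'v mpoly \<Rightarrow> nat \<Rightarrow> ('v mpoly ^ ('v::{finite,linorder})) set set" where
  "ER_part f m = (\<lambda>a. a +o KR f) ` AR_part f m"

section \<open>Germs of holomorphic functions at the origin\<close>

text \<open>A real Frechet derivative (the library's \<open>has_derivative\<close>) that commutes with complex
  scalars is a complex Frechet derivative.\<close>

definition holomorphic_at_origin :: "(complex ^ 'n \<Rightarrow> complex) \<Rightarrow> bool" where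
  "holomorphic_at_origin F \<longleftrightarrow>
     (\<forall>\<^sub>F z in nhds 0. \<exists>D. (F has_derivative D) (at z) \<and> (\<forall>c v. D (c *s v) = c * D v))"

lemma holomorphic_at_origin_const: "holomorphic_at_origin (\<lambda>_. c)"
  unfolding holomorphic_at_origin_def
  by (intro always_eventually allI exI[of _ "\<lambda>_. 0"]) auto

lemma holomorphic_at_origin_add:
  assumes "holomorphic_at_origin F" "holomorphic_at_origin G"
  shows "holomorphic_at_origin (\<lambda>z. F z + G z)"
  using assms unfolding holomorphic_at_origin_def
proof eventually_elim
  case (elim z)
  then obtain D E where "(F has_derivative D) (at z)" "\<forall>c v. D (c *s v) = c * D v"
    "(G has_derivative E) (at z)" "\<forall>c v. E (c *s v) = c * E v" by blast
  then show ?case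
    by (intro exI[of _ "\<lambda>v. D v + E v"]) (auto intro: has_derivative_add simp: algebra_simps)
qed

lemma holomorphic_at_origin_mult:
  assumes "holomorphic_at_origin F" "holomorphic_at_origin G"
  shows "holomorphic_at_origin (\<lambda>z. F z * G z)"
  using assms unfolding holomorphic_at_origin_def
proof eventually_elim
  case (elim z)
  then obtain D E where "(F has_derivative D) (at z)" "\<forall>c v. D (c *s v) = c * D v"
    "(G has_derivative E) (at z)" "\<forall>c v. E (c *s v) = c * E v" by blast
  then show ?case
    by (intro exI[of _ "\<lambda>v. F z * E v + D v * G z"] conjI has_derivative_mult)
       (auto simp: algebra_simps)
qed

lemma holomorphic_at_origin_uminus:
  "holomorphic_at_origin F \<Longrightarrow> holomorphic_at_origin (\<lambda>z. - F z)"
  using holomorphic_at_origin_mult[OF holomorphic_at_origin_const[of "-1"]] by simp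

definition same_germ :: "(complex ^ 'n \<Rightarrow> complex) \<Rightarrow> (complex ^ 'n \<Rightarrow> complex) \<Rightarrow> bool" where
  "same_germ F G \<longleftrightarrow>
     holomorphic_at_origin F \<and> holomorphic_at_origin G \<and> (\<forall>\<^sub>F z in nhds 0. F z = G z)"

lemma same_germ_part_equivp: "part_equivp same_germ"
proof (rule part_equivpI)
  show "\<exists>F. same_germ F F"
    using holomorphic_at_origin_const[of 0] by (auto simp: same_germ_def)
  show "symp same_germ"
    by (auto simp: symp_def same_germ_def elim: eventually_mono)
  show "transp same_germ"
    by (auto simp: transp_def same_germ_def elim: eventually_elim2)
qed

quotient_type 'n holo_germ = "complex ^ 'n \<Rightarrow> complex" / partial: same_germ
  by (rule same_germ_part_equivp)

instantiation holo_germ :: (finite) comm_ring_1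
begin

lift_definition zero_holo_germ :: "'a holo_germ" is "\<lambda>_. 0"
  by (simp add: same_germ_def holomorphic_at_origin_const)

lift_definition one_holo_germ :: "'a holo_germ" is "\<lambda>_. 1"
  by (simp add: same_germ_def holomorphic_at_origin_const)

lift_definition plus_holo_germ :: "'a holo_germ \<Rightarrow> 'a holo_germ \<Rightarrow> 'a holo_germ"
  is "\<lambda>F G z. F z + G z"
  by (auto simp: same_germ_def holomorphic_at_origin_add elim: eventually_elim2)

lift_definition times_holo_germ :: "'a holo_germ \<Rightarrow> 'a holo_germ \<Rightarrow> 'a holo_germ"
  is "\<lambda>F G z. F z * G z"
  by (auto simp: same_germ_def holomorphic_at_origin_mult elim: eventually_elim2)

lift_definition uminus_holo_germ :: "'a holo_germ \<Rightarrow> 'a holo_germ" is "\<lambda>F z. - F z"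
  by (auto simp: same_germ_def holomorphic_at_origin_uminus)

definition minus_holo_germ :: "'a holo_germ \<Rightarrow> 'a holo_germ \<Rightarrow> 'a holo_germ" where
  "minus_holo_germ a b = a + (- b)"

instance
proof
  fix a b c :: "'a holo_germ"
  show "a + b + c = a + (b + c)"
    by transfer (auto simp: same_germ_def algebra_simps intro!: holomorphic_at_origin_add)
  show "a + b = b + a"
    by transfer (auto simp: same_germ_def algebra_simps intro!: holomorphic_at_origin_add)
  show "0 + a = a" by transfer (auto simp: same_germ_def)
  show "- a + a = 0"
    by transfer (auto simp: same_germ_def holomorphic_at_origin_const)
  show "a - b = a + - b" by (simp add: minus_holo_germ_def)
  show "a * b * c = a * (b * c)"
    by transfer (auto simp: same_germ_def mult.assoc intro!: holomorphic_at_origin_mult)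
  show "a * b = b * a"
    by transfer (auto simp: same_germ_def mult.commute intro!: holomorphic_at_origin_mult)
  show "1 * a = a" by transfer (auto simp: same_germ_def)
  show "(a + b) * c = a * c + b * c"
    by transfer (auto simp: same_germ_def distrib_right
        intro!: holomorphic_at_origin_mult holomorphic_at_origin_add)
  show "(0 :: 'a holo_germ) \<noteq> 1"
    by transfer (auto simp: same_germ_def dest: eventually_nhds_x_imp_x)
qed

end

text \<open>\<open>germ F\<close> is meaningful only if \<open>F\<close> is holomorphic near the origin.\<close>

abbreviation germ :: "(complex ^ 'n \<Rightarrow> complex) \<Rightarrow> ('n::finite) holo_germ" where
  "germ \<equiv> abs_holo_germ"

definition scale_germ :: "complex \<Rightarrow> ('n::finite) holo_germ \<Rightarrow> 'n holo_germ" where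
  "scale_germ c h = germ (\<lambda>_. c) * h"

section \<open>Tjurina numbers\<close>

text \<open>The classes of the elements of \<open>B\<close> are pairwise distinct and form a finite basis of the
  quotient of the whole space by the subspace \<open>W\<close>.\<close>

definition quotient_basis :: "(complex \<Rightarrow> 'a \<Rightarrow> 'a) \<Rightarrow> ('a::ab_group_add) set \<Rightarrow> 'a set \<Rightarrow> bool" where
  "quotient_basis smul W B \<longleftrightarrow> finite B \<and>
     (\<forall>v. \<exists>!c. (\<forall>b. b \<notin> B \<longrightarrow> c b = 0) \<and> v - (\<Sum>b\<in>B. smul (c b) b) \<in> W)"

text \<open>All finite bases have the same cardinality; without a finite basis the infimum is \<open>\<infinity>\<close>.\<close>

definition quotient_dim :: "(complex \<Rightarrow> 'a \<Rightarrow> 'a) \<Rightarrow> ('a::ab_group_add) set \<Rightarrow> enat" where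
  "quotient_dim smul W = (INF B\<in>{B. quotient_basis smul W B}. enat (card B))"

definition fun_partial :: "'n \<Rightarrow> (complex ^ 'n \<Rightarrow> complex) \<Rightarrow> complex ^ ('n::finite) \<Rightarrow> complex" where
  "fun_partial i g z = deriv (\<lambda>t. g (z + t *s axis i 1)) 0"

definition tjurina_ideal :: "(complex ^ 'n \<Rightarrow> complex) \<Rightarrow> ('n::finite) holo_germ set" where
  "tjurina_ideal g = module.span (*) (insert (germ g) (range (\<lambda>i. germ (fun_partial i g))))"

definition tjurina :: "(complex ^ ('n::finite) \<Rightarrow> complex) \<Rightarrow> enat" where
  "tjurina g = quotient_dim scale_germ (tjurina_ideal g)"

section \<open>Projective hypersurfaces\<close>

text \<open>A point is the set of all its homogeneous coordinate vectors.\<close>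

definition proj_space :: "(complex ^ ('v::finite)) set set" where
  "proj_space = (- {0}) // {(x, y). \<exists>c. c \<noteq> 0 \<and> y = c *s x}"

text \<open>The quotient topology.\<close>

definition proj_open :: "(complex ^ ('v::finite)) set set \<Rightarrow> bool" where
  "proj_open U \<longleftrightarrow> U \<subseteq> proj_space \<and> open (\<Union>U)"

definition hypersurface :: "('v::finite) mpoly \<Rightarrow> (complex ^ 'v) set set" where
  "hypersurface f = {p \<in> proj_space. \<forall>x\<in>p. poly_eval f x = 0}"

definition singular_points :: "('v::finite) mpoly \<Rightarrow> (complex ^ 'v) set set" where
  "singular_points f = {p \<in> hypersurface f. \<forall>x\<in>p. \<forall>i. poly_eval (poly_partial i f) x = 0}"

definition only_isolated_singularities :: "('v::finite) mpoly \<Rightarrow> bool" where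
  "only_isolated_singularities f \<longleftrightarrow>
     (\<forall>p\<in>singular_points f. \<exists>U. proj_open U \<and> U \<inter> singular_points f = {p})"

text \<open>The linear embedding of $C^n$ as the coordinate hyperplane $x_j = 0$ of $C^{n+1}$. The
  coordinate $y_i$ is placed in position \<open>Some i\<close>, except that for \<open>j = Some i\<close> it is placed in
  the otherwise unused position \<open>None\<close>.\<close>

definition hyperplane_embedding :: "'n option \<Rightarrow> complex ^ 'n \<Rightarrow> complex ^ (('n::finite) option)" where
  "hyperplane_embedding j y =
     (\<chi> k. if k = j then 0 else (case k of Some i \<Rightarrow> y $ i | None \<Rightarrow> y $ the j))"

text \<open>Equations of the hypersurface in an affine chart $x_j = 1$ containing \<open>p\<close>, translated so that
  \<open>p\<close> becomes the origin. The Tjurina number does not depend on the admissible index \<open>j\<close>.\<close>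

definition local_equation ::
  "('n::finite) option mpoly \<Rightarrow> (complex ^ 'n option) set \<Rightarrow> (complex ^ 'n \<Rightarrow> complex) \<Rightarrow> bool" where
  "local_equation f p g \<longleftrightarrow>
     (\<exists>j. \<exists>x\<in>p. x $ j = 1 \<and> g = (\<lambda>y. poly_eval f (x + hyperplane_embedding j y)))"

definition tjurina_at :: "('n::finite) option mpoly \<Rightarrow> (complex ^ 'n option) set \<Rightarrow> enat" where
  "tjurina_at f p = tjurina (SOME g. local_equation f p g)"

text \<open>If all singular points are isolated there are only finitely many, by compactness.\<close>

definition total_tjurina :: "('n::finite) option mpoly \<Rightarrow> enat" where
  "total_tjurina f = (\<Sum>p\<in>singular_points f. tjurina_at f p)"

end

theory Submission
  imports Defs "HOL-Complex_Analysis.Complex_Analysis"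
    "HOL-Computational_Algebra.Fundamental_Theorem_Algebra"
begin

text \<open>
  Choose a linear form \<open>L\<close> that vanishes at no singular point. By the Nullstellensatz and Noether
  normalization, some \<open>n\<close> linear combinations of the partial derivatives form, together with \<open>L\<close>, a
  complete intersection. Let \<open>I\<close> be the ideal of these \<open>n\<close> forms \<open>g\<^sub>j = f\<^sub>j - \<mu>\<^sub>j f\<^sub>i\<close>; the \<open>g\<^sub>j\<close> have only Koszul
  relations, \<open>L\<close> is a nonzerodivisor modulo \<open>I\<close>, and the socle of \<open>S/(I, L)\<close> lies in degree
  \<open>s = n(N - 2)\<close>. A Jacobian relation is a Koszul relation as soon as its coefficient \<open>b\<close> at \<open>f\<^sub>i\<close> lies in \<open>I\<close>.

  Suppose \<open>b\<close>, of degree \<open>m\<close>, is not in \<open>I\<close>, and put \<open>Q = (I : b)\<close>. Since \<open>Q\<close> contains the Jacobian ideal and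
  is saturated, the local Tjurina algebras bound \<open>dim S\<^sub>k/Q\<^sub>k\<close> by \<open>\<tau>\<close> for all \<open>k\<close>. Hence multiplication
  by \<open>L\<close> is onto \<open>S\<^sub>k/Q\<^sub>k\<close> for all \<open>k \<ge> \<tau>\<close>. On the other hand, after division by a power
  of \<open>L\<close> the class of \<open>b\<close> in \<open>S/(I, L)\<close> is nonzero, so it has a nonzero multiple in degree \<open>s\<close>; the
  cofactor has degree at least \<open>s - m \<ge> \<tau>\<close> and so is divisible by \<open>L\<close> modulo \<open>Q\<close>, a contradiction.
\<close>

section \<open>Graded polynomial ring\<close>

text \<open>The constant \<open>n(N - 2)\<close> is \<open>n(d - 1)\<close> for
  \<open>d = N - 1\<close>: modulo \<open>L\<close> there remain \<open>n\<close> forms of degree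
  \<open>d\<close> in \<open>n\<close> variables, and each trade of a variable for a form moves the
  socle up by \<open>d - 1\<close>. The \<open>n + 1\<close> partial derivatives cannot be used all
  at once, since they have relations that are not Koszul as soon as \<open>V\<close> is singular;
  hence one of them, \<open>f\<^sub>i\<close>, is set aside and only its coefficient has to be
  controlled.

  The obstacle is that \<open>\<tau>\<close> counts analytic germs, whereas \<open>Q\<close>
  consists of polynomials. Membership in the Tjurina ideals at all singular points amounts to
  \<open>\<tau>\<close> linear conditions, so among \<open>\<tau> + 1\<close> forms some combination
  \<open>c\<close> satisfies them; it remains to see that \<open>c * b\<close> lies in
  \<open>I\<close>. Near a singular point, Taylor approximation turns the germ identity for
  \<open>c\<close> into an identity of forms, up to an error of arbitrarily high vanishing order.
  The error is harmless because the class of \<open>b\<close> in \<open>S/I\<close>, after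
  multiplication by a form not vanishing at the point, is annihilated by a power of the ideal of
  that point.\<close>

definition homogeneous_component :: "nat \<Rightarrow> ('v::finite) mpoly \<Rightarrow> 'v mpoly" where
  "homogeneous_component m p = Poly_Mapping.mapp (\<lambda>a c. c when monom_degree a = m) p"

lemma lookup_homogeneous_component:
  "Poly_Mapping.lookup (homogeneous_component m p) a = (Poly_Mapping.lookup p a when monom_degree a = m)"
  by (auto simp: homogeneous_component_def lookup_mapp when_def in_keys_iff)

lemma homogeneous_part_iff:
  "p \<in> homogeneous_part m \<longleftrightarrow> (\<forall>a. Poly_Mapping.lookup p a \<noteq> 0 \<longrightarrow> monom_degree a = m)"
  by (auto simp: homogeneous_part_def in_keys_iff)

lemma homogeneous_component_in [simp]: "homogeneous_component m p \<in> homogeneous_part m"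
  by (auto simp: homogeneous_part_iff lookup_homogeneous_component)

lemma homogeneous_component_homogeneous:
  "p \<in> homogeneous_part k \<Longrightarrow> homogeneous_component m p = (if m = k then p else 0)"
  by (rule poly_mapping_eqI) (auto simp: homogeneous_part_iff lookup_homogeneous_component when_def)

lemma homogeneous_component_add:
  "homogeneous_component m (p + q) = homogeneous_component m p + homogeneous_component m q"
  by (rule poly_mapping_eqI) (auto simp: lookup_homogeneous_component lookup_add when_def)

lemma homogeneous_component_diff:
  "homogeneous_component m (p - q) = homogeneous_component m p - homogeneous_component m q"
  by (rule poly_mapping_eqI) (auto simp: lookup_homogeneous_component lookup_minus when_def)

lemma homogeneous_component_uminus:
  "homogeneous_component m (- p) = - homogeneous_component m p"
  by (rule poly_mapping_eqI) (auto simp: lookup_homogeneous_component when_def)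

lemma homogeneous_component_0 [simp]: "homogeneous_component m 0 = 0"
  by (rule poly_mapping_eqI) (auto simp: lookup_homogeneous_component)

lemma homogeneous_component_sum:
  "homogeneous_component m (\<Sum>x\<in>A. p x) = (\<Sum>x\<in>A. homogeneous_component m (p x))"
  by (induction A rule: infinite_finite_induct) (auto simp: homogeneous_component_add)

lemma homogeneous_part_0 [simp]: "0 \<in> homogeneous_part m"
  by (auto simp: homogeneous_part_iff)

lemma homogeneous_part_add: "p \<in> homogeneous_part m \<Longrightarrow> q \<in> homogeneous_part m \<Longrightarrow> p + q \<in> homogeneous_part m"
  by (metis homogeneous_component_add homogeneous_component_homogeneous homogeneous_component_in)

lemma homogeneous_part_diff: "p \<in> homogeneous_part m \<Longrightarrow> q \<in> homogeneous_part m \<Longrightarrow> p - q \<in> homogeneous_part m"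
  by (metis homogeneous_component_diff homogeneous_component_homogeneous homogeneous_component_in)

lemma homogeneous_part_sum: "(\<And>x. x \<in> A \<Longrightarrow> p x \<in> homogeneous_part m) \<Longrightarrow> (\<Sum>x\<in>A. p x) \<in> homogeneous_part m"
  by (induction A rule: infinite_finite_induct) (auto simp: homogeneous_part_add)

lemma monom_degree_add: "monom_degree (a + b) = monom_degree a + monom_degree b"
  by (simp add: monom_degree_def lookup_add sum.distrib)

lemma homogeneous_part_mult:
  assumes "p \<in> homogeneous_part a" "q \<in> homogeneous_part b"
  shows "p * q \<in> homogeneous_part (a + b)"
  using assms keys_mult[of p q] by (fastforce simp: homogeneous_part_def monom_degree_add)

lemma monom_degree_0 [simp]: "monom_degree 0 = 0"
  by (simp add: monom_degree_def)

lemma homogeneous_part_single: "Poly_Mapping.single a c \<in> homogeneous_part (monom_degree a)"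
  by (auto simp: homogeneous_part_def split: if_splits)

lemma homogeneous_part_1: "1 \<in> homogeneous_part 0"
  using homogeneous_part_single[of 0 1] by simp

lemma homogeneous_part_power:
  assumes "p \<in> homogeneous_part a" shows "p ^ k \<in> homogeneous_part (k * a)"
  by (induction k) (use homogeneous_part_mult[OF assms] homogeneous_part_1 in auto)

text \<open>Stated for all large bounds, so that several polynomials can share one bound and two
  consecutive bounds can be compared.\<close>

lemma homogeneous_decomposition:
  obtains D where "\<And>E. D \<le> E \<Longrightarrow> p = (\<Sum>k\<le>E. homogeneous_component k p)"
proof
  fix E assume E: "Max (insert 0 (monom_degree ` Poly_Mapping.keys p)) \<le> E"
  show "p = (\<Sum>k\<le>E. homogeneous_component k p)"
  proof (rule poly_mapping_eqI)
    fix a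
    have "monom_degree a \<le> E" if "Poly_Mapping.lookup p a \<noteq> 0"
      using E that by (simp add: in_keys_iff)
    then show "Poly_Mapping.lookup p a = Poly_Mapping.lookup (\<Sum>k\<le>E. homogeneous_component k p) a"
      by (auto simp: lookup_sum lookup_homogeneous_component when_def)
  qed
qed

lemma homogeneous_component_mult:
  assumes q: "q \<in> homogeneous_part d"
  shows "homogeneous_component m (p * q) = (if d \<le> m then homogeneous_component (m - d) p * q else 0)"
proof -
  obtain D where D: "\<And>E. D \<le> E \<Longrightarrow> p = (\<Sum>k\<le>E. homogeneous_component k p)"
    using homogeneous_decomposition[of p] by blast
  define E where "E = max D m"
  have p: "p = (\<Sum>k\<le>E. homogeneous_component k p)" using D by (simp add: E_def)
  have "homogeneous_component m (p * q) = (\<Sum>k\<le>E. homogeneous_component m (homogeneous_component k p * q))"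
    by (subst p) (simp add: sum_distrib_right homogeneous_component_sum)
  also have "\<dots> = (\<Sum>k\<le>E. if m = k + d then homogeneous_component k p * q else 0)"
    by (intro sum.cong refl homogeneous_component_homogeneous homogeneous_part_mult q) auto
  also have "\<dots> = (\<Sum>k\<le>E. if k = m - d then (if d \<le> m then homogeneous_component (m - d) p * q else 0) else 0)"
    by (intro sum.cong) auto
  also have "\<dots> = (if d \<le> m then homogeneous_component (m - d) p * q else 0)"
    by (subst sum.delta) (auto simp: E_def)
  finally show ?thesis .
qed

definition Const :: "complex \<Rightarrow> ('v::finite) mpoly" where "Const c = Poly_Mapping.single 0 c"
definition Var :: "'v \<Rightarrow> ('v::finite) mpoly" where "Var v = Poly_Mapping.single (Poly_Mapping.single v 1) 1"

lemma monom_degree_single [simp]: "monom_degree (Poly_Mapping.single v k) = k"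
  by (simp add: monom_degree_def lookup_single when_def)

lemma Const_hom: "Const c \<in> homogeneous_part 0"
  unfolding Const_def using homogeneous_part_single[of 0 c] by simp

lemma Var_hom: "Var v \<in> homogeneous_part 1"
  unfolding Var_def using homogeneous_part_single[of "Poly_Mapping.single v 1" 1] by simp

lemma Const_mult: "Const (a * b) = Const a * Const b" by (simp add: Const_def mult_single)
lemma Const_add: "Const (a + b) = Const a + Const b" by (simp add: Const_def single_add)
lemma Const_diff: "Const (a - b) = Const a - Const b" by (simp add: Const_def single_diff)
lemma Const_0 [simp]: "Const 0 = 0" by (simp add: Const_def)
lemma Const_1 [simp]: "Const 1 = 1" by (simp add: Const_def)
lemma Const_power: "Const (a ^ k) = Const a ^ k" by (induction k) (auto simp: Const_mult)
lemma Const_sum: "Const (\<Sum>x\<in>A. c x) = (\<Sum>x\<in>A. Const (c x))"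
  by (induction A rule: infinite_finite_induct) (auto simp: Const_add)
lemma Const_eq_0_iff [simp]: "Const c = 0 \<longleftrightarrow> c = 0"
  by (metis Const_0 Const_def lookup_single_eq)

lemma homogeneous_part_Const_mult:
  "p \<in> homogeneous_part m \<Longrightarrow> Const c * p \<in> homogeneous_part m"
  using homogeneous_part_mult[OF Const_hom] by fastforce

lemma single_eq_Const_mult_prod:
  "Poly_Mapping.single a c = Const c * (\<Prod>v\<in>UNIV. Var v ^ Poly_Mapping.lookup a v)"
proof -
  have pw: "Var v ^ k = Poly_Mapping.single (Poly_Mapping.single v k) 1" for v :: 'a and k
    by (induction k) (auto simp: Var_def mult_single simp flip: single_add)
  have "(\<Prod>v\<in>A. Var v ^ Poly_Mapping.lookup a v) =
      Poly_Mapping.single (\<Sum>v\<in>A. Poly_Mapping.single v (Poly_Mapping.lookup a v)) 1" if "finite A" for A :: "'a set"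
    using that by (induction A) (auto simp: pw mult_single)
  moreover have "(\<Sum>v\<in>UNIV. Poly_Mapping.single v (Poly_Mapping.lookup a v)) = a"
    by (rule poly_mapping_eqI) (simp add: lookup_sum lookup_single when_def)
  ultimately show ?thesis by (simp add: Const_def mult_single)
qed

lemma mpoly_eq_sum_single:
  "p = (\<Sum>a\<in>Poly_Mapping.keys p. Poly_Mapping.single a (Poly_Mapping.lookup p a))"
  by (rule poly_mapping_eqI) (auto simp: lookup_sum lookup_single when_def in_keys_iff)

lemma mpoly_induct [case_names monom add]:
  assumes "\<And>a c. P (Poly_Mapping.single a c)" "\<And>p q. P p \<Longrightarrow> P q \<Longrightarrow> P (p + q)"
  shows "P (p :: ('v::finite) mpoly)"
proof -
  have "P 0" using assms(1)[of 0 0] by simp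
  have "P (\<Sum>a\<in>A. Poly_Mapping.single a (Poly_Mapping.lookup p a))" if "finite A" for A
    using that by (induction A) (auto intro: assms \<open>P 0\<close>)
  then show ?thesis by (subst mpoly_eq_sum_single) auto
qed

section \<open>Ideals and Koszul relations modulo an ideal\<close>

definition is_ideal :: "'a::comm_ring_1 set \<Rightarrow> bool" where
  "is_ideal I \<longleftrightarrow> 0 \<in> I \<and> (\<forall>p\<in>I. \<forall>q\<in>I. p + q \<in> I) \<and> (\<forall>p\<in>I. \<forall>r. r * p \<in> I)"

lemma ideal_0: "is_ideal I \<Longrightarrow> 0 \<in> I"
  and ideal_add: "is_ideal I \<Longrightarrow> p \<in> I \<Longrightarrow> q \<in> I \<Longrightarrow> p + q \<in> I"
  and ideal_mult: "is_ideal I \<Longrightarrow> p \<in> I \<Longrightarrow> r * p \<in> I"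
  by (auto simp: is_ideal_def)

lemma ideal_mult_right: "is_ideal I \<Longrightarrow> p \<in> I \<Longrightarrow> p * r \<in> I"
  by (metis ideal_mult mult.commute)

lemma ideal_uminus: "is_ideal I \<Longrightarrow> p \<in> I \<Longrightarrow> - p \<in> I"
  using ideal_mult[of I p "-1"] by simp

lemma ideal_diff: "is_ideal I \<Longrightarrow> p \<in> I \<Longrightarrow> q \<in> I \<Longrightarrow> p - q \<in> I"
  by (metis ideal_add ideal_uminus add_uminus_conv_diff)

lemma ideal_sum: "is_ideal I \<Longrightarrow> (\<And>x. x \<in> A \<Longrightarrow> p x \<in> I) \<Longrightarrow> (\<Sum>x\<in>A. p x) \<in> I"
  by (induction A rule: infinite_finite_induct) (auto simp: ideal_0 ideal_add)

lemma ideal_cong: "is_ideal I \<Longrightarrow> p - q \<in> I \<Longrightarrow> p \<in> I \<longleftrightarrow> q \<in> I"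
  by (metis diff_add_cancel ideal_add ideal_diff diff_diff_eq2 add_diff_cancel_left')

lemma ideal_trans: "is_ideal I \<Longrightarrow> p - q \<in> I \<Longrightarrow> q - r \<in> I \<Longrightarrow> p - r \<in> I"
  using ideal_add[of I "p - q" "q - r"] by simp

definition homogeneous_ideal :: "('v::finite) mpoly set \<Rightarrow> bool" where
  "homogeneous_ideal I \<longleftrightarrow> is_ideal I \<and> (\<forall>p\<in>I. \<forall>m. homogeneous_component m p \<in> I)"

text \<open>Quotient rings are replaced by congruences: \<open>adjoin t I\<close> and \<open>gen \<theta> X I\<close> are the ideals
  generated by \<open>I\<close> together with \<open>t\<close>, respectively all \<open>\<theta> j\<close> with \<open>j \<in> X\<close>.\<close>

definition adjoin :: "'a::comm_ring_1 \<Rightarrow> 'a set \<Rightarrow> 'a set" where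
  "adjoin t I = {p. \<exists>e. p - e * t \<in> I}"

definition gen :: "('i \<Rightarrow> 'a) \<Rightarrow> 'i set \<Rightarrow> 'a::comm_ring_1 set \<Rightarrow> 'a set" where
  "gen \<theta> X I = {p. \<exists>a. p - (\<Sum>j\<in>X. a j * \<theta> j) \<in> I}"

definition regular_mod :: "'a::comm_ring_1 \<Rightarrow> 'a set \<Rightarrow> bool" where
  "regular_mod t I \<longleftrightarrow> (\<forall>p. t * p \<in> I \<longrightarrow> p \<in> I)"

text \<open>Vanishing of the first Koszul homology of the family over the quotient by
  \<open>I\<close>: relations come from skew matrices. Over complex polynomials skewness forces the
  diagonal to be 0.\<close>

definition only_koszul :: "('i \<Rightarrow> 'a) \<Rightarrow> 'i set \<Rightarrow> 'a::comm_ring_1 set \<Rightarrow> bool" where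
  "only_koszul \<theta> X I \<longleftrightarrow> (\<forall>a. (\<Sum>j\<in>X. a j * \<theta> j) \<in> I \<longrightarrow>
     (\<exists>B. (\<forall>i j. B i j = - B j i) \<and> (\<forall>i\<in>X. a i - (\<Sum>j\<in>X. B i j * \<theta> j) \<in> I)))"

lemma is_ideal_adjoin: assumes "is_ideal I" shows "is_ideal (adjoin t I)"
  unfolding is_ideal_def
proof (intro conjI ballI allI)
  show "0 \<in> adjoin t I" by (auto simp: adjoin_def intro!: exI[of _ 0] ideal_0[OF assms])
next
  fix p q assume "p \<in> adjoin t I" "q \<in> adjoin t I"
  then obtain e f where "p - e * t \<in> I" "q - f * t \<in> I" by (auto simp: adjoin_def)
  then have "(p + q) - (e + f) * t \<in> I" using ideal_add[OF assms] by (fastforce simp: algebra_simps)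
  then show "p + q \<in> adjoin t I" by (auto simp: adjoin_def)
next
  fix p r assume "p \<in> adjoin t I"
  then obtain e where "p - e * t \<in> I" by (auto simp: adjoin_def)
  then have "r * p - (r * e) * t \<in> I" using ideal_mult[OF assms, of _ r] by (fastforce simp: algebra_simps)
  then show "r * p \<in> adjoin t I" by (auto simp: adjoin_def)
qed

lemma gen_empty [simp]: "gen \<theta> {} I = I"
  by (simp add: gen_def)

lemma gen_insert: "finite X \<Longrightarrow> i \<notin> X \<Longrightarrow> gen \<theta> (insert i X) I = adjoin (\<theta> i) (gen \<theta> X I)"
proof (intro set_eqI iffI)
  fix p assume X: "finite X" "i \<notin> X" and "p \<in> adjoin (\<theta> i) (gen \<theta> X I)"
  then obtain e a where "p - e * \<theta> i - (\<Sum>j\<in>X. a j * \<theta> j) \<in> I" by (auto simp: gen_def adjoin_def)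
  moreover have "(\<Sum>j\<in>X. a j * \<theta> j) = (\<Sum>j\<in>X. (a(i:=e)) j * \<theta> j)"
    using X by (intro sum.cong) auto
  ultimately have "p - (\<Sum>j\<in>insert i X. (a(i:=e)) j * \<theta> j) \<in> I"
    using X by (simp add: algebra_simps)
  then show "p \<in> gen \<theta> (insert i X) I" unfolding gen_def by blast
next
  fix p assume X: "finite X" "i \<notin> X" and "p \<in> gen \<theta> (insert i X) I"
  then obtain a where "p - (\<Sum>j\<in>insert i X. a j * \<theta> j) \<in> I" by (auto simp: gen_def)
  then have "p - a i * \<theta> i - (\<Sum>j\<in>X. a j * \<theta> j) \<in> I" using X by (simp add: algebra_simps)
  then show "p \<in> adjoin (\<theta> i) (gen \<theta> X I)" by (auto simp: gen_def adjoin_def)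
qed

lemma is_ideal_gen: "finite X \<Longrightarrow> is_ideal I \<Longrightarrow> is_ideal (gen \<theta> X I)"
  by (induction X rule: finite_induct) (auto simp: gen_insert is_ideal_adjoin)

lemma adjoin_subset: "is_ideal I \<Longrightarrow> I \<subseteq> adjoin t I"
  by (auto simp: adjoin_def intro!: exI[of _ 0])

lemma adjoin_mem: "is_ideal I \<Longrightarrow> t \<in> adjoin t I"
  by (auto simp: adjoin_def intro!: exI[of _ 1] ideal_0)

lemma adjoin_least:
  assumes J: "is_ideal J" "I \<subseteq> J" "t \<in> J" shows "adjoin t I \<subseteq> J"
proof
  fix p assume "p \<in> adjoin t I"
  then obtain e where "p - e * t \<in> J" using J(2) by (auto simp: adjoin_def)
  moreover have "e * t \<in> J" by (intro ideal_mult J)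
  ultimately show "p \<in> J" using ideal_cong[OF J(1)] by blast
qed

lemma gen_subset: "I \<subseteq> gen \<theta> X I"
  by (auto simp: gen_def intro!: exI[of _ "\<lambda>_. 0"])

lemma gen_mem: "finite X \<Longrightarrow> is_ideal I \<Longrightarrow> j \<in> X \<Longrightarrow> \<theta> j \<in> gen \<theta> X I"
  unfolding gen_def
  by (auto intro!: exI[of _ "\<lambda>i. if i = j then 1 else 0"] simp: if_distrib if_distribR sum.delta ideal_0 cong: if_cong)

lemma gen_least:
  assumes J: "is_ideal J" "I \<subseteq> J" "\<And>j. j \<in> X \<Longrightarrow> \<theta> j \<in> J" shows "gen \<theta> X I \<subseteq> J"
proof
  fix p assume "p \<in> gen \<theta> X I"
  then obtain a where "p - (\<Sum>j\<in>X. a j * \<theta> j) \<in> J" using J(2) by (auto simp: gen_def)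
  moreover have "(\<Sum>j\<in>X. a j * \<theta> j) \<in> J" by (intro ideal_sum ideal_mult J)
  ultimately show "p \<in> J" using ideal_cong[OF J(1)] by blast
qed

lemma gen_adjoin:
  assumes "finite X" "is_ideal I" shows "gen \<theta> X (adjoin t I) = adjoin t (gen \<theta> X I)"
proof
  have i: "is_ideal (adjoin t I)" "is_ideal (gen \<theta> X I)" using assms by (auto intro: is_ideal_adjoin is_ideal_gen)
  have "I \<subseteq> adjoin t (gen \<theta> X I)" "\<And>j. j \<in> X \<Longrightarrow> \<theta> j \<in> adjoin t (gen \<theta> X I)"
    using adjoin_subset[OF i(2), of t] gen_subset[of I \<theta> X] gen_mem[OF assms, of _ \<theta>] by auto
  then show "gen \<theta> X (adjoin t I) \<subseteq> adjoin t (gen \<theta> X I)"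
    using i by (intro gen_least adjoin_least adjoin_mem) (auto intro: is_ideal_adjoin)
  have "I \<subseteq> gen \<theta> X (adjoin t I)" "t \<in> gen \<theta> X (adjoin t I)"
    "\<And>j. j \<in> X \<Longrightarrow> \<theta> j \<in> gen \<theta> X (adjoin t I)"
    using adjoin_subset[OF assms(2), of t] adjoin_mem[OF assms(2), of t] gen_subset[of "adjoin t I" \<theta> X]
      gen_mem[OF assms(1) i(1), of _ \<theta>] by auto
  then show "adjoin t (gen \<theta> X I) \<subseteq> gen \<theta> X (adjoin t I)"
    using assms i by (intro gen_least adjoin_least) (auto intro: is_ideal_gen)
qed

lemma homogeneous_ideal_adjoin:
  assumes "homogeneous_ideal I" "t \<in> homogeneous_part d" shows "homogeneous_ideal (adjoin t I)"
  unfolding homogeneous_ideal_def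
proof (intro conjI ballI allI)
  show "is_ideal (adjoin t I)" using assms by (auto simp: homogeneous_ideal_def is_ideal_adjoin)
  fix p m assume "p \<in> adjoin t I"
  then obtain e where e: "p - e * t \<in> I" by (auto simp: adjoin_def)
  then have "homogeneous_component m p - homogeneous_component m (e * t) \<in> I"
    using assms(1) by (metis homogeneous_component_diff homogeneous_ideal_def)
  then have "homogeneous_component m p - (if d \<le> m then homogeneous_component (m - d) e else 0) * t \<in> I"
    by (simp add: homogeneous_component_mult[OF assms(2)] split: if_splits)
  then show "homogeneous_component m p \<in> adjoin t I" unfolding adjoin_def by blast
qed

lemma homogeneous_ideal_gen:
  "finite X \<Longrightarrow> homogeneous_ideal I \<Longrightarrow> (\<And>j. j \<in> X \<Longrightarrow> \<theta> j \<in> homogeneous_part d) \<Longrightarrow> homogeneous_ideal (gen \<theta> X I)"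
  by (induction X rule: finite_induct) (auto simp: gen_insert intro: homogeneous_ideal_adjoin)

lemma homogeneous_idealD: "homogeneous_ideal I \<Longrightarrow> is_ideal I"
  by (simp add: homogeneous_ideal_def)

text \<open>The cofactor may be replaced by its component of degree \<open>m - d\<close>. The last
  conclusion repairs the truncated subtraction: in degrees below \<open>d\<close> the cofactor is 0
  and not some constant.\<close>

lemma homogeneous_adjoinE:
  assumes "homogeneous_ideal I" "t \<in> homogeneous_part d" "p \<in> adjoin t I" "p \<in> homogeneous_part m"
  obtains e where "p - e * t \<in> I" "e \<in> homogeneous_part (m - d)" "m < d \<Longrightarrow> e = 0"
proof -
  obtain e where e: "p - e * t \<in> I" using assms(3) by (auto simp: adjoin_def)
  then have "homogeneous_component m p - homogeneous_component m (e * t) \<in> I"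
    using assms(1) by (metis homogeneous_component_diff homogeneous_ideal_def)
  then have "p - (if d \<le> m then homogeneous_component (m - d) e else 0) * t \<in> I"
    using assms(4) by (simp add: homogeneous_component_mult[OF assms(2)] homogeneous_component_homogeneous split: if_splits)
  then show thesis by (rule that) auto
qed

section \<open>Skew matrices and the exchange of regular elements\<close>

lemma mpoly_double_eq_0:
  fixes p :: "('v::finite) mpoly" assumes "p + p = 0" shows "p = 0"
proof (rule poly_mapping_eqI)
  fix a
  have "Poly_Mapping.lookup p a + Poly_Mapping.lookup p a = 0"
    using arg_cong[OF assms, of "\<lambda>q. Poly_Mapping.lookup q a"] by (simp only: lookup_add lookup_zero)
  then show "Poly_Mapping.lookup p a = Poly_Mapping.lookup 0 a" by auto
qed

lemma skew_sum_0:
  fixes B :: "'i \<Rightarrow> 'i \<Rightarrow> ('v::finite) mpoly"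
  assumes "\<And>i j. B i j = - B j i"
  shows "(\<Sum>i\<in>X. (\<Sum>j\<in>X. B i j * t j) * t i) = 0"
proof -
  let ?s = "\<Sum>i\<in>X. \<Sum>j\<in>X. B i j * t j * t i"
  have "?s = (\<Sum>j\<in>X. \<Sum>i\<in>X. B i j * t j * t i)" by (rule sum.swap)
  also have "\<dots> = (\<Sum>j\<in>X. \<Sum>i\<in>X. - (B j i * t i * t j))"
    by (subst assms) (simp add: ac_simps)
  also have "\<dots> = - ?s" by (simp add: sum_negf)
  finally have "?s + ?s = 0" by simp
  then have "?s = 0" by (rule mpoly_double_eq_0)
  then show ?thesis by (simp add: sum_distrib_right)
qed

text \<open>Pairing the coefficients with \<open>\<theta>\<close> kills their skew part. A relation
  thus passes from the \<open>a i\<close> to the remainders \<open>c i\<close>.\<close>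

lemma koszul_relation_in_ideal:
  fixes \<theta> :: "'i \<Rightarrow> ('v::finite) mpoly"
  assumes I: "is_ideal I" and B: "\<And>i j. B i j = - B j i"
    and a: "\<And>i. i \<in> X \<Longrightarrow> a i - (\<Sum>j\<in>X. B i j * \<theta> j) - c i \<in> I"
  shows "(\<Sum>i\<in>X. a i * \<theta> i) - (\<Sum>i\<in>X. c i * \<theta> i) \<in> I"
proof -
  have "(\<Sum>i\<in>X. (a i - (\<Sum>j\<in>X. B i j * \<theta> j) - c i) * \<theta> i) \<in> I"
    by (intro ideal_sum ideal_mult_right I a)
  then show ?thesis
    using skew_sum_0[of B \<theta> X, OF B] by (simp add: left_diff_distrib sum_subtractf)
qed

text \<open>Exchange of a regular element past a family. If \<open>t * p\<close> is a combination of
  the \<open>\<theta> j\<close>, its coefficients form a relation modulo \<open>t\<close>, hence are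
  a skew part plus \<open>c i * t\<close>; the skew part contributes nothing and \<open>t\<close>
  can be cancelled.\<close>

lemma regular_mod_gen:
  fixes \<theta> :: "'i \<Rightarrow> ('v::finite) mpoly"
  assumes X: "finite X" and I: "is_ideal I" and t: "regular_mod t I" and K: "only_koszul \<theta> X (adjoin t I)"
  shows "regular_mod t (gen \<theta> X I)"
  unfolding regular_mod_def
proof (intro allI impI)
  fix p assume "t * p \<in> gen \<theta> X I"
  then obtain a where a: "t * p - (\<Sum>j\<in>X. a j * \<theta> j) \<in> I" by (auto simp: gen_def)
  have "- (t * p - (\<Sum>j\<in>X. a j * \<theta> j)) \<in> I" using ideal_uminus[OF I a] .
  then have "(\<Sum>j\<in>X. a j * \<theta> j) \<in> adjoin t I"
    by (auto simp: adjoin_def algebra_simps intro!: exI[of _ p])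
  then obtain B where B: "\<And>i j. B i j = - B j i"
    and *: "\<And>i. i\<in>X \<Longrightarrow> a i - (\<Sum>j\<in>X. B i j * \<theta> j) \<in> adjoin t I"
    using K unfolding only_koszul_def by blast
  have "\<forall>i\<in>X. \<exists>c. a i - (\<Sum>j\<in>X. B i j * \<theta> j) - c * t \<in> I" using * by (auto simp: adjoin_def)
  then obtain c where c: "\<And>i. i\<in>X \<Longrightarrow> a i - (\<Sum>j\<in>X. B i j * \<theta> j) - c i * t \<in> I" by metis
  have "(\<Sum>i\<in>X. a i * \<theta> i) - (\<Sum>i\<in>X. c i * t * \<theta> i) \<in> I"
    by (rule koszul_relation_in_ideal[OF I B c])
  from ideal_trans[OF I a this] have "t * (p - (\<Sum>i\<in>X. c i * \<theta> i)) \<in> I"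
    by (simp add: right_diff_distrib sum_distrib_left ac_simps)
  then have "p - (\<Sum>i\<in>X. c i * \<theta> i) \<in> I" using t by (auto simp: regular_mod_def)
  then show "p \<in> gen \<theta> X I" by (auto simp: gen_def)
qed

text \<open>Because all \<open>\<theta> j\<close> have the same degree, a relation splits into
  relations whose coefficients are forms of one degree; their skew matrices are added up.\<close>

lemma only_koszul_homogeneousI:
  fixes \<theta> :: "'i \<Rightarrow> ('v::finite) mpoly"
  assumes X: "finite X" and I: "homogeneous_ideal I" and \<theta>: "\<And>j. j \<in> X \<Longrightarrow> \<theta> j \<in> homogeneous_part d"
    and H: "\<And>m a. (\<And>j. j \<in> X \<Longrightarrow> a j \<in> homogeneous_part m) \<Longrightarrow> (\<Sum>j\<in>X. a j * \<theta> j) \<in> I \<Longrightarrow>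
      \<exists>B. (\<forall>i j. B i j = - B j i) \<and> (\<forall>i\<in>X. a i - (\<Sum>j\<in>X. B i j * \<theta> j) \<in> I)"
  shows "only_koszul \<theta> X I"
  unfolding only_koszul_def
proof (intro allI impI)
  fix a assume a: "(\<Sum>j\<in>X. a j * \<theta> j) \<in> I"
  have "\<exists>B. (\<forall>i j. B i j = - B j i) \<and> (\<forall>i\<in>X. homogeneous_component k (a i) - (\<Sum>j\<in>X. B i j * \<theta> j) \<in> I)" for k
  proof (rule H[where m = k])
    have "homogeneous_component (k + d) (\<Sum>j\<in>X. a j * \<theta> j) \<in> I"
      using I a by (auto simp: homogeneous_ideal_def)
    also have "homogeneous_component (k + d) (\<Sum>j\<in>X. a j * \<theta> j) = (\<Sum>j\<in>X. homogeneous_component k (a j) * \<theta> j)"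
      by (simp add: homogeneous_component_sum homogeneous_component_mult[OF \<theta>])
    finally show "(\<Sum>j\<in>X. homogeneous_component k (a j) * \<theta> j) \<in> I" .
  qed auto
  then obtain B where B: "\<And>k i j. B k i j = - B k j i"
    and *: "\<And>k i. i\<in>X \<Longrightarrow> homogeneous_component k (a i) - (\<Sum>j\<in>X. B k i j * \<theta> j) \<in> I" by metis
  have "\<forall>i. \<exists>D. \<forall>E\<ge>D. a i = (\<Sum>k\<le>E. homogeneous_component k (a i))"
    using homogeneous_decomposition by metis
  then obtain D where D: "\<And>i E. E \<ge> D i \<Longrightarrow> a i = (\<Sum>k\<le>E. homogeneous_component k (a i))" by metis
  define E where "E = (\<Sum>i\<in>X. D i)"
  have E: "a i = (\<Sum>k\<le>E. homogeneous_component k (a i))" if "i \<in> X" for i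
    using that X by (intro D) (auto simp: E_def intro: member_le_sum)
  show "\<exists>B. (\<forall>i j. B i j = - B j i) \<and> (\<forall>i\<in>X. a i - (\<Sum>j\<in>X. B i j * \<theta> j) \<in> I)"
  proof (intro exI[of _ "\<lambda>i j. \<Sum>k\<le>E. B k i j"] conjI allI ballI)
    fix i j show "(\<Sum>k\<le>E. B k i j) = - (\<Sum>k\<le>E. B k j i)"
      by (subst sum_negf[symmetric]) (rule sum.cong[OF refl], rule B)
  next
    fix i assume i: "i \<in> X"
    have "(\<Sum>k\<le>E. homogeneous_component k (a i) - (\<Sum>j\<in>X. B k i j * \<theta> j)) \<in> I"
      by (intro ideal_sum homogeneous_idealD I *[OF i])
    moreover have "(\<Sum>j\<in>X. (\<Sum>k\<le>E. B k i j) * \<theta> j) = (\<Sum>k\<le>E. \<Sum>j\<in>X. B k i j * \<theta> j)"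
      by (simp add: sum_distrib_right) (rule sum.swap)
    ultimately show "a i - (\<Sum>j\<in>X. (\<Sum>k\<le>E. B k i j) * \<theta> j) \<in> I"
      by (subst E[OF i]) (simp add: sum_subtractf)
  qed
qed

lemma if_mult: "(if c then x else 0) * y = (if c then x * y else (0 :: 'a :: semiring_0))"
  by simp

text \<open>Graded Nakayama argument, by induction on the degree of the coefficients. Modulo
  \<open>t\<close> they come from a skew matrix \<open>B\<close>; the error is
  \<open>c i * t\<close>, and since \<open>t\<close> is regular the \<open>c i\<close> form a
  relation of degree one less, given by a skew \<open>C\<close>. Then \<open>B + t * C\<close>
  works.\<close>

lemma only_koszul_lift:
  fixes \<theta> :: "'i \<Rightarrow> ('v::finite) mpoly"
  assumes X: "finite X" and I: "homogeneous_ideal I" and \<theta>: "\<And>j. j \<in> X \<Longrightarrow> \<theta> j \<in> homogeneous_part d"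
    and t: "t \<in> homogeneous_part 1" "regular_mod t I" and K: "only_koszul \<theta> X (adjoin t I)"
  shows "only_koszul \<theta> X I"
proof (rule only_koszul_homogeneousI[OF X I \<theta>])
  note Ii = homogeneous_idealD[OF I]
  fix m a assume "\<And>j. j \<in> X \<Longrightarrow> a j \<in> homogeneous_part m" "(\<Sum>j\<in>X. a j * \<theta> j) \<in> I"
  then show "\<exists>B. (\<forall>i j. B i j = - B j i) \<and> (\<forall>i\<in>X. a i - (\<Sum>j\<in>X. B i j * \<theta> j) \<in> I)"
  proof (induction m arbitrary: a)
    case (0 a)
    have "(\<Sum>j\<in>X. a j * \<theta> j) \<in> adjoin t I" using 0 adjoin_subset[OF Ii] by blast
    then obtain B where B: "\<And>i j. B i j = - B j i"
      and *: "\<And>i. i\<in>X \<Longrightarrow> a i - (\<Sum>j\<in>X. B i j * \<theta> j) \<in> adjoin t I"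
      using K unfolding only_koszul_def by blast
    \<comment> \<open>The component of \<open>B\<close> of degree \<open>- d\<close>, which is 0
      unless \<open>d = 0\<close>. In degree 0 the error \<open>c * t\<close> disappears because
      \<open>t\<close> has degree 1.\<close>
    define B1 where "B1 i j = (if d \<le> 0 then homogeneous_component (0 - d) (B i j) else 0)" for i j
    have "a i - (\<Sum>j\<in>X. B1 i j * \<theta> j) \<in> I" if iX: "i \<in> X" for i
    proof -
      obtain c where "a i - (\<Sum>j\<in>X. B i j * \<theta> j) - c * t \<in> I" using *[OF iX] by (auto simp: adjoin_def)
      then have "homogeneous_component 0 (a i - (\<Sum>j\<in>X. B i j * \<theta> j) - c * t) \<in> I"
        using I by (auto simp: homogeneous_ideal_def)
      then show ?thesis using 0(1)[OF iX]
        by (auto simp: homogeneous_component_diff homogeneous_component_sum homogeneous_component_mult[OF \<theta>]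
            homogeneous_component_mult[OF t(1)] homogeneous_component_homogeneous B1_def if_mult cong: sum.cong)
    qed
    moreover have "B1 i j = - B1 j i" for i j unfolding B1_def
      by (subst B) (simp add: homogeneous_component_uminus)
    ultimately show ?case by blast
  next
    case (Suc m a)
    have "(\<Sum>j\<in>X. a j * \<theta> j) \<in> adjoin t I" using Suc adjoin_subset[OF Ii] by blast
    then obtain B where B: "\<And>i j. B i j = - B j i"
      and *: "\<And>i. i\<in>X \<Longrightarrow> a i - (\<Sum>j\<in>X. B i j * \<theta> j) \<in> adjoin t I"
      using K unfolding only_koszul_def by blast
    define B1 where "B1 i j = (if d \<le> Suc m then homogeneous_component (Suc m - d) (B i j) else 0)" for i j
    have "\<exists>c. c \<in> homogeneous_part m \<and> a i - (\<Sum>j\<in>X. B1 i j * \<theta> j) - c * t \<in> I" if iX: "i \<in> X" for i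
    proof -
      obtain c where "a i - (\<Sum>j\<in>X. B i j * \<theta> j) - c * t \<in> I" using *[OF iX] by (auto simp: adjoin_def)
      then have "homogeneous_component (Suc m) (a i - (\<Sum>j\<in>X. B i j * \<theta> j) - c * t) \<in> I"
        using I by (auto simp: homogeneous_ideal_def)
      then have "a i - (\<Sum>j\<in>X. B1 i j * \<theta> j) - homogeneous_component m c * t \<in> I" using Suc(2)[OF iX]
        by (auto simp: homogeneous_component_diff homogeneous_component_sum homogeneous_component_mult[OF \<theta>]
            homogeneous_component_mult[OF t(1)] homogeneous_component_homogeneous B1_def if_mult cong: sum.cong)
      then show ?thesis by (intro exI[of _ "homogeneous_component m c"]) auto
    qed
    then obtain c where c: "\<And>i. i\<in>X \<Longrightarrow> c i \<in> homogeneous_part m"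
        "\<And>i. i\<in>X \<Longrightarrow> a i - (\<Sum>j\<in>X. B1 i j * \<theta> j) - c i * t \<in> I" by metis
    have B1: "B1 i j = - B1 j i" for i j unfolding B1_def
      by (subst B) (simp add: homogeneous_component_uminus)
    have "(\<Sum>i\<in>X. a i * \<theta> i) - (\<Sum>i\<in>X. c i * t * \<theta> i) \<in> I"
      by (rule koszul_relation_in_ideal[OF Ii B1 c(2)])
    then have "(\<Sum>i\<in>X. c i * t * \<theta> i) \<in> I" using Suc(3) ideal_cong[OF Ii] by blast
    then have "t * (\<Sum>i\<in>X. c i * \<theta> i) \<in> I" by (simp add: sum_distrib_left ac_simps)
    then have "(\<Sum>i\<in>X. c i * \<theta> i) \<in> I" using t by (auto simp: regular_mod_def)
    from Suc.IH[OF c(1) this] obtain C where C: "\<And>i j. C i j = - C j i"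
      "\<And>i. i\<in>X \<Longrightarrow> c i - (\<Sum>j\<in>X. C i j * \<theta> j) \<in> I" by blast
    show ?case
    proof (intro exI[of _ "\<lambda>i j. B1 i j + t * C i j"] conjI allI ballI)
      fix i j show "B1 i j + t * C i j = - (B1 j i + t * C j i)"
        using B1[of i j] C(1)[of i j] by simp
    next
      fix i assume i: "i \<in> X"
      have "(a i - (\<Sum>j\<in>X. B1 i j * \<theta> j) - c i * t) + t * (c i - (\<Sum>j\<in>X. C i j * \<theta> j)) \<in> I"
        by (intro ideal_add ideal_mult Ii c C i)
      then show "a i - (\<Sum>j\<in>X. (B1 i j + t * C i j) * \<theta> j) \<in> I"
        by (simp add: algebra_simps sum.distrib sum_distrib_left)
    qed
  qed
qed

text \<open>Writing \<open>a i\<close> as a combination \<open>c\<close> of the other forms, one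
  subtracts multiples of the Koszul relations between \<open>i\<close> and the
  \<open>j \<in> X\<close> until the coefficient at \<open>i\<close> is gone; what remains is a
  relation among \<open>X\<close>. The matrix is then bordered by the row \<open>c\<close> and the
  column \<open>- c\<close>.\<close>

lemma koszul_insert:
  fixes \<theta> :: "'i \<Rightarrow> ('v::finite) mpoly"
  assumes X: "finite X" "i \<notin> X" and I: "is_ideal I" and K: "only_koszul \<theta> X I"
    and a: "(\<Sum>j\<in>insert i X. a j * \<theta> j) \<in> I" and ai: "a i \<in> gen \<theta> X I"
  shows "\<exists>B. (\<forall>i j. B i j = - B j i) \<and> (\<forall>p\<in>insert i X. a p - (\<Sum>j\<in>insert i X. B p j * \<theta> j) \<in> I)"
proof -
  obtain c where c: "a i - (\<Sum>j\<in>X. c j * \<theta> j) \<in> I" using ai by (auto simp: gen_def)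
  have "(\<Sum>j\<in>insert i X. a j * \<theta> j) - (a i - (\<Sum>j\<in>X. c j * \<theta> j)) * \<theta> i \<in> I"
    by (intro ideal_diff ideal_mult_right I a c)
  then have "(\<Sum>j\<in>X. (a j + c j * \<theta> i) * \<theta> j) \<in> I"
    using X by (simp add: algebra_simps sum.distrib sum_distrib_left)
  then obtain B where B: "\<And>i j. B i j = - B j i"
    "\<And>j. j \<in> X \<Longrightarrow> a j + c j * \<theta> i - (\<Sum>l\<in>X. B j l * \<theta> l) \<in> I"
    using K[unfolded only_koszul_def, rule_format, of "\<lambda>j. a j + c j * \<theta> i"] by blast
  define B' where "B' p q = (if p = i then (if q = i then 0 else c q) else if q = i then - c p else B p q)" for p q
  show "\<exists>B. (\<forall>i j. B i j = - B j i) \<and> (\<forall>p\<in>insert i X. a p - (\<Sum>j\<in>insert i X. B p j * \<theta> j) \<in> I)"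
  proof (intro exI[of _ B'] conjI allI ballI)
    fix p q show "B' p q = - B' q p" using B(1)[of p q] by (auto simp: B'_def)
  next
    fix p assume "p \<in> insert i X"
    then consider "p = i" | "p \<in> X" "p \<noteq> i" by auto
    then show "a p - (\<Sum>j\<in>insert i X. B' p j * \<theta> j) \<in> I"
    proof cases
      case 1
      have "(\<Sum>j\<in>X. B' i j * \<theta> j) = (\<Sum>j\<in>X. c j * \<theta> j)"
        using X by (intro sum.cong) (auto simp: B'_def)
      then show ?thesis using 1 X c by (simp add: B'_def)
    next
      case 2
      have "(\<Sum>j\<in>X. B' p j * \<theta> j) = (\<Sum>j\<in>X. B p j * \<theta> j)"
        using X 2 by (intro sum.cong) (auto simp: B'_def)
      then show ?thesis using 2 X B(2)[of p] by (simp add: B'_def algebra_simps)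
    qed
  qed
qed

lemma only_koszul_insert:
  fixes \<theta> :: "'i \<Rightarrow> ('v::finite) mpoly"
  assumes X: "finite X" "i \<notin> X" and I: "is_ideal I"
    and R: "regular_mod (\<theta> i) (gen \<theta> X I)" and K: "only_koszul \<theta> X I"
  shows "only_koszul \<theta> (insert i X) I"
  unfolding only_koszul_def
proof (intro allI impI)
  fix a assume a: "(\<Sum>j\<in>insert i X. a j * \<theta> j) \<in> I"
  have "\<theta> i * a i - (\<Sum>j\<in>X. - a j * \<theta> j) \<in> I" using a X by (simp add: sum_negf ac_simps)
  then have "\<theta> i * a i \<in> gen \<theta> X I" unfolding gen_def by fast
  then have "a i \<in> gen \<theta> X I" using R by (auto simp: regular_mod_def)
  then show "\<exists>B. (\<forall>i j. B i j = - B j i) \<and> (\<forall>p\<in>insert i X. a p - (\<Sum>j\<in>insert i X. B p j * \<theta> j) \<in> I)"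
    by (rule koszul_insert[OF X I K a])
qed

section \<open>Relations under the coordinate change
  \<open>\<theta> j - \<mu> j * \<theta> i\<close>\<close>

definition shear_coefficients :: "'i set \<Rightarrow> 'i \<Rightarrow> ('i \<Rightarrow> 'a) \<Rightarrow> ('i \<Rightarrow> 'a) \<Rightarrow> 'i \<Rightarrow> 'a::comm_ring_1" where
  "shear_coefficients X i \<mu> a j = (if j = i then a i + (\<Sum>l\<in>X. a l * \<mu> l) else a j)"

lemma sum_shear_coefficients:
  assumes X: "finite X" "i \<in> X"
  shows "(\<Sum>j\<in>X. shear_coefficients X i \<mu> a j * t j) = (\<Sum>j\<in>X. a j * t j) + (\<Sum>j\<in>X. a j * \<mu> j) * t i"
proof -
  have "(\<Sum>j\<in>X. shear_coefficients X i \<mu> a j * t j) =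
      (\<Sum>j\<in>X. a j * t j + (if j = i then (\<Sum>j\<in>X. a j * \<mu> j) * t i else 0))"
    by (intro sum.cong) (auto simp: shear_coefficients_def algebra_simps)
  then show ?thesis using X by (simp add: sum.distrib)
qed

lemma shear_relation:
  assumes X: "finite X" "i \<in> X" and \<mu>: "\<mu> i = 0"
  shows "(\<Sum>j\<in>X. shear_coefficients X i \<mu> a j * (\<theta> j - \<mu> j * \<theta> i)) = (\<Sum>j\<in>X. a j * \<theta> j)"
  unfolding sum_shear_coefficients[OF X]
  by (simp add: right_diff_distrib sum_subtractf sum_distrib_right mult.assoc \<mu>)

text \<open>The forms change by the matrix \<open>M = 1 - \<mu> * e\<^sub>i\<^sup>T\<close> and the
  coefficients by its inverse transpose, so a skew \<open>B\<close> for the new forms yields the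
  skew matrix \<open>M\<^sup>T B M\<close> for the old ones.\<close>

lemma koszul_shear:
  fixes \<theta> :: "'i \<Rightarrow> ('v::finite) mpoly"
  assumes X: "finite X" "i \<in> X" and I: "is_ideal I" and \<mu>: "\<mu> i = 0"
    and K: "\<exists>B. (\<forall>i j. B i j = - B j i) \<and>
      (\<forall>p\<in>X. shear_coefficients X i \<mu> a p - (\<Sum>j\<in>X. B p j * (\<theta> j - \<mu> j * \<theta> i)) \<in> I)"
  shows "\<exists>B. (\<forall>i j. B i j = - B j i) \<and> (\<forall>p\<in>X. a p - (\<Sum>j\<in>X. B p j * \<theta> j) \<in> I)"
proof -
  define s where "s = (\<Sum>j\<in>X. a j * \<mu> j)"
  define a' where "a' = shear_coefficients X i \<mu> a"
  have a'_def': "a' j = (if j = i then a i + s else a j)" for j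
    by (simp add: a'_def s_def shear_coefficients_def)
  obtain B where B: "\<And>i j. B i j = - B j i"
    "\<And>p. p \<in> X \<Longrightarrow> a' p - (\<Sum>j\<in>X. B p j * (\<theta> j - \<mu> j * \<theta> i)) \<in> I"
    using K unfolding a'_def by blast
  define r where "r p = (\<Sum>l\<in>X. B p l * \<mu> l)" for p
  define w where "w = (\<Sum>l\<in>X. \<mu> l * r l)"
  have w0: "w = 0" using skew_sum_0[of B \<mu> X, OF B(1)] by (simp add: w_def r_def ac_simps)
  \<comment> \<open>The entries of \<open>M\<^sup>T B M\<close>, where \<open>r = B \<mu>\<close>;
    the further term at \<open>(i, i)\<close> is the value \<open>w\<close> of the skew form at
    \<open>\<mu>\<close> and vanishes.\<close>
  define B' where "B' p q = B p q - (if q = i then r p else 0) + (if p = i then r q else 0)" for p q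
  have row: "(\<Sum>j\<in>X. B p j * (\<theta> j - \<mu> j * \<theta> i)) = (\<Sum>j\<in>X. B p j * \<theta> j) - r p * \<theta> i" for p
    by (simp add: right_diff_distrib sum_subtractf r_def sum_distrib_right mult.assoc)
  have row': "(\<Sum>j\<in>X. B' p j * \<theta> j) = (\<Sum>j\<in>X. B p j * \<theta> j) - r p * \<theta> i
      + (if p = i then (\<Sum>j\<in>X. r j * \<theta> j) else 0)" for p
    using X by (simp add: B'_def distrib_right left_diff_distrib sum.distrib sum_subtractf if_mult)
  show "\<exists>B. (\<forall>i j. B i j = - B j i) \<and> (\<forall>p\<in>X. a p - (\<Sum>j\<in>X. B p j * \<theta> j) \<in> I)"
  proof (intro exI[of _ B'] conjI allI ballI)
    fix p q show "B' p q = - B' q p" using B(1)[of p q] by (auto simp: B'_def)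
  next
    fix p assume p: "p \<in> X"
    show "a p - (\<Sum>j\<in>X. B' p j * \<theta> j) \<in> I"
    proof (cases "p = i")
      case False
      then show ?thesis using B(2)[OF p] row row' by (simp add: a'_def')
    next
      case True
      have "(\<Sum>l\<in>X. \<mu> l * (a' l - (\<Sum>j\<in>X. B l j * (\<theta> j - \<mu> j * \<theta> i)))) \<in> I"
        by (intro ideal_sum ideal_mult I B)
      moreover have "(\<Sum>l\<in>X. \<mu> l * a' l) = s"
        using sum_shear_coefficients[OF X, of \<mu> a \<mu>] \<mu> by (simp add: a'_def s_def ac_simps)
      moreover have "(\<Sum>l\<in>X. \<mu> l * (\<Sum>j\<in>X. B l j * (\<theta> j - \<mu> j * \<theta> i))) = - (\<Sum>j\<in>X. r j * \<theta> j)"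
      proof -
        have "(\<Sum>l\<in>X. \<mu> l * (\<Sum>j\<in>X. B l j * \<theta> j)) = (\<Sum>j\<in>X. \<Sum>l\<in>X. \<mu> l * (B l j * \<theta> j))"
          by (simp add: sum_distrib_left) (rule sum.swap)
        also have "\<dots> = (\<Sum>j\<in>X. - (r j * \<theta> j))"
        proof (rule sum.cong[OF refl])
          fix j
          have "\<mu> l * (B l j * \<theta> j) = - (B j l * \<mu> l * \<theta> j)" for l by (subst B(1)) (simp add: ac_simps)
          then show "(\<Sum>l\<in>X. \<mu> l * (B l j * \<theta> j)) = - (r j * \<theta> j)"
            by (simp add: r_def sum_distrib_right sum_negf)
        qed
        finally have "(\<Sum>l\<in>X. \<mu> l * (\<Sum>j\<in>X. B l j * \<theta> j)) = - (\<Sum>j\<in>X. r j * \<theta> j)"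
          by (simp add: sum_negf)
        moreover have "(\<Sum>l\<in>X. \<mu> l * (r l * \<theta> i)) = w * \<theta> i"
          by (simp add: w_def sum_distrib_right mult.assoc)
        ultimately show ?thesis unfolding row using w0 by (simp add: right_diff_distrib sum_subtractf)
      qed
      ultimately have "s + (\<Sum>j\<in>X. r j * \<theta> j) \<in> I" by (simp add: right_diff_distrib sum_subtractf)
      with B(2)[OF p] have "(a' p - (\<Sum>j\<in>X. B p j * (\<theta> j - \<mu> j * \<theta> i))) - (s + (\<Sum>j\<in>X. r j * \<theta> j)) \<in> I"
        by (rule ideal_diff[OF I])
      then show ?thesis unfolding row row' using True by (simp add: a'_def' algebra_simps)
    qed
  qed
qed

lemma only_koszul_shear:
  fixes \<theta> :: "'i \<Rightarrow> ('v::finite) mpoly"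
  assumes X: "finite X" "i \<in> X" and I: "is_ideal I" and \<mu>: "\<mu> i = 0"
    and K: "only_koszul (\<lambda>j. \<theta> j - \<mu> j * \<theta> i) X I"
  shows "only_koszul \<theta> X I"
  unfolding only_koszul_def
proof (intro allI impI)
  fix a assume a: "(\<Sum>j\<in>X. a j * \<theta> j) \<in> I"
  then have "(\<Sum>j\<in>X. shear_coefficients X i \<mu> a j * (\<theta> j - \<mu> j * \<theta> i)) \<in> I"
    unfolding shear_relation[of X i \<mu> a \<theta>, OF X \<mu>] .
  then have "\<exists>B. (\<forall>i j. B i j = - B j i) \<and>
      (\<forall>p\<in>X. shear_coefficients X i \<mu> a p - (\<Sum>j\<in>X. B p j * (\<theta> j - \<mu> j * \<theta> i)) \<in> I)"
    by (rule K[unfolded only_koszul_def, THEN spec, THEN mp])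
  then show "\<exists>B. (\<forall>i j. B i j = - B j i) \<and> (\<forall>p\<in>X. a p - (\<Sum>j\<in>X. B p j * \<theta> j) \<in> I)"
    by (rule koszul_shear[of X i I \<mu> a \<theta>, OF X I \<mu>])
qed

text \<open>The socle of the quotient by \<open>Q\<close> has nothing in degrees below
  \<open>r\<close>; equivalently, a nonzero class of smaller degree survives multiplication by some
  variable.\<close>

definition socle_above :: "nat \<Rightarrow> ('v::finite) mpoly set \<Rightarrow> bool" where
  "socle_above r Q \<longleftrightarrow> (\<forall>m<r. \<forall>b\<in>homogeneous_part m. (\<forall>v. Var v * b \<in> Q) \<longrightarrow> b \<in> Q)"

text \<open>If \<open>b\<close> is a socle element modulo \<open>u\<close>, then \<open>t * b = u * e\<close> modulo \<open>Q\<close> for a socle element \<open>e\<close> modulo \<open>t\<close>;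
  the correspondence of \<open>b\<close> and \<open>e\<close> shifts the degree by \<open>d - 1\<close>.\<close>

lemma socle_above_adjoin:
  fixes t u :: "('v::finite) mpoly"
  assumes Q: "homogeneous_ideal Q" and t: "t = (\<Sum>v\<in>UNIV. c v * Var v)" "t \<in> homogeneous_part 1" "regular_mod t Q"
    and u: "u \<in> homogeneous_part d" "regular_mod u Q" "d \<ge> 1" and S: "socle_above r (adjoin t Q)"
  shows "socle_above (r + (d - 1)) (adjoin u Q)"
  unfolding socle_above_def
proof (intro allI impI ballI)
  note Qi = homogeneous_idealD[OF Q]
  fix m b assume m: "m < r + (d - 1)" and b: "b \<in> homogeneous_part m" and *: "\<forall>v. Var v * b \<in> adjoin u Q"
  have "t * b = (\<Sum>v\<in>UNIV. c v * (Var v * b))" by (simp add: t(1) sum_distrib_right mult.assoc)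
  moreover have "\<dots> \<in> adjoin u Q"
    by (rule ideal_sum[OF is_ideal_adjoin[OF Qi]], rule ideal_mult[OF is_ideal_adjoin[OF Qi]]) (use * in blast)
  ultimately have "t * b \<in> adjoin u Q" by simp
  moreover have "t * b \<in> homogeneous_part (1 + m)" using homogeneous_part_mult[OF t(2) b] .
  ultimately obtain e where e: "t * b - e * u \<in> Q" "e \<in> homogeneous_part (1 + m - d)" "1 + m < d \<Longrightarrow> e = 0"
    using homogeneous_adjoinE[OF Q u(1)] by metis
  obtain ev where ev: "\<And>v. Var v * b - ev v * u \<in> Q" using * unfolding adjoin_def by simp metis
  have xe: "Var v * e \<in> adjoin t Q" for v
  proof -
    have "t * (Var v * b - ev v * u) - Var v * (t * b - e * u) \<in> Q"
      by (intro ideal_diff ideal_mult Qi e ev)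
    then have "u * (Var v * e - ev v * t) \<in> Q" by (simp add: algebra_simps)
    then show ?thesis using u(2) by (auto simp: regular_mod_def adjoin_def)
  qed
  show "b \<in> adjoin u Q"
  proof (cases "1 + m < d")
    case True
    then have "t * b \<in> Q" using e by simp
    then show ?thesis using t(3) adjoin_subset[OF Qi] by (auto simp: regular_mod_def)
  next
    case False
    \<comment> \<open>The truncated subtraction is exact here, and the bound on \<open>m\<close> is
      just what puts \<open>e\<close> below the socle degree \<open>r\<close>.\<close>
    then have "1 + m - d < r" using m u(3) by linarith
    then have "e \<in> adjoin t Q" using S e(2) xe by (auto simp: socle_above_def)
    then obtain e' where e': "e - e' * t \<in> Q" by (auto simp: adjoin_def)
    have "(t * b - e * u) + u * (e - e' * t) \<in> Q" by (intro ideal_add ideal_mult Qi e e')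
    then have "t * (b - e' * u) \<in> Q" by (simp add: algebra_simps)
    then show ?thesis using t(3) by (auto simp: regular_mod_def adjoin_def)
  qed
qed

lemma regular_mod_power: "regular_mod t Q \<Longrightarrow> regular_mod (t ^ k) Q"
proof (induction k)
  case 0 then show ?case by (simp add: regular_mod_def)
next
  case (Suc k)
  show ?case unfolding regular_mod_def
  proof (intro allI impI)
    fix p assume "t ^ Suc k * p \<in> Q"
    then have "t * (t ^ k * p) \<in> Q" by (simp add: mult.assoc)
    then have "t ^ k * p \<in> Q" using Suc.prems unfolding regular_mod_def by blast
    then show "p \<in> Q" using Suc.IH[OF Suc.prems] unfolding regular_mod_def by blast
  qed
qed

text \<open>A divisor of a regular element is regular: if \<open>u * p\<close> vanishes modulo
  \<open>Q\<close>, so does \<open>t ^ k * p\<close>, because \<open>t ^ k\<close> is a multiple of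
  \<open>u\<close>.\<close>

lemma regular_mod_of_power_mem:
  assumes Q: "is_ideal Q" and t: "regular_mod t Q" "t ^ k \<in> adjoin u Q"
  shows "regular_mod u Q"
  unfolding regular_mod_def
proof (intro allI impI)
  fix p assume p: "u * p \<in> Q"
  obtain e where "t ^ k - e * u \<in> Q" using t(2) by (auto simp: adjoin_def)
  then have "p * (t ^ k - e * u) + e * (u * p) \<in> Q" by (intro ideal_add ideal_mult Q p)
  then have "t ^ k * p \<in> Q" by (simp add: algebra_simps)
  then show "p \<in> Q" using regular_mod_power[OF t(1), of k] by (auto simp: regular_mod_def)
qed

lemma gen_shear:
  assumes X: "finite X" "i \<in> X" and I: "is_ideal I" and \<mu>: "\<mu> i = 0"
  shows "gen (\<lambda>j. \<theta> j - \<mu> j * \<theta> i) X I = gen \<theta> X I"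
proof
  let ?\<theta> = "\<lambda>j. \<theta> j - \<mu> j * \<theta> i"
  have 1: "is_ideal (gen \<theta> X I)" and 2: "is_ideal (gen ?\<theta> X I)" using X I by (auto intro: is_ideal_gen)
  have ti: "\<theta> j \<in> gen \<theta> X I" if "j \<in> X" for j by (rule gen_mem[OF X(1) I that])
  have "\<theta> j - \<mu> j * \<theta> i \<in> gen \<theta> X I" if "j \<in> X" for j
    by (rule ideal_diff[OF 1 ti[OF that] ideal_mult[OF 1 ti[OF X(2)]]])
  then show "gen ?\<theta> X I \<subseteq> gen \<theta> X I"
    by (rule gen_least[OF 1 gen_subset])
  have *: "\<theta> i \<in> gen ?\<theta> X I" using gen_mem[OF X(1) I X(2), of ?\<theta>] \<mu> by simp
  have "\<theta> j \<in> gen ?\<theta> X I" if "j \<in> X" for j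
    using ideal_add[OF 2 gen_mem[OF X(1) I that, of ?\<theta>] ideal_mult[OF 2 *, of "\<mu> j"]] by simp
  then show "gen \<theta> X I \<subseteq> gen ?\<theta> X I"
    by (rule gen_least[OF 2 gen_subset])
qed

text \<open>Trades the linear form \<open>t\<close> for the form \<open>\<theta> i\<close>. By
  exchange \<open>t\<close> is regular modulo the sheared forms without \<open>i\<close>; a power of
  \<open>t\<close> lies in the ideal that these generate with \<open>\<theta> i\<close>, so
  \<open>\<theta> i\<close> is regular modulo them too. Hence relations stay Koszul and the socle
  rises by \<open>d - 1\<close>.\<close>

lemma complete_intersection_step:
  fixes \<theta> :: "'i \<Rightarrow> ('v::finite) mpoly"
  assumes I: "homogeneous_ideal I"
    and t: "t = (\<Sum>v\<in>UNIV. c v * Var v)" "t \<in> homogeneous_part 1" "regular_mod t I"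
    and X: "finite X" "i \<in> X" and \<theta>: "\<And>j. j \<in> X \<Longrightarrow> \<theta> j \<in> homogeneous_part d" and d: "d \<ge> 1" and \<mu>: "\<mu> i = 0"
    and K: "only_koszul (\<lambda>j. \<theta> j - Const (\<mu> j) * \<theta> i) (X - {i}) (adjoin t I)"
    and S: "socle_above r (gen (\<lambda>j. \<theta> j - Const (\<mu> j) * \<theta> i) (X - {i}) (adjoin t I))"
    and tk: "t ^ k \<in> gen \<theta> X I"
  shows "only_koszul \<theta> X I \<and> socle_above (r + (d - 1)) (gen \<theta> X I)"
proof
  let ?\<theta> = "\<lambda>j. \<theta> j - Const (\<mu> j) * \<theta> i"
  note Ii = homogeneous_idealD[OF I]
  have X': "finite (X - {i})" "i \<notin> X - {i}" "insert i (X - {i}) = X" using X by auto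
  have \<theta>': "?\<theta> j \<in> homogeneous_part d" if "j \<in> X" for j
    by (intro homogeneous_part_diff homogeneous_part_Const_mult \<theta> that X)
  define Q where "Q = gen ?\<theta> (X - {i}) I"
  have Q: "homogeneous_ideal Q" unfolding Q_def using \<theta>' by (intro homogeneous_ideal_gen X' I) auto
  note Qi = homogeneous_idealD[OF Q]
  have tQ: "regular_mod t Q" unfolding Q_def by (rule regular_mod_gen[OF X'(1) Ii t(3) K])
  have g: "gen \<theta> X I = adjoin (\<theta> i) Q"
    using gen_insert[OF X'(1,2), of ?\<theta> I] X'(3) gen_shear[OF X Ii, of "\<lambda>j. Const (\<mu> j)" \<theta>] \<mu> by (simp add: Q_def)
  have uQ: "regular_mod (\<theta> i) Q" using regular_mod_of_power_mem[OF Qi tQ] tk g by simp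
  have "only_koszul ?\<theta> (X - {i}) I"
    using \<theta>' by (intro only_koszul_lift[OF X'(1) I _ t(2,3) K]) auto
  then have "only_koszul ?\<theta> (insert i (X - {i})) I"
    using uQ \<mu> by (intro only_koszul_insert X' Ii) (auto simp: Q_def)
  then show "only_koszul \<theta> X I"
    unfolding X'(3) using \<mu> by (rule_tac only_koszul_shear[OF X Ii, of "\<lambda>j. Const (\<mu> j)"]) simp_all
  have "socle_above r (adjoin t Q)" using S gen_adjoin[OF X'(1) Ii, of ?\<theta> t] by (simp add: Q_def)
  then show "socle_above (r + (d - 1)) (gen \<theta> X I)"
    unfolding g by (intro socle_above_adjoin[OF Q t(1,2) tQ _ uQ d] \<theta> X)
qed

section \<open>Linear algebra\<close>

lemma underdetermined_system:
  fixes M :: "'e \<Rightarrow> 't \<Rightarrow> 'k::field"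
  assumes "finite E" "finite X" "card E < card X"
  shows "\<exists>x. (\<exists>t\<in>X. x t \<noteq> 0) \<and> (\<forall>e\<in>E. (\<Sum>t\<in>X. M e t * x t) = 0)"
  using assms
proof (induction E arbitrary: X M rule: finite_induct)
  case empty
  then obtain t where "t \<in> X" by fastforce
  then show ?case by (intro exI[of _ "\<lambda>_. 1"]) auto
next
  case (insert e E X M)
  show ?case
  proof (cases "\<forall>t\<in>X. M e t = 0")
    case True
    have "card E < card X" using insert by simp
    then obtain x where "\<exists>t\<in>X. x t \<noteq> 0" "\<forall>e\<in>E. (\<Sum>t\<in>X. M e t * x t) = 0"
      using insert.IH[OF insert.prems(1)] by blast
    then show ?thesis using True by (intro exI[of _ x]) auto
  next
    case False
    then obtain s where s: "s \<in> X" "M e s \<noteq> 0" by blast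
    define X' where "X' = X - {s}"
    have X': "finite X'" "card E < card X'" "s \<notin> X'" "X = insert s X'"
      using insert s by (auto simp: X'_def)
    \<comment> \<open>The system after the unknown \<open>s\<close> has been eliminated by the
      equation \<open>e\<close>; \<open>y\<close> below restores its value.\<close>
    define M' where "M' f t = M f t - M f s * (M e t / M e s)" for f t
    obtain x where x: "\<exists>t\<in>X'. x t \<noteq> 0" "\<forall>f\<in>E. (\<Sum>t\<in>X'. M' f t * x t) = 0"
      using insert.IH[OF X'(1,2)] by blast
    define y where "y = x(s := - (\<Sum>t\<in>X'. M e t / M e s * x t))"
    have sy: "(\<Sum>t\<in>X. M f t * y t) = (\<Sum>t\<in>X'. M f t * x t) - M f s * (\<Sum>t\<in>X'. M e t / M e s * x t)" for f
    proof -
      have "(\<Sum>t\<in>X'. M f t * y t) = (\<Sum>t\<in>X'. M f t * x t)"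
        using X' by (intro sum.cong) (auto simp: y_def)
      then show ?thesis using X' by (simp add: y_def)
    qed
    have "(\<Sum>t\<in>X. M f t * y t) = 0" if "f \<in> insert e E" for f
    proof (cases "f = e")
      case True
      have "M e s * (\<Sum>t\<in>X'. M e t / M e s * x t) = (\<Sum>t\<in>X'. M e t * x t)"
        unfolding sum_distrib_left using s by (intro sum.cong) auto
      then show ?thesis using sy True by simp
    next
      case False
      then have "(\<Sum>t\<in>X'. M' f t * x t) = 0" using x that by auto
      then show ?thesis unfolding sy M'_def by (simp add: left_diff_distrib sum_subtractf sum_distrib_left mult.assoc)
    qed
    moreover have "\<exists>t\<in>X. y t \<noteq> 0" using x(1) X' by (auto simp: y_def)
    ultimately show ?thesis by blast
  qed
qed

lemma dependent_mod_ideal: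
  fixes v :: "'t \<Rightarrow> ('v::finite) mpoly"
  assumes I: "is_ideal I" and fin: "finite W" "finite T" "card W < card T"
    and v: "\<And>t. t \<in> T \<Longrightarrow> v t - (\<Sum>w\<in>W. Const (c t w) * u w) \<in> I"
  obtains x where "\<exists>t\<in>T. x t \<noteq> 0" "(\<Sum>t\<in>T. Const (x t) * v t) \<in> I"
proof -
  obtain x where x: "\<exists>t\<in>T. x t \<noteq> 0" "\<And>w. w\<in>W \<Longrightarrow> (\<Sum>t\<in>T. c t w * x t) = 0"
    using underdetermined_system[OF fin, of "\<lambda>w t. c t w"] by blast
  have "(\<Sum>t\<in>T. Const (x t) * (v t - (\<Sum>w\<in>W. Const (c t w) * u w))) \<in> I"
    by (intro ideal_sum ideal_mult I v)
  also have "(\<Sum>t\<in>T. Const (x t) * (v t - (\<Sum>w\<in>W. Const (c t w) * u w))) =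
     (\<Sum>t\<in>T. Const (x t) * v t) - (\<Sum>t\<in>T. \<Sum>w\<in>W. Const (c t w * x t) * u w)"
    by (simp add: right_diff_distrib sum_subtractf sum_distrib_left Const_mult ac_simps)
  also have "(\<Sum>t\<in>T. \<Sum>w\<in>W. Const (c t w * x t) * u w) = (\<Sum>w\<in>W. Const (\<Sum>t\<in>T. c t w * x t) * u w)"
    by (subst sum.swap) (simp add: Const_sum sum_distrib_right)
  also have "\<dots> = 0" using x by simp
  finally show thesis using that x(1) by simp
qed

section \<open>Substitution\<close>

definition is_hom :: "(complex \<Rightarrow> 'a::comm_ring_1) \<Rightarrow> bool" where
  "is_hom \<kappa> \<longleftrightarrow> \<kappa> 0 = 0 \<and> \<kappa> 1 = 1 \<and> (\<forall>a b. \<kappa> (a + b) = \<kappa> a + \<kappa> b) \<and> (\<forall>a b. \<kappa> (a * b) = \<kappa> a * \<kappa> b)"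

text \<open>The coefficient map \<open>\<kappa>\<close> is a parameter so that the same lemmas serve
  evaluation at points (the identity) and substitution of polynomials
  (\<open>Const\<close>).\<close>

definition insertion :: "(complex \<Rightarrow> 'a) \<Rightarrow> ('v \<Rightarrow> 'a) \<Rightarrow> ('v::finite) mpoly \<Rightarrow> 'a::comm_ring_1" where
  "insertion \<kappa> \<phi> p = (\<Sum>a\<in>Poly_Mapping.keys p. \<kappa> (Poly_Mapping.lookup p a) * (\<Prod>v\<in>UNIV. \<phi> v ^ Poly_Mapping.lookup a v))"

lemma insertion_superset:
  assumes "is_hom \<kappa>" "finite A" "Poly_Mapping.keys p \<subseteq> A"
  shows "insertion \<kappa> \<phi> p = (\<Sum>a\<in>A. \<kappa> (Poly_Mapping.lookup p a) * (\<Prod>v\<in>UNIV. \<phi> v ^ Poly_Mapping.lookup a v))"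
  unfolding insertion_def using assms
  by (intro sum.mono_neutral_left) (auto simp: in_keys_iff is_hom_def)

lemma insertion_add:
  assumes "is_hom \<kappa>" shows "insertion \<kappa> \<phi> (p + q) = insertion \<kappa> \<phi> p + insertion \<kappa> \<phi> q"
proof -
  let ?A = "Poly_Mapping.keys p \<union> Poly_Mapping.keys q"
  have "insertion \<kappa> \<phi> r = (\<Sum>a\<in>?A. \<kappa> (Poly_Mapping.lookup r a) * (\<Prod>v\<in>UNIV. \<phi> v ^ Poly_Mapping.lookup a v))"
    if "r \<in> {p, q, p + q}" for r
    using that keys_add[of p q] by (intro insertion_superset assms) auto
  then show ?thesis using assms by (simp add: lookup_add is_hom_def distrib_right sum.distrib)
qed

lemma insertion_single:
  "is_hom \<kappa> \<Longrightarrow> insertion \<kappa> \<phi> (Poly_Mapping.single a c) = \<kappa> c * (\<Prod>v\<in>UNIV. \<phi> v ^ Poly_Mapping.lookup a v)"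
  using insertion_superset[of \<kappa> "{a}" "Poly_Mapping.single a c" \<phi>] by simp

lemma insertion_mult:
  assumes \<kappa>: "is_hom \<kappa>" shows "insertion \<kappa> \<phi> (p * q) = insertion \<kappa> \<phi> p * insertion \<kappa> \<phi> q"
proof (induction p rule: mpoly_induct)
  case (monom a c)
  show ?case
  proof (induction q rule: mpoly_induct)
    case (monom b e)
    then show ?case using \<kappa>
      by (simp add: mult_single insertion_single lookup_add power_add prod.distrib is_hom_def ac_simps)
  next
    case (add p q)
    then show ?case by (simp add: distrib_left insertion_add[OF \<kappa>])
  qed
next
  case (add p q)
  then show ?case by (simp add: distrib_right insertion_add[OF \<kappa>])
qed

lemma insertion_Const: "is_hom \<kappa> \<Longrightarrow> insertion \<kappa> \<phi> (Const c) = \<kappa> c"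
  by (simp add: Const_def insertion_single)

lemma insertion_Var: "is_hom \<kappa> \<Longrightarrow> insertion \<kappa> \<phi> (Var v) = \<phi> v"
  by (auto simp: Var_def insertion_single lookup_single when_def is_hom_def if_distrib[of "\<lambda>n. _ ^ n"] prod.delta cong: if_cong)

lemma insertion_0: "is_hom \<kappa> \<Longrightarrow> insertion \<kappa> \<phi> 0 = 0"
  by (simp add: insertion_def)

lemma insertion_1: "is_hom \<kappa> \<Longrightarrow> insertion \<kappa> \<phi> 1 = 1"
  using insertion_Const[of \<kappa> \<phi> 1] by (simp add: is_hom_def)

lemma insertion_sum: "is_hom \<kappa> \<Longrightarrow> insertion \<kappa> \<phi> (\<Sum>x\<in>A. p x) = (\<Sum>x\<in>A. insertion \<kappa> \<phi> (p x))"
  by (induction A rule: infinite_finite_induct) (auto simp: insertion_0 insertion_add)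

lemma insertion_prod: "is_hom \<kappa> \<Longrightarrow> insertion \<kappa> \<phi> (\<Prod>x\<in>A. p x) = (\<Prod>x\<in>A. insertion \<kappa> \<phi> (p x))"
  by (induction A rule: infinite_finite_induct) (auto simp: insertion_1 insertion_mult)

lemma insertion_power: "is_hom \<kappa> \<Longrightarrow> insertion \<kappa> \<phi> (p ^ k) = insertion \<kappa> \<phi> p ^ k"
  by (induction k) (auto simp: insertion_1 insertion_mult)

lemma insertion_uminus: "is_hom \<kappa> \<Longrightarrow> insertion \<kappa> \<phi> (- p) = - insertion \<kappa> \<phi> p"
  using insertion_add[of \<kappa> \<phi> p "- p"] by (simp add: insertion_0 add_eq_0_iff)

lemma insertion_diff: "is_hom \<kappa> \<Longrightarrow> insertion \<kappa> \<phi> (p - q) = insertion \<kappa> \<phi> p - insertion \<kappa> \<phi> q"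
  using insertion_add[of \<kappa> \<phi> p "- q"] by (simp add: insertion_uminus)

lemma is_hom_Const: "is_hom (Const :: _ \<Rightarrow> ('v::finite) mpoly)"
  by (simp add: is_hom_def Const_add Const_mult)

lemma is_hom_id: "is_hom (\<lambda>x. x)"
  by (simp add: is_hom_def)

lemma poly_eval_insertion: "poly_eval p x = insertion (\<lambda>x. x) (\<lambda>i. x $ i) p"
  by (simp add: poly_eval_def insertion_def)

lemma
  shows poly_eval_add: "poly_eval (p + q) x = poly_eval p x + poly_eval q x"
    and poly_eval_diff: "poly_eval (p - q) x = poly_eval p x - poly_eval q x"
    and poly_eval_mult: "poly_eval (p * q) x = poly_eval p x * poly_eval q x"
    and poly_eval_Const: "poly_eval (Const c) x = c"
    and poly_eval_Var: "poly_eval (Var v) x = x $ v"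
    and poly_eval_power: "poly_eval (p ^ k) x = poly_eval p x ^ k"
    and poly_eval_0: "poly_eval 0 x = 0"
    and poly_eval_1: "poly_eval 1 x = 1"
  by (simp_all add: poly_eval_insertion is_hom_id insertion_add insertion_diff insertion_mult insertion_uminus
      insertion_Const insertion_Var insertion_power insertion_0 insertion_1)

lemma poly_eval_sum: "poly_eval (\<Sum>j\<in>A. p j) x = (\<Sum>j\<in>A. poly_eval (p j) x)"
  and poly_eval_prod: "poly_eval (\<Prod>j\<in>A. p j) x = (\<Prod>j\<in>A. poly_eval (p j) x)"
  by (simp_all add: poly_eval_insertion is_hom_id insertion_sum insertion_prod)

text \<open>Exponents are functions of which only the values on \<open>X\<close> are seen, whence
  the last hypothesis. Nonzero coordinates are demanded because the shear in Noether normalization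
  divides by one of them.\<close>

lemma nonvanishing_point:
  fixes x :: "('i \<Rightarrow> nat) \<Rightarrow> complex"
  assumes "finite X" "finite T" "\<alpha>0 \<in> T" "x \<alpha>0 \<noteq> 0"
    and "\<And>\<alpha> \<beta>. \<alpha> \<in> T \<Longrightarrow> \<beta> \<in> T \<Longrightarrow> \<forall>j\<in>X. \<alpha> j = \<beta> j \<Longrightarrow> \<alpha> = \<beta>"
  shows "\<exists>q. (\<forall>j\<in>X. q j \<noteq> 0) \<and> (\<Sum>\<alpha>\<in>T. x \<alpha> * (\<Prod>j\<in>X. q j ^ \<alpha> j)) \<noteq> 0"
  using assms
proof (induction X arbitrary: T rule: finite_induct)
  case empty
  then have "T = {\<alpha>0}" by auto
  then show ?case using empty by auto
next
  case (insert i X T)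
  define T' where "T' r = {\<alpha>\<in>T. \<alpha> i = r}" for r
  have "\<exists>q. (\<forall>j\<in>X. q j \<noteq> 0) \<and> (\<Sum>\<alpha>\<in>T' (\<alpha>0 i). x \<alpha> * (\<Prod>j\<in>X. q j ^ \<alpha> j)) \<noteq> 0"
  proof (rule insert.IH)
    show "\<alpha> = \<beta>" if "\<alpha> \<in> T' (\<alpha>0 i)" "\<beta> \<in> T' (\<alpha>0 i)" "\<forall>j\<in>X. \<alpha> j = \<beta> j" for \<alpha> \<beta>
      using insert.prems(4)[of \<alpha> \<beta>] that by (auto simp: T'_def)
  qed (use insert.prems in \<open>auto simp: T'_def\<close>)
  then obtain q where q: "\<forall>j\<in>X. q j \<noteq> 0" "(\<Sum>\<alpha>\<in>T' (\<alpha>0 i). x \<alpha> * (\<Prod>j\<in>X. q j ^ \<alpha> j)) \<noteq> 0" by blast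
  define c where "c r = (\<Sum>\<alpha>\<in>T' r. x \<alpha> * (\<Prod>j\<in>X. q j ^ \<alpha> j))" for r
  define n where "n = Max ((\<lambda>\<alpha>. \<alpha> i) ` T)"
  have n: "\<alpha> i \<le> n" if "\<alpha> \<in> T" for \<alpha> using that insert.prems(1) by (auto simp: n_def)
  \<comment> \<open>By the choice of \<open>q\<close> the coefficient at the exponent
    \<open>\<alpha>0 i\<close> is nonzero, so there are finitely many roots \<open>z\<close>; 0 is
    excluded as well.\<close>
  have "finite {z. (\<Sum>r\<le>n. c r * z ^ r) = 0}"
    using polyfun_finite_roots[of c n] q(2) n[OF insert.prems(2)] by (auto simp: c_def)
  then have "finite (insert 0 {z. (\<Sum>r\<le>n. c r * z ^ r) = 0})" by simp
  then obtain z where z: "z \<notin> insert 0 {z. (\<Sum>r\<le>n. c r * z ^ r) = 0}"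
    using ex_new_if_finite infinite_UNIV_char_0 by blast
  have "(\<Sum>\<alpha>\<in>T. x \<alpha> * (\<Prod>j\<in>insert i X. (q(i:=z)) j ^ \<alpha> j)) = (\<Sum>\<alpha>\<in>T. z ^ \<alpha> i * (x \<alpha> * (\<Prod>j\<in>X. q j ^ \<alpha> j)))"
  proof (rule sum.cong[OF refl])
    fix \<alpha>
    have "(\<Prod>j\<in>X. (q(i:=z)) j ^ \<alpha> j) = (\<Prod>j\<in>X. q j ^ \<alpha> j)"
      using insert.hyps by (intro prod.cong) auto
    then show "x \<alpha> * (\<Prod>j\<in>insert i X. (q(i:=z)) j ^ \<alpha> j) = z ^ \<alpha> i * (x \<alpha> * (\<Prod>j\<in>X. q j ^ \<alpha> j))"
      using insert.hyps by (simp del: fun_upd_apply) (simp add: ac_simps)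
  qed
  also have "\<dots> = (\<Sum>r\<le>n. \<Sum>\<alpha>\<in>T' r. z ^ \<alpha> i * (x \<alpha> * (\<Prod>j\<in>X. q j ^ \<alpha> j)))"
    unfolding T'_def by (rule sum.group[symmetric]) (use insert.prems n in auto)
  also have "\<dots> = (\<Sum>r\<le>n. c r * z ^ r)"
    unfolding c_def T'_def by (intro sum.cong refl) (simp add: sum_distrib_right sum_distrib_left ac_simps)
  finally have "(\<Sum>\<alpha>\<in>T. x \<alpha> * (\<Prod>j\<in>insert i X. (q(i:=z)) j ^ \<alpha> j)) \<noteq> 0" using z by simp
  then show ?case using q(1) z by (intro exI[of _ "q(i:=z)"]) auto
qed

section \<open>Noether normalization\<close>

lemma ideal_mult_cong: "is_ideal Q \<Longrightarrow> a - a' \<in> Q \<Longrightarrow> b - b' \<in> Q \<Longrightarrow> a * b - a' * b' \<in> Q"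
  using ideal_add[of Q "b * (a - a')" "a' * (b - b')"] ideal_mult[of Q "a - a'" b] ideal_mult[of Q "b - b'" a']
  by (simp add: algebra_simps)

lemma ideal_power_cong: "is_ideal Q \<Longrightarrow> a - b \<in> Q \<Longrightarrow> a ^ k - b ^ k \<in> Q"
  by (induction k) (auto simp: ideal_0 ideal_mult_cong)

lemma ideal_prod_cong:
  "is_ideal Q \<Longrightarrow> (\<And>j. j \<in> X \<Longrightarrow> a j - b j \<in> Q) \<Longrightarrow> (\<Prod>j\<in>X. a j) - (\<Prod>j\<in>X. b j) \<in> Q"
  by (induction X rule: infinite_finite_induct) (auto simp: ideal_0 ideal_mult_cong)

lemma homogeneous_part_prod:
  "finite X \<Longrightarrow> (\<And>j. j \<in> X \<Longrightarrow> p j \<in> homogeneous_part (m j)) \<Longrightarrow> (\<Prod>j\<in>X. p j) \<in> homogeneous_part (\<Sum>j\<in>X. m j)"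
  by (induction X rule: finite_induct) (auto simp: homogeneous_part_1 homogeneous_part_mult)

text \<open>By counting monomials, \<open>k + 1\<close> forms on a space of dimension \<open>k\<close> satisfy a homogeneous algebraic
  relation. At a point \<open>q\<close> where the relation does not vanish, the shear that moves \<open>q\<close> to a coordinate
  axis makes it monic in one of the forms.\<close>

lemma noether_shear:
  fixes \<theta> :: "'i \<Rightarrow> ('v::finite) mpoly"
  assumes I: "homogeneous_ideal I" and X: "finite X" "card X = Suc k"
    and \<theta>: "\<And>j. j \<in> X \<Longrightarrow> \<theta> j \<in> homogeneous_part d" and d: "d \<ge> 1"
    and span: "\<And>D. \<exists>W. finite W \<and> card W \<le> (D + 1) ^ k \<and>
      (\<forall>m\<le>D. \<forall>p\<in>homogeneous_part m. \<exists>c. p - (\<Sum>w\<in>W. Const (c w) * w) \<in> I)"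
  obtains i \<mu> e where "i \<in> X" "\<mu> i = 0" "\<theta> i ^ e \<in> gen (\<lambda>j. \<theta> j - Const (\<mu> j) * \<theta> i) (X - {i}) I"
proof -
  note Ii = homogeneous_idealD[OF I]
  \<comment> \<open>Exponents up to \<open>E\<close> give \<open>(E + 1) ^ (k + 1)\<close> monomials
    in the forms, of degree at most \<open>D\<close>. The available spanning set has at most
    \<open>(D + 1) ^ k \<le> (d * card X * (E + 1)) ^ k = E * (E + 1) ^ k\<close> elements, which is
    smaller.\<close>
  define E where "E = (d * card X) ^ k"
  define D where "D = d * (card X * E)"
  define T where "T = PiE X (\<lambda>_. {..E})"
  have T: "finite T" "card T = (E + 1) ^ Suc k" using X by (simp_all add: T_def finite_PiE card_PiE)
  obtain W where W: "finite W" "card W \<le> (D + 1) ^ k"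
    "\<forall>m\<le>D. \<forall>p\<in>homogeneous_part m. \<exists>c. p - (\<Sum>w\<in>W. Const (c w) * w) \<in> I" using span[of D] by blast
  have "1 \<le> d * card X" using d X by simp
  then have "D + 1 \<le> (d * card X) * (E + 1)" unfolding D_def by (simp add: algebra_simps)
  then have "(D + 1) ^ k \<le> ((d * card X) * (E + 1)) ^ k" by (rule power_mono) simp
  also have "\<dots> = E * (E + 1) ^ k" unfolding E_def by (rule power_mult_distrib)
  also have "\<dots> < (E + 1) ^ Suc k" by simp
  finally have cWT: "card W < card T" using W(2) T(2) by simp
  define mon where "mon \<alpha> = (\<Prod>j\<in>X. \<theta> j ^ \<alpha> j)" for \<alpha>
  have mon: "mon \<alpha> \<in> homogeneous_part ((\<Sum>j\<in>X. \<alpha> j) * d)" for \<alpha>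
    unfolding mon_def sum_distrib_right by (intro homogeneous_part_prod X homogeneous_part_power \<theta>)
  have sT: "(\<Sum>j\<in>X. \<alpha> j) * d \<le> D" if "\<alpha> \<in> T" for \<alpha>
  proof -
    have "(\<Sum>j\<in>X. \<alpha> j) \<le> (\<Sum>j\<in>X. E)" using that by (intro sum_mono) (auto simp: T_def)
    then show ?thesis by (simp add: D_def)
  qed
  have "\<forall>\<alpha>\<in>T. \<exists>c. mon \<alpha> - (\<Sum>w\<in>W. Const (c w) * w) \<in> I" using W(3) mon sT by blast
  from bchoice[OF this] obtain c where c: "\<forall>\<alpha>\<in>T. mon \<alpha> - (\<Sum>w\<in>W. Const (c \<alpha> w) * w) \<in> I" ..
  obtain x where x: "\<exists>t\<in>T. x t \<noteq> 0" "(\<Sum>t\<in>T. Const (x t) * mon t) \<in> I"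
    by (rule dependent_mod_ideal[OF Ii W(1) T(1) cWT c[rule_format]])
  then obtain \<alpha>0 where \<alpha>0: "\<alpha>0 \<in> T" "x \<alpha>0 \<noteq> 0" by blast
  \<comment> \<open>The relation found need not be homogeneous; its part of degree
    \<open>s * d\<close> keeps the nonzero coefficient at \<open>\<alpha>0\<close>.\<close>
  define s where "s = (\<Sum>j\<in>X. \<alpha>0 j)"
  define T' where "T' = {\<alpha>\<in>T. (\<Sum>j\<in>X. \<alpha> j) = s}"
  have T': "finite T'" "\<alpha>0 \<in> T'" using T \<alpha>0 by (auto simp: T'_def s_def)
  have "homogeneous_component (s * d) (\<Sum>t\<in>T. Const (x t) * mon t) \<in> I"
    using I x(2) by (auto simp: homogeneous_ideal_def)
  also have "homogeneous_component (s * d) (\<Sum>t\<in>T. Const (x t) * mon t) =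
      (\<Sum>t\<in>T. if (\<Sum>j\<in>X. t j) = s then Const (x t) * mon t else 0)"
    unfolding homogeneous_component_sum
  proof (rule sum.cong[OF refl])
    fix t
    show "homogeneous_component (s * d) (Const (x t) * mon t) = (if (\<Sum>j\<in>X. t j) = s then Const (x t) * mon t else 0)"
      using homogeneous_component_homogeneous[OF homogeneous_part_Const_mult[OF mon[of t]], of "s * d" "x t"] d by auto
  qed
  also have "\<dots> = (\<Sum>t\<in>T'. Const (x t) * mon t)"
    unfolding T'_def by (rule sum.inter_filter[OF T(1), symmetric])
  finally have rel: "(\<Sum>t\<in>T'. Const (x t) * mon t) \<in> I" .
  obtain q where q: "\<forall>j\<in>X. q j \<noteq> 0" "(\<Sum>\<alpha>\<in>T'. x \<alpha> * (\<Prod>j\<in>X. q j ^ \<alpha> j)) \<noteq> 0"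
  proof -
    have "\<alpha> = \<beta>" if "\<alpha> \<in> T'" "\<beta> \<in> T'" "\<forall>j\<in>X. \<alpha> j = \<beta> j" for \<alpha> \<beta>
      using that by (auto simp: T'_def T_def intro: PiE_ext)
    from nonvanishing_point[of X T' \<alpha>0 x, OF X(1) T' \<alpha>0(2) this] show ?thesis using that by blast
  qed
  obtain i where i: "i \<in> X" using X(2) by fastforce
  \<comment> \<open>In the coordinates \<open>\<theta> j\<close>, the forms
    \<open>\<theta> j - (q j / q i) * \<theta> i\<close> vanish at \<open>q\<close>. Modulo them the
    relation becomes a nonzero multiple of its value at \<open>q\<close>, times
    \<open>\<theta> i ^ s\<close>.\<close>
  define \<mu> where "\<mu> j = (if j = i then 0 else q j / q i)" for j
  define Q where "Q = gen (\<lambda>j. \<theta> j - Const (\<mu> j) * \<theta> i) (X - {i}) I"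
  have Q: "is_ideal Q" unfolding Q_def using X by (intro is_ideal_gen Ii) auto
  have cong1: "\<theta> j - Const (q j / q i) * \<theta> i \<in> Q" if "j \<in> X" for j
  proof (cases "j = i")
    case True
    then show ?thesis using q i ideal_0[OF Q] by simp
  next
    case False
    then show ?thesis using gen_mem[of "X - {i}" I j "\<lambda>j. \<theta> j - Const (\<mu> j) * \<theta> i"] X that Ii
      by (auto simp: Q_def \<mu>_def)
  qed
  have cong2: "mon t - Const (\<Prod>j\<in>X. q j ^ t j) * (Const ((1 / q i) ^ s) * \<theta> i ^ s) \<in> Q" if "t \<in> T'" for t
  proof -
    have "mon t - (\<Prod>j\<in>X. (Const (q j / q i) * \<theta> i) ^ t j) \<in> Q"
      unfolding mon_def by (intro ideal_prod_cong ideal_power_cong Q cong1)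
    also have "(\<Prod>j\<in>X. (Const (q j / q i) * \<theta> i) ^ t j) = (\<Prod>j\<in>X. Const (q j ^ t j) * (Const (1 / q i) * \<theta> i) ^ t j)"
      by (intro prod.cong refl)
         (simp add: power_mult_distrib Const_power[symmetric] mult.assoc[symmetric] Const_mult[symmetric] power_divide)
    also have "\<dots> = Const (\<Prod>j\<in>X. q j ^ t j) * (Const (1 / q i) * \<theta> i) ^ (\<Sum>j\<in>X. t j)"
    proof -
      have "(\<Prod>j\<in>X. Const (q j ^ t j)) = (Const (\<Prod>j\<in>X. q j ^ t j) :: 'v mpoly)"
        using X(1) by (induction X rule: finite_induct) (auto simp: Const_mult)
      then show ?thesis by (simp add: prod.distrib power_sum)
    qed
    also have "(\<Sum>j\<in>X. t j) = s" using that by (simp add: T'_def)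
    finally show ?thesis by (simp add: power_mult_distrib Const_power)
  qed
  define \<Phi> where "\<Phi> = (\<Sum>\<alpha>\<in>T'. x \<alpha> * (\<Prod>j\<in>X. q j ^ \<alpha> j))"
  have "(\<Sum>t\<in>T'. Const (x t) * (mon t - Const (\<Prod>j\<in>X. q j ^ t j) * (Const ((1 / q i) ^ s) * \<theta> i ^ s))) \<in> Q"
    by (intro ideal_sum ideal_mult Q cong2)
  also have "(\<Sum>t\<in>T'. Const (x t) * (mon t - Const (\<Prod>j\<in>X. q j ^ t j) * (Const ((1 / q i) ^ s) * \<theta> i ^ s))) =
     (\<Sum>t\<in>T'. Const (x t) * mon t) - Const (\<Phi> * (1 / q i) ^ s) * \<theta> i ^ s"
    unfolding right_diff_distrib sum_subtractf mult.assoc[symmetric] Const_mult[symmetric] sum_distrib_right[symmetric] Const_sum[symmetric] \<Phi>_def ..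
  finally have *: "(\<Sum>t\<in>T'. Const (x t) * mon t) - Const (\<Phi> * (1 / q i) ^ s) * \<theta> i ^ s \<in> Q" .
  have "(\<Sum>t\<in>T'. Const (x t) * mon t) \<in> Q" using rel gen_subset[of I] by (auto simp: Q_def)
  then have "Const (\<Phi> * (1 / q i) ^ s) * \<theta> i ^ s \<in> Q"
    using ideal_diff[OF Q _ *] by fastforce
  then have "Const (1 / (\<Phi> * (1 / q i) ^ s)) * (Const (\<Phi> * (1 / q i) ^ s) * \<theta> i ^ s) \<in> Q"
    by (rule ideal_mult[OF Q])
  then have "\<theta> i ^ s \<in> Q"
    using q i by (simp add: mult.assoc[symmetric] Const_mult[symmetric] \<Phi>_def)
  then show thesis using that[of i \<mu> s] i by (auto simp: Q_def \<mu>_def)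
qed

section \<open>Linear sections\<close>

definition linear_form :: "('v::finite \<Rightarrow> complex) \<Rightarrow> 'v mpoly" where
  "linear_form l = (\<Sum>v\<in>UNIV. Const (l v) * Var v)"

text \<open>\<open>Z\<close> collects the variables already set to 0. Enlarging it lowers the
  dimension of the section by one, which drives the induction over complete intersections.\<close>

definition flag_ideal :: "('v::finite \<Rightarrow> complex) \<Rightarrow> 'v set \<Rightarrow> 'v mpoly set" where
  "flag_ideal l Z = gen Var Z (adjoin (linear_form l) {0})"

lemma linear_form_hom: "linear_form l \<in> homogeneous_part 1"
  unfolding linear_form_def by (intro homogeneous_part_sum homogeneous_part_Const_mult Var_hom)

lemma is_ideal_0: "is_ideal {0}" by (simp add: is_ideal_def)

lemma homogeneous_ideal_0: "homogeneous_ideal {0}"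
  by (simp add: homogeneous_ideal_def is_ideal_0)

lemma homogeneous_flag_ideal: "homogeneous_ideal (flag_ideal l Z)"
  unfolding flag_ideal_def
  by (rule homogeneous_ideal_gen[OF finite homogeneous_ideal_adjoin[OF homogeneous_ideal_0 linear_form_hom] Var_hom])

lemma flag_ideal_insert: "v \<notin> Z \<Longrightarrow> flag_ideal l (insert v Z) = adjoin (Var v) (flag_ideal l Z)"
  unfolding flag_ideal_def by (rule gen_insert[OF finite])

text \<open>The parametrization of the linear section \<open>linear_form l = 0\<close>, \<open>x\<^sub>u = 0\<close> for \<open>u \<in> Z\<close>
  obtained by solving the first equation for the coordinate \<open>i0\<close>.\<close>

definition section_map :: "('v::finite \<Rightarrow> complex) \<Rightarrow> 'v \<Rightarrow> 'v set \<Rightarrow> 'v \<Rightarrow> 'v mpoly" where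
  "section_map l i0 Z v = (if v = i0 then - (\<Sum>u\<in>UNIV - {i0} - Z. Const (l u / l i0) * Var u)
     else if v \<in> Z then 0 else Var v)"

abbreviation restrict_section :: "('v::finite \<Rightarrow> complex) \<Rightarrow> 'v \<Rightarrow> 'v set \<Rightarrow> 'v mpoly \<Rightarrow> 'v mpoly" where
  "restrict_section l i0 Z \<equiv> insertion Const (section_map l i0 Z)"

lemma split_linear_form:
  assumes "i0 \<notin> Z"
  shows "(\<Sum>v\<in>UNIV. h v) = h i0 + (\<Sum>u\<in>UNIV - {i0} - Z. h u) + (\<Sum>u\<in>Z. h (u::'v::finite)) "
proof -
  have "(\<Sum>v\<in>UNIV. h v) = h i0 + (\<Sum>u\<in>UNIV - {i0}. h u)" by (simp add: sum.remove)
  also have "(\<Sum>u\<in>UNIV - {i0}. h u) = (\<Sum>u\<in>UNIV - {i0} - Z. h u) + (\<Sum>u\<in>Z. h u)"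
    using assms by (intro sum.subset_diff) auto
  finally show ?thesis by (simp add: add.assoc)
qed

lemma restrict_section_eq_0:
  assumes l: "l i0 \<noteq> 0" "i0 \<notin> Z" and p: "p \<in> flag_ideal l Z"
  shows "restrict_section l i0 Z p = 0"
proof -
  note [simp] = insertion_add[OF is_hom_Const] insertion_mult[OF is_hom_Const] insertion_Var[OF is_hom_Const]
    insertion_sum[OF is_hom_Const] insertion_Const[OF is_hom_Const]
  obtain a e where "p - (\<Sum>j\<in>Z. a j * Var j) - e * linear_form l = 0"
    using p by (auto simp: flag_ideal_def gen_def adjoin_def)
  then have p: "p = (\<Sum>j\<in>Z. a j * Var j) + e * linear_form l" by (simp add: algebra_simps)
  have "section_map l i0 Z j = 0" if "j \<in> Z" for j using that l by (auto simp: section_map_def)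
  then have 1: "restrict_section l i0 Z (\<Sum>j\<in>Z. a j * Var j) = 0" by simp
  have "restrict_section l i0 Z (linear_form l) = (\<Sum>v\<in>UNIV. Const (l v) * section_map l i0 Z v)"
    by (simp add: linear_form_def)
  also have "\<dots> = Const (l i0) * section_map l i0 Z i0 + (\<Sum>u\<in>UNIV - {i0} - Z. Const (l u) * section_map l i0 Z u)
      + (\<Sum>u\<in>Z. Const (l u) * section_map l i0 Z u)" by (rule split_linear_form[OF l(2)])
  also have "(\<Sum>u\<in>Z. Const (l u) * section_map l i0 Z u) = 0"
    using l by (intro sum.neutral) (auto simp: section_map_def)
  also have "(\<Sum>u\<in>UNIV - {i0} - Z. Const (l u) * section_map l i0 Z u) = (\<Sum>u\<in>UNIV - {i0} - Z. Const (l u) * Var u)"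
    by (intro sum.cong) (auto simp: section_map_def)
  also have "Const (l i0) * section_map l i0 Z i0 = - (\<Sum>u\<in>UNIV - {i0} - Z. Const (l u) * Var u)"
    using l by (simp add: section_map_def sum_distrib_left mult.assoc[symmetric] Const_mult[symmetric])
  finally show ?thesis unfolding p using 1 by simp
qed

lemma section_map_cong:
  assumes l: "l i0 \<noteq> 0" "i0 \<notin> Z"
  shows "Var v - section_map l i0 Z v \<in> flag_ideal l Z"
proof -
  let ?I = "flag_ideal l Z"
  have I: "is_ideal ?I" using homogeneous_flag_ideal homogeneous_idealD by blast
  have Z: "Var u \<in> ?I" if "u \<in> Z" for u
    unfolding flag_ideal_def by (intro gen_mem that is_ideal_adjoin is_ideal_0) simp
  have lf: "linear_form l \<in> ?I"
    unfolding flag_ideal_def using gen_subset adjoin_mem[OF is_ideal_0] by blast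
  consider "v = i0" | "v \<in> Z" "v \<noteq> i0" | "v \<notin> Z" "v \<noteq> i0" by blast
  then show ?thesis
  proof cases
    case 1
    have "linear_form l - (\<Sum>u\<in>Z. Const (l u) * Var u) \<in> ?I"
      by (rule ideal_diff[OF I lf ideal_sum[OF I ideal_mult[OF I Z]]])
    then have "Const (1 / l i0) * (Const (l i0) * Var i0 + (\<Sum>u\<in>UNIV - {i0} - Z. Const (l u) * Var u)) \<in> ?I"
      using split_linear_form[OF l(2), of "\<lambda>u. Const (l u) * Var u"] by (intro ideal_mult[OF I]) (simp add: linear_form_def)
    then show ?thesis using 1 l
      by (simp add: section_map_def distrib_left sum_distrib_left mult.assoc[symmetric] Const_mult[symmetric])
  next
    case 2
    then show ?thesis using Z by (simp add: section_map_def)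
  next
    case 3
    then show ?thesis using ideal_0[OF I] by (simp add: section_map_def)
  qed
qed

lemma insertion_cong_mod_ideal:
  assumes I: "is_ideal I" and "\<And>v. Var v - \<phi> v \<in> I"
  shows "p - insertion Const \<phi> p \<in> I"
proof (induction p rule: mpoly_induct)
  case (monom a c)
  have "Const c * ((\<Prod>v\<in>UNIV. Var v ^ Poly_Mapping.lookup a v) - (\<Prod>v\<in>UNIV. \<phi> v ^ Poly_Mapping.lookup a v)) \<in> I"
    by (intro ideal_mult ideal_prod_cong ideal_power_cong assms)
  then show ?case unfolding insertion_single[OF is_hom_Const] unfolding single_eq_Const_mult_prod right_diff_distrib .
next
  case (add p q)
  then show ?case using ideal_add[OF I, of "p - insertion Const \<phi> p" "q - insertion Const \<phi> q"]
    by (simp add: insertion_add[OF is_hom_Const] algebra_simps)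
qed

text \<open>With \<open>restrict_section_eq_0\<close> this identifies the flag ideal as the kernel
  of the parametrization, so its quotient is a polynomial ring in the remaining variables.\<close>

lemma restrict_section_cong:
  "l i0 \<noteq> 0 \<Longrightarrow> i0 \<notin> Z \<Longrightarrow> p - restrict_section l i0 Z p \<in> flag_ideal l Z"
  by (rule insertion_cong_mod_ideal[OF homogeneous_idealD[OF homogeneous_flag_ideal] section_map_cong])

lemma Var_neq_0: "Var v \<noteq> (0 :: ('v::finite) mpoly)"
  unfolding Var_def by (metis lookup_single_eq lookup_zero zero_neq_one)

text \<open>The quotient is a polynomial ring and therefore a domain. The linear order on the
  variables enters here: it orders the monomials, which excludes zero divisors.\<close>

lemma regular_mod_flag_ideal:
  fixes v :: "'v::{finite,linorder}"
  assumes l: "l i0 \<noteq> 0" "i0 \<notin> Z" and v: "v \<notin> Z" "v \<noteq> i0"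
  shows "regular_mod (Var v) (flag_ideal l Z)"
  unfolding regular_mod_def
proof (intro allI impI)
  let ?I = "flag_ideal l Z"
  fix p assume "Var v * p \<in> ?I"
  then have "restrict_section l i0 Z (Var v * p) = 0" by (rule restrict_section_eq_0[of l i0 Z, OF l])
  then have "Var v * restrict_section l i0 Z p = 0"
    using v by (simp add: insertion_mult[OF is_hom_Const] insertion_Var[OF is_hom_Const] section_map_def)
  then have "restrict_section l i0 Z p = 0" by (simp add: Var_neq_0)
  then show "p \<in> ?I" using restrict_section_cong[of l i0 Z, OF l, of p] by simp
qed

section \<open>Forms in the free coordinates of a section, and counting their monomials\<close>

definition polys_in :: "'v set \<Rightarrow> nat \<Rightarrow> ('v::finite) mpoly set" where
  "polys_in A m = {q \<in> homogeneous_part m. \<forall>a\<in>Poly_Mapping.keys q. Poly_Mapping.keys a \<subseteq> A}"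

lemma polys_in_iff:
  "q \<in> polys_in A m \<longleftrightarrow> (\<forall>a. Poly_Mapping.lookup q a \<noteq> 0 \<longrightarrow> monom_degree a = m \<and> Poly_Mapping.keys a \<subseteq> A)"
  by (auto simp: polys_in_def homogeneous_part_def in_keys_iff)

lemma polys_in_0: "0 \<in> polys_in A m" by (simp add: polys_in_iff)

lemma polys_in_add: assumes "p \<in> polys_in A m" "q \<in> polys_in A m" shows "p + q \<in> polys_in A m"
  using assms keys_add[of p q] homogeneous_part_add[of p m q] unfolding polys_in_def by blast

lemma polys_in_uminus: "q \<in> polys_in A m \<Longrightarrow> - q \<in> polys_in A m"
  by (simp add: polys_in_iff)

lemma polys_in_sum: "(\<And>x. x \<in> B \<Longrightarrow> p x \<in> polys_in A m) \<Longrightarrow> (\<Sum>x\<in>B. p x) \<in> polys_in A m"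
  by (induction B rule: infinite_finite_induct) (auto simp: polys_in_0 polys_in_add)

lemma polys_in_mult:
  assumes "p \<in> polys_in A m" "q \<in> polys_in A k" shows "p * q \<in> polys_in A (m + k)"
proof -
  have "Poly_Mapping.keys c \<subseteq> A" if c: "c \<in> Poly_Mapping.keys (p * q)" for c
  proof -
    obtain a b where "c = a + b" "a \<in> Poly_Mapping.keys p" "b \<in> Poly_Mapping.keys q"
      using keys_mult[of p q] c by blast
    then show ?thesis using keys_add[of a b] assms unfolding polys_in_def by blast
  qed
  then show ?thesis using assms homogeneous_part_mult[of p m q k] by (auto simp: polys_in_def)
qed

lemma polys_in_Const: "Const c \<in> polys_in A 0"
  using Const_hom by (auto simp: polys_in_def Const_def)

lemma polys_in_1: "1 \<in> polys_in A 0"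
  using polys_in_Const[of 1] by simp

lemma polys_in_Const_mult: "p \<in> polys_in A m \<Longrightarrow> Const c * p \<in> polys_in A m"
  using polys_in_mult[OF polys_in_Const, of p A m c] by simp

lemma polys_in_Var: "v \<in> A \<Longrightarrow> Var v \<in> polys_in A 1"
  using Var_hom[of v] by (auto simp: polys_in_def Var_def)

lemma polys_in_power: "p \<in> polys_in A m \<Longrightarrow> p ^ k \<in> polys_in A (k * m)"
  by (induction k) (auto simp: polys_in_1 polys_in_mult)

lemma polys_in_prod:
  "finite X \<Longrightarrow> (\<And>j. j \<in> X \<Longrightarrow> p j \<in> polys_in A (m j)) \<Longrightarrow> (\<Prod>j\<in>X. p j) \<in> polys_in A (\<Sum>j\<in>X. m j)"
  by (induction X rule: finite_induct) (auto simp: polys_in_1 polys_in_mult)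

lemma restrict_section_polys_in:
  assumes p: "p \<in> homogeneous_part m"
  shows "restrict_section l i0 Z p \<in> polys_in (UNIV - {i0} - Z) m"
  unfolding insertion_def
proof (intro polys_in_sum polys_in_Const_mult)
  fix a assume "a \<in> Poly_Mapping.keys p"
  then have m: "m = (\<Sum>v\<in>UNIV. Poly_Mapping.lookup a v * 1)"
    using p by (auto simp: homogeneous_part_def monom_degree_def)
  have s: "section_map l i0 Z v \<in> polys_in (UNIV - {i0} - Z) 1" for v
    by (auto simp: section_map_def polys_in_0 simp del: One_nat_def intro!: polys_in_uminus polys_in_sum polys_in_Const_mult polys_in_Var)
  show "(\<Prod>v\<in>UNIV. section_map l i0 Z v ^ Poly_Mapping.lookup a v) \<in> polys_in (UNIV - {i0} - Z) m"
    unfolding m by (intro polys_in_prod polys_in_power s) simp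
qed

text \<open>A crude count by boxes of exponents. What counts is the growth exponent
  \<open>card A\<close>, one less than that of the monomials in \<open>card A + 1\<close>
  forms.\<close>

lemma card_bounded_monomials:
  fixes A :: "'v::finite set" and D :: nat
  defines "M \<equiv> {a :: 'v \<Rightarrow>\<^sub>0 nat. monom_degree a \<le> D \<and> Poly_Mapping.keys a \<subseteq> A}"
  shows "finite M" "card M \<le> (D + 1) ^ card A"
proof -
  let ?P = "PiE A (\<lambda>_. {..D})"
  let ?r = "\<lambda>a. restrict (Poly_Mapping.lookup a) A"
  have inj: "inj_on ?r M"
  proof (rule inj_onI)
    fix a b assume M: "a \<in> M" "b \<in> M" and r: "?r a = ?r b"
    have "Poly_Mapping.lookup a v = Poly_Mapping.lookup b v" for v
    proof (cases "v \<in> A")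
      case True
      then show ?thesis using fun_cong[OF r, of v] unfolding restrict_apply by (simp only: if_True)
    next
      case False
      then have "v \<notin> Poly_Mapping.keys a" "v \<notin> Poly_Mapping.keys b" using M by (auto simp: M_def)
      then show ?thesis by (simp add: in_keys_iff)
    qed
    then show "a = b" by (rule poly_mapping_eqI)
  qed
  have "Poly_Mapping.lookup a v \<le> D" if "a \<in> M" for a v
    using that member_le_sum[of v UNIV "Poly_Mapping.lookup a"] by (auto simp: M_def monom_degree_def)
  then have sub: "?r ` M \<subseteq> ?P" by auto
  have fin: "finite ?P" by (intro finite_PiE) auto
  show "finite M" using finite_imageD[OF finite_subset[OF sub fin] inj] .
  have "card M \<le> card ?P" by (rule card_inj_on_le[OF inj sub fin])
  then show "card M \<le> (D + 1) ^ card A" by (simp add: card_PiE)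
qed

lemma monomial_expansion:
  assumes "finite M" "Poly_Mapping.keys q \<subseteq> M"
  shows "q = (\<Sum>a\<in>M. Const (Poly_Mapping.lookup q a) * Poly_Mapping.single a 1)"
proof (rule poly_mapping_eqI)
  fix b
  show "Poly_Mapping.lookup q b = Poly_Mapping.lookup (\<Sum>a\<in>M. Const (Poly_Mapping.lookup q a) * Poly_Mapping.single a 1) b"
    using assms by (auto simp: lookup_sum Const_def mult_single lookup_single when_def in_keys_iff)
qed

text \<open>Supplies the dimension hypothesis of Noether normalization, with \<open>k\<close> the
  number of free variables; one set serves all degrees up to \<open>D\<close>.\<close>

lemma flag_ideal_span:
  fixes l :: "'v::finite \<Rightarrow> complex"
  assumes l: "l i0 \<noteq> 0" "i0 \<notin> Z"
  shows "\<exists>W. finite W \<and> card W \<le> (D + 1) ^ card (UNIV - {i0} - Z) \<and>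
      (\<forall>m\<le>D. \<forall>p\<in>homogeneous_part m. \<exists>c. p - (\<Sum>w\<in>W. Const (c w) * w) \<in> flag_ideal l Z)"
proof -
  let ?A = "UNIV - {i0} - Z"
  define M where "M = {a :: 'v \<Rightarrow>\<^sub>0 nat. monom_degree a \<le> D \<and> Poly_Mapping.keys a \<subseteq> ?A}"
  note M = card_bounded_monomials[of D ?A, folded M_def]
  define s where "s a = (Poly_Mapping.single a 1 :: 'v mpoly)" for a
  have inj: "inj_on s M" by (rule inj_onI) (metis s_def lookup_single_eq lookup_single_not_eq zero_neq_one)
  show ?thesis
  proof (intro exI[of _ "s ` M"] conjI allI impI ballI)
    show "card (s ` M) \<le> (D + 1) ^ card ?A" using M(2) card_image[OF inj] by simp
  next
    fix m and p :: "'v mpoly" assume m: "m \<le> D" and p: "p \<in> homogeneous_part m"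
    let ?q = "restrict_section l i0 Z p"
    have "?q \<in> polys_in ?A m" by (rule restrict_section_polys_in[OF p])
    then have "Poly_Mapping.keys ?q \<subseteq> M" using m by (auto simp: polys_in_def homogeneous_part_def M_def)
    then have "?q = (\<Sum>a\<in>M. Const (Poly_Mapping.lookup ?q a) * s a)"
      unfolding s_def by (rule monomial_expansion[OF M(1)])
    also have "\<dots> = (\<Sum>w\<in>s ` M. Const (Poly_Mapping.lookup ?q (the_inv_into M s w)) * w)"
      by (simp add: sum.reindex[OF inj] the_inv_into_f_f[OF inj])
    finally show "\<exists>c. p - (\<Sum>w\<in>s ` M. Const (c w) * w) \<in> flag_ideal l Z"
      using restrict_section_cong[of l i0 Z, OF l, of p]
      by (intro exI[of _ "\<lambda>w. Poly_Mapping.lookup ?q (the_inv_into M s w)"]) simp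
  qed (use M in simp)
qed

section \<open>Complete intersections of forms of equal degree\<close>

text \<open>For homogeneous \<open>Q\<close> this says that \<open>Q\<close> has no zeros in
  projective space; the unit ideal is included.\<close>

definition primary_mod :: "('v::finite) mpoly set \<Rightarrow> bool" where
  "primary_mod Q \<longleftrightarrow> (\<forall>v. \<exists>k. Var v ^ k \<in> Q)"

lemma primary_mod_mono: "primary_mod Q \<Longrightarrow> Q \<subseteq> Q' \<Longrightarrow> primary_mod Q'"
  unfolding primary_mod_def by blast

text \<open>An element that is nilpotent modulo \<open>Q\<close> contributes nothing to the
  radical.\<close>

lemma primary_mod_remove:
  assumes Q: "is_ideal Q" and P: "primary_mod (adjoin u Q)" and u: "u ^ e \<in> Q"
  shows "primary_mod Q"
  unfolding primary_mod_def
proof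
  fix v
  obtain k where "Var v ^ k \<in> adjoin u Q" using P unfolding primary_mod_def by blast
  then obtain c where "Var v ^ k - c * u \<in> Q" unfolding adjoin_def by blast
  then have "(Var v ^ k) ^ e - (c * u) ^ e \<in> Q" by (rule ideal_power_cong[OF Q])
  moreover have "(c * u) ^ e \<in> Q" using ideal_mult[OF Q u, of "c ^ e"] by (simp add: power_mult_distrib)
  ultimately have "Var v ^ (k * e) \<in> Q" using ideal_cong[OF Q] by (simp add: power_mult)
  then show "\<exists>k. Var v ^ k \<in> Q" by blast
qed

lemma gen_mono: "I \<subseteq> J \<Longrightarrow> gen \<theta> X I \<subseteq> gen \<theta> X J"
  unfolding gen_def by blast

lemma primary_shear:
  fixes \<theta> :: "'i \<Rightarrow> ('v::finite) mpoly"
  assumes l: "l i0 \<noteq> 0" "i0 \<notin> Z" and X: "finite X" "card X = Suc (card (UNIV - {i0} - Z))"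
    and \<theta>: "\<And>j. j \<in> X \<Longrightarrow> \<theta> j \<in> homogeneous_part d" and d: "d \<ge> 1"
    and P: "primary_mod (gen \<theta> X (flag_ideal l Z))"
  obtains i \<mu> where "i \<in> X" "\<mu> i = 0"
    "primary_mod (gen (\<lambda>j. \<theta> j - Const (\<mu> j) * \<theta> i) (X - {i}) (flag_ideal l Z))"
proof -
  let ?I = "flag_ideal l Z"
  have I: "homogeneous_ideal ?I" by (rule homogeneous_flag_ideal)
  note Ii = homogeneous_idealD[OF I]
  obtain i \<mu> e where i: "i \<in> X" "\<mu> i = 0" and e: "\<theta> i ^ e \<in> gen (\<lambda>j. \<theta> j - Const (\<mu> j) * \<theta> i) (X - {i}) ?I"
    by (rule noether_shear[OF I X \<theta> d flag_ideal_span[of l i0 Z, OF l]])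
  let ?\<theta> = "\<lambda>j. \<theta> j - Const (\<mu> j) * \<theta> i"
  have X': "finite (X - {i})" "i \<notin> X - {i}" "insert i (X - {i}) = X" using X i by auto
  have "gen \<theta> X ?I = adjoin (\<theta> i) (gen ?\<theta> (X - {i}) ?I)"
    using gen_insert[OF X'(1,2), of ?\<theta> ?I] X'(3) gen_shear[OF X(1) i(1) Ii, of "\<lambda>j. Const (\<mu> j)" \<theta>] i by simp
  then have "primary_mod (gen ?\<theta> (X - {i}) ?I)"
    using primary_mod_remove[OF is_ideal_gen[OF X'(1) Ii] _ e] P by simp
  then show thesis using that i by blast
qed

lemma Var_linear: "Var v = (\<Sum>u\<in>UNIV. (if u = v then 1 else 0) * Var (u :: 'v::finite))"
  by (simp add: if_mult)

text \<open>Induction on the number of forms. Setting one more variable \<open>v\<close> to 0 leaves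
  one form too many; Noether normalization drops one, induction applies to the rest, and the
  exchange step then trades \<open>v\<close> for the dropped form.\<close>

theorem complete_intersection:
  fixes \<theta> :: "'i \<Rightarrow> ('v::{finite,linorder}) mpoly"
  assumes l: "l i0 \<noteq> 0" "i0 \<notin> Z" and d: "d \<ge> 1"
    and X: "finite X" "card X = card (UNIV - {i0} - Z)"
    and \<theta>: "\<And>j. j \<in> X \<Longrightarrow> \<theta> j \<in> homogeneous_part d"
    and P: "primary_mod (gen \<theta> X (flag_ideal l Z))"
  shows "only_koszul \<theta> X (flag_ideal l Z) \<and> socle_above (card X * (d - 1)) (gen \<theta> X (flag_ideal l Z))"
  using l(2) X \<theta> P
proof (induction "card X" arbitrary: X \<theta> Z)
  case 0
  then have "X = {}" using 0(1,3) by simp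
  then show ?case by (auto simp: only_koszul_def socle_above_def intro!: exI[of _ "\<lambda>_ _. 0"])
next
  case (Suc k X \<theta> Z)
  have "UNIV - {i0} - Z \<noteq> {}" using Suc.hyps(2) Suc.prems(3) by (metis card.empty nat.distinct(1))
  then obtain v where v: "v \<noteq> i0" "v \<notin> Z" by blast
  let ?I = "flag_ideal l Z" and ?Z = "insert v Z"
  have I: "homogeneous_ideal ?I" by (rule homogeneous_flag_ideal)
  note Ii = homogeneous_idealD[OF I]
  have Z: "flag_ideal l ?Z = adjoin (Var v) ?I" by (rule flag_ideal_insert[OF v(2)])
  have i0: "i0 \<notin> ?Z" using Suc.prems v by auto
  have "UNIV - {i0} - Z = insert v (UNIV - {i0} - ?Z)" using v by auto
  then have cZ: "card (UNIV - {i0} - Z) = Suc (card (UNIV - {i0} - ?Z))" by simp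
  have "primary_mod (gen \<theta> X (flag_ideal l ?Z))"
    using primary_mod_mono[OF Suc.prems(5) gen_mono[OF adjoin_subset[OF Ii]]] unfolding Z .
  from primary_shear[of l i0 ?Z X \<theta> d, OF l(1) i0 Suc.prems(2) Suc.prems(3)[unfolded cZ] Suc.prems(4) d this]
  obtain i \<mu> where i: "i \<in> X" "\<mu> i = 0"
    and P: "primary_mod (gen (\<lambda>j. \<theta> j - Const (\<mu> j) * \<theta> i) (X - {i}) (flag_ideal l ?Z))"
    by blast
  let ?\<theta> = "\<lambda>j. \<theta> j - Const (\<mu> j) * \<theta> i"
  have k: "k = card (X - {i})" using Suc.hyps(2) i Suc.prems(2) by simp
  have IH: "only_koszul ?\<theta> (X - {i}) (flag_ideal l ?Z) \<and>
      socle_above (card (X - {i}) * (d - 1)) (gen ?\<theta> (X - {i}) (flag_ideal l ?Z))"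
  proof (rule Suc.hyps(1)[OF k i0 _ _ _ P])
    show "card (X - {i}) = card (UNIV - {i0} - ?Z)" using k Suc.hyps(2) Suc.prems(3) cZ by simp
    show "?\<theta> j \<in> homogeneous_part d" if "j \<in> X - {i}" for j
      using that i by (intro homogeneous_part_diff homogeneous_part_Const_mult Suc.prems) auto
  qed (use Suc.prems in simp)
  \<comment> \<open>A power of \<open>Var v\<close> in the ideal of all forms is what makes the
    dropped form regular.\<close>
  obtain K where K: "Var v ^ K \<in> gen \<theta> X ?I" using Suc.prems(5) unfolding primary_mod_def by blast
  have "only_koszul \<theta> X ?I \<and> socle_above (card (X - {i}) * (d - 1) + (d - 1)) (gen \<theta> X ?I)"
    by (rule complete_intersection_step[of ?I "Var v" "\<lambda>u. if u = v then 1 else 0" X i \<theta> d \<mu>, OF I Var_linear Var_hom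
        regular_mod_flag_ideal[of l i0 Z, OF l(1) Suc.prems(1) v(2,1)] Suc.prems(2) i(1) Suc.prems(4) d i(2) _ _ K])
       (use IH in \<open>simp_all add: Z\<close>)
  moreover have "card (X - {i}) * (d - 1) + (d - 1) = card X * (d - 1)" using k Suc.hyps(2)[symmetric] by simp
  ultimately show ?case by simp
qed

text \<open>On the hyperplane \<open>L = 0\<close> there is one form more than coordinates, so one
  is dropped there. The statement about relations is then lifted from the hyperplane to the whole
  ring, which is possible because \<open>L\<close> is nonzero in a domain.\<close>

theorem almost_complete_intersection:
  fixes \<theta> :: "'v \<Rightarrow> ('v::{finite,linorder}) mpoly"
  assumes l: "l i0 \<noteq> 0" and d: "d \<ge> 1" and \<theta>: "\<And>j. \<theta> j \<in> homogeneous_part d"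
    and P: "primary_mod (gen \<theta> UNIV (adjoin (linear_form l) {0}))"
  obtains i \<mu> I where "\<mu> i = 0" "I = gen (\<lambda>j. \<theta> j - Const (\<mu> j) * \<theta> i) (UNIV - {i}) {0}"
    "regular_mod (linear_form l) I" "only_koszul (\<lambda>j. \<theta> j - Const (\<mu> j) * \<theta> i) (UNIV - {i}) {0}"
    "socle_above ((CARD('v) - 1) * (d - 1)) (adjoin (linear_form l) I)"
    "primary_mod (adjoin (linear_form l) I)"
proof -
  let ?L = "linear_form l"
  have F: "flag_ideal l {} = adjoin ?L {0}" by (simp add: flag_ideal_def)
  have empty_not: "i0 \<notin> {}" by simp
  have c: "card (UNIV :: 'v set) = Suc (card (UNIV - {i0} - {} :: 'v set))"
    by (simp add: card_Suc_Diff1)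
  obtain i \<mu> where i: "\<mu> i = 0" and P: "primary_mod (gen (\<lambda>j. \<theta> j - Const (\<mu> j) * \<theta> i) (UNIV - {i}) (flag_ideal l {}))"
    using primary_shear[of l i0 "{}" UNIV \<theta> d, OF l empty_not finite c \<theta> d P[folded F]] by blast
  let ?\<theta> = "\<lambda>j. \<theta> j - Const (\<mu> j) * \<theta> i"
  have \<theta>': "?\<theta> j \<in> homogeneous_part d" for j
    by (intro homogeneous_part_diff homogeneous_part_Const_mult \<theta>)
  have cc: "card (UNIV - {i}) = card (UNIV - {i0} - {} :: 'v set)" by simp
  have CI: "only_koszul ?\<theta> (UNIV - {i}) (flag_ideal l {}) \<and>
      socle_above (card (UNIV - {i}) * (d - 1)) (gen ?\<theta> (UNIV - {i}) (flag_ideal l {}))"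
    by (rule complete_intersection[OF l _ d _ cc \<theta>' P]) auto
  define I where "I = gen ?\<theta> (UNIV - {i}) {0}"
  have "linear_form l \<noteq> 0"
  proof
    assume "linear_form l = 0"
    then have "poly_eval (linear_form l) (\<chi> v. if v = i0 then 1 else 0) = 0" by (simp add: poly_eval_0)
    then show False using l
      by (simp add: linear_form_def poly_eval_sum poly_eval_mult poly_eval_Const poly_eval_Var if_distrib cong: if_cong)
  qed
  then have L: "regular_mod ?L {0}" by (simp add: regular_mod_def)
  have g: "gen ?\<theta> (UNIV - {i}) (adjoin ?L {0}) = adjoin ?L I"
    unfolding I_def by (rule gen_adjoin[OF _ is_ideal_0]) simp
  have "regular_mod ?L I"
    unfolding I_def by (rule regular_mod_gen[OF _ is_ideal_0 L]) (use CI F in simp_all)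
  moreover have "only_koszul ?\<theta> (UNIV - {i}) {0}"
    by (rule only_koszul_lift[OF _ homogeneous_ideal_0 \<theta>' linear_form_hom L]) (use CI F in simp_all)
  ultimately show thesis
    using that[of \<mu> i I] i I_def CI P unfolding F g by (simp add: card_Diff_singleton)
qed

lemma Const_prod: "Const (\<Prod>x\<in>A. c x) = (\<Prod>x\<in>A. Const (c x))"
  by (induction A rule: infinite_finite_induct) (auto simp: Const_mult)

section \<open>Binary forms\<close>

text \<open>The homogenization of \<open>P\<close> to degree \<open>K\<close>, evaluated at the pair \<open>(y, z)\<close>.\<close>

definition binary_form :: "complex poly \<Rightarrow> nat \<Rightarrow> ('v::finite) mpoly \<Rightarrow> 'v mpoly \<Rightarrow> 'v mpoly" where
  "binary_form P K y z = (\<Sum>i\<le>K. Const (coeff P i) * y ^ i * z ^ (K - i))"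

lemma binary_form_sum: "binary_form (\<Sum>x\<in>A. P x) K y z = (\<Sum>x\<in>A. binary_form (P x) K y z)"
  unfolding binary_form_def coeff_sum Const_sum sum_distrib_right by (rule sum.swap)

lemma binary_form_smult: "binary_form (smult c P) K y z = Const c * binary_form P K y z"
  by (simp add: binary_form_def Const_mult sum_distrib_left mult.assoc)

lemma binary_form_diff: "binary_form (P - Q) K y z = binary_form P K y z - binary_form Q K y z"
  by (simp add: binary_form_def Const_diff left_diff_distrib sum_subtractf)

lemma binary_form_pCons: "binary_form (pCons 0 P) (Suc K) y z = y * binary_form P K y z"
  by (simp add: binary_form_def sum.atMost_Suc_shift sum_distrib_left ac_simps del: sum.atMost_Suc)

lemma binary_form_Suc: "degree P \<le> K \<Longrightarrow> binary_form P (Suc K) y z = z * binary_form P K y z"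
  by (simp add: binary_form_def coeff_eq_0 sum_distrib_left Suc_diff_le ac_simps)

lemma binary_form_linear:
  assumes "degree P \<le> K"
  shows "binary_form ([:- \<gamma>, 1:] * P) (Suc K) y z = (y - Const \<gamma> * z) * binary_form P K y z"
proof -
  have "[:- \<gamma>, 1:] * P = pCons 0 P - smult \<gamma> P" by simp
  then show ?thesis
    by (simp add: binary_form_diff binary_form_pCons binary_form_smult binary_form_Suc[OF assms] algebra_simps
        del: mult_pCons_left)
qed

lemma binary_form_prod:
  "finite S \<Longrightarrow> binary_form (\<Prod>\<beta>\<in>S. [:- \<beta>, 1:]) (card S) y z = (\<Prod>\<beta>\<in>S. y - Const \<beta> * z)"
proof (induction S rule: finite_induct)
  case empty
  then show ?case by (simp add: binary_form_def)
next
  case (insert \<beta> S)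
  have "degree (\<Prod>\<beta>\<in>S. [:- \<beta>, 1:]) \<le> card S"
    using degree_prod_sum_le[OF insert(1), of "\<lambda>\<beta>. [:- \<beta>, 1:]"] by simp
  from binary_form_linear[OF this, of \<beta> y z] insert show ?case by (simp del: mult_pCons_left)
qed

text \<open>Factorization over the complex numbers. The power of \<open>z\<close> accounts for the
  roots at infinity when the degree of \<open>P\<close> falls short of \<open>K\<close>.\<close>

lemma binary_form_factor:
  assumes "P \<noteq> 0" "degree P \<le> K"
  obtains c \<gamma>s where "c \<noteq> 0"
    "\<And>y z :: ('v::finite) mpoly. binary_form P K y z = Const c * (z ^ (K - length \<gamma>s) * (\<Prod>\<gamma>\<leftarrow>\<gamma>s. y - Const \<gamma> * z))"
proof -
  have "\<exists>c \<gamma>s. c \<noteq> 0 \<and> (\<forall>y z :: 'v mpoly. binary_form P K y z = Const c * (z ^ (K - length \<gamma>s) * (\<Prod>\<gamma>\<leftarrow>\<gamma>s. y - Const \<gamma> * z)))"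
    using assms
  proof (induction "degree P" arbitrary: P K)
    case 0
    then obtain c where c: "P = [:c:]" by (metis degree_eq_zeroE)
    have "binary_form P K y z = Const c * z ^ K" for y z :: "'v mpoly"
    proof -
      have "binary_form P K y z = (\<Sum>i\<le>K. if i = 0 then Const c * z ^ K else 0)"
        unfolding binary_form_def c by (intro sum.cong) (auto simp: coeff_pCons split: nat.split)
      then show ?thesis by simp
    qed
    then show ?case using c 0 by (intro exI[of _ c] exI[of _ "[]"]) auto
  next
    case (Suc n)
    then obtain \<gamma> where "poly P \<gamma> = 0"
      using fundamental_theorem_of_algebra constant_degree by (metis nat.distinct(1))
    then obtain P' where P': "P = [:- \<gamma>, 1:] * P'" by (metis poly_eq_0_iff_dvd dvdE)
    have nz: "P' \<noteq> 0" using P' Suc by auto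
    then have deg: "degree P = Suc (degree P')" unfolding P' by (subst degree_mult_eq) auto
    obtain K' where K: "K = Suc K'" using Suc by (cases K) auto
    have "degree P' \<le> K'" using deg K Suc by simp
    moreover have "n = degree P'" using Suc deg by simp
    ultimately obtain c \<gamma>s where IH: "c \<noteq> 0"
      "\<forall>y z :: 'v mpoly. binary_form P' K' y z = Const c * (z ^ (K' - length \<gamma>s) * (\<Prod>\<gamma>\<leftarrow>\<gamma>s. y - Const \<gamma> * z))"
      using Suc.hyps(1) nz by blast
    have "binary_form P K y z = Const c * (z ^ (K - length (\<gamma> # \<gamma>s)) * (\<Prod>\<gamma>\<leftarrow>\<gamma> # \<gamma>s. y - Const \<gamma> * z))" for y z :: "'v mpoly"
      unfolding P' K binary_form_linear[OF \<open>degree P' \<le> K'\<close>] using IH(2) by (simp add: ac_simps)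
    then show ?case using IH(1) by blast
  qed
  then show thesis using that by blast
qed

section \<open>Nullstellensatz\<close>

text \<open>Otherwise every \<open>x\<^sub>v - \<beta>\<close> has an inverse \<open>r \<beta>\<close> modulo \<open>Q\<close>. Uncountably many polynomials
  \<open>r \<beta>\<close> are linearly dependent, and clearing denominators yields a univariate polynomial in \<open>Q\<close>.\<close>

lemma nullstellensatz_step:
  fixes Q :: "('v::finite) mpoly set"
  assumes Q: "is_ideal Q" "1 \<notin> Q"
  shows "\<exists>\<beta>. 1 \<notin> adjoin (Var v - Const \<beta>) Q"
proof (rule ccontr)
  assume "\<nexists>\<beta>. 1 \<notin> adjoin (Var v - Const \<beta>) Q"
  then have "\<forall>\<beta>. \<exists>r. 1 - r * (Var v - Const \<beta>) \<in> Q" by (auto simp: adjoin_def)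
  from choice[OF this] obtain r where r: "\<And>\<beta>. 1 - r \<beta> * (Var v - Const \<beta>) \<in> Q" by blast
  define M where "M D = {a :: 'v \<Rightarrow>\<^sub>0 nat. monom_degree a \<le> D \<and> Poly_Mapping.keys a \<subseteq> UNIV}" for D
  define S where "S D = {\<beta>. Poly_Mapping.keys (r \<beta>) \<subseteq> M D}" for D
  have "\<beta> \<in> (\<Union>D. S D)" for \<beta>
  proof -
    have "Poly_Mapping.keys (r \<beta>) \<subseteq> M (\<Sum>a\<in>Poly_Mapping.keys (r \<beta>). monom_degree a)"
      by (auto simp: M_def intro: member_le_sum)
    then show ?thesis by (auto simp: S_def)
  qed
  then have "(\<Union>D. S D) = (UNIV :: complex set)" by blast
  \<comment> \<open>Countably many finite sets cannot cover the uncountable field, so infinitely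
    many inverses live in one space of bounded degree.\<close>
  then have "\<not> (\<forall>D. finite (S D))"
    using uncountable_UNIV_complex by (metis countable_UN countable_finite countableI_type)
  then obtain D where D: "infinite (S D)" by blast
  have M: "finite (M D)" unfolding M_def by (rule card_bounded_monomials)
  obtain T where T: "T \<subseteq> S D" "finite T" "card T = Suc (card (M D))"
    using infinite_arbitrarily_large[OF D] by blast
  have ex: "r \<beta> - (\<Sum>a\<in>M D. Const (Poly_Mapping.lookup (r \<beta>) a) * Poly_Mapping.single a 1) \<in> Q" if "\<beta> \<in> T" for \<beta>
  proof -
    have "r \<beta> = (\<Sum>a\<in>M D. Const (Poly_Mapping.lookup (r \<beta>) a) * Poly_Mapping.single a 1)"
      using that T by (intro monomial_expansion[OF M]) (auto simp: S_def)
    then show ?thesis using ideal_0[OF Q(1)] by simp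
  qed
  obtain x where x: "\<exists>t\<in>T. x t \<noteq> 0" "(\<Sum>t\<in>T. Const (x t) * r t) \<in> Q"
    by (rule dependent_mod_ideal[OF Q(1) M T(2) _ ex]) (use T in auto)
  define lin where "lin \<beta> = Var v - Const \<beta>" for \<beta>
  \<comment> \<open>The numerator of \<open>\<Sum> x\<^sub>\<beta> / (X - \<beta>)\<close> over the
    common denominator; at \<open>t0\<close> a single summand survives, so \<open>P\<close> is
    nonzero.\<close>
  define P where "P = (\<Sum>\<beta>\<in>T. smult (x \<beta>) (\<Prod>\<gamma>\<in>T - {\<beta>}. [:- \<gamma>, 1:]))"
  obtain t0 where t0: "t0 \<in> T" "x t0 \<noteq> 0" using x by blast
  have "poly P t0 = (\<Sum>\<beta>\<in>T. x \<beta> * (\<Prod>\<gamma>\<in>T - {\<beta>}. t0 - \<gamma>))"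
    by (simp add: P_def poly_sum poly_prod)
  also have "\<dots> = (\<Sum>\<beta>\<in>T. if \<beta> = t0 then x t0 * (\<Prod>\<gamma>\<in>T - {t0}. t0 - \<gamma>) else 0)"
    using T t0 by (intro sum.cong) auto
  also have "\<dots> \<noteq> 0" using T t0 by auto
  finally have P0: "P \<noteq> 0" by auto
  define K where "K = card (M D)"
  have cK: "card (T - {\<beta>}) = K" if "\<beta> \<in> T" for \<beta> using that T by (simp add: K_def)
  have dP: "degree P \<le> K"
    unfolding P_def
  proof (intro degree_sum_le T)
    fix \<beta> assume "\<beta> \<in> T"
    then show "degree (smult (x \<beta>) (\<Prod>\<gamma>\<in>T - {\<beta>}. [:- \<gamma>, 1:])) \<le> K"
      using degree_prod_sum_le[of "T - {\<beta>}" "\<lambda>\<gamma>. [:- \<gamma>, 1:]"] cK T(2) degree_smult_le[of "x \<beta>"]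
      by (auto intro: order.trans)
  qed
  have "binary_form P K (Var v) 1 = (\<Sum>\<beta>\<in>T. Const (x \<beta>) * (\<Prod>\<gamma>\<in>T - {\<beta>}. lin \<gamma>))"
    unfolding P_def binary_form_sum binary_form_smult
  proof (rule sum.cong[OF refl])
    fix \<beta> assume "\<beta> \<in> T"
    from binary_form_prod[of "T - {\<beta>}" "Var v" 1] T(2) cK[OF this]
    show "Const (x \<beta>) * binary_form (\<Prod>\<gamma>\<in>T - {\<beta>}. [:- \<gamma>, 1:]) K (Var v) 1 = Const (x \<beta>) * (\<Prod>\<gamma>\<in>T - {\<beta>}. lin \<gamma>)"
      by (simp add: lin_def)
  qed
  moreover have "(\<Prod>\<gamma>\<in>T. lin \<gamma>) * (\<Sum>t\<in>T. Const (x t) * r t) -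
      (\<Sum>\<beta>\<in>T. Const (x \<beta>) * (\<Prod>\<gamma>\<in>T - {\<beta>}. lin \<gamma>)) =
      (\<Sum>\<beta>\<in>T. - (Const (x \<beta>) * (\<Prod>\<gamma>\<in>T - {\<beta>}. lin \<gamma>)) * (1 - r \<beta> * lin \<beta>))"
    unfolding sum_distrib_left sum_subtractf[symmetric]
    by (intro sum.cong refl) (simp add: prod.remove[OF T(2)] algebra_simps)
  moreover have "(\<Sum>\<beta>\<in>T. - (Const (x \<beta>) * (\<Prod>\<gamma>\<in>T - {\<beta>}. lin \<gamma>)) * (1 - r \<beta> * lin \<beta>)) \<in> Q"
    unfolding lin_def by (intro ideal_sum ideal_mult Q r)
  ultimately have bQ: "binary_form P K (Var v) 1 \<in> Q"
    using ideal_cong[OF Q(1)] ideal_mult[OF Q(1) x(2)] by metis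
  obtain c \<gamma>s where c: "c \<noteq> 0"
    "\<And>y z :: 'v mpoly. binary_form P K y z = Const c * (z ^ (K - length \<gamma>s) * (\<Prod>\<gamma>\<leftarrow>\<gamma>s. y - Const \<gamma> * z))"
    using binary_form_factor[where 'v = 'v, OF P0 dP] by blast
  have "Const c * (\<Prod>\<gamma>\<leftarrow>\<gamma>s. lin \<gamma>) \<in> Q" using bQ c(2)[of "Var v" 1] by (simp add: lin_def)
  then have "Const (1 / c) * (Const c * (\<Prod>\<gamma>\<leftarrow>\<gamma>s. lin \<gamma>)) \<in> Q" by (rule ideal_mult[OF Q(1)])
  then have "(\<Prod>\<gamma>\<leftarrow>\<gamma>s. lin \<gamma>) \<in> Q" using c(1) by (simp add: mult.assoc[symmetric] Const_mult[symmetric])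
  \<comment> \<open>A product of units modulo the proper ideal \<open>Q\<close> cannot lie in
    \<open>Q\<close>.\<close>
  moreover have "(\<Prod>\<gamma>\<leftarrow>\<gamma>s. lin \<gamma>) \<notin> Q" for \<gamma>s
  proof (induction \<gamma>s)
    case Nil
    then show ?case using Q by simp
  next
    case (Cons \<gamma> \<gamma>s)
    show ?case
    proof
      assume "(\<Prod>\<gamma>\<leftarrow>\<gamma> # \<gamma>s. lin \<gamma>) \<in> Q"
      then have A: "lin \<gamma> * (\<Prod>\<gamma>\<leftarrow>\<gamma>s. lin \<gamma>) \<in> Q" by simp
      have "1 - r \<gamma> * lin \<gamma> \<in> Q" using r by (simp add: lin_def)
      from ideal_add[OF Q(1) ideal_mult[OF Q(1) A, of "r \<gamma>"] ideal_mult[OF Q(1) this, of "\<Prod>\<gamma>\<leftarrow>\<gamma>s. lin \<gamma>"]]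
      have "(\<Prod>\<gamma>\<leftarrow>\<gamma>s. lin \<gamma>) \<in> Q" by (simp add: algebra_simps)
      then show False using Cons by simp
    qed
  qed
  ultimately show False by blast
qed

text \<open>Prescribing one coordinate after another keeps the ideal proper. Once all are
  prescribed, every polynomial is congruent to its value at the point, and a nonzero constant would
  generate everything.\<close>

lemma weak_nullstellensatz:
  fixes Q :: "('v::finite) mpoly set"
  assumes Q: "is_ideal Q" "1 \<notin> Q"
  obtains x where "\<And>p. p \<in> Q \<Longrightarrow> poly_eval p x = 0"
proof -
  have "\<exists>Q'. is_ideal Q' \<and> Q \<subseteq> Q' \<and> 1 \<notin> Q' \<and> (\<forall>v\<in>A. \<exists>\<beta>. Var v - Const \<beta> \<in> Q')" if "finite A" for A
    using that
  proof (induction A rule: finite_induct)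
    case empty
    then show ?case using Q by blast
  next
    case (insert v A)
    then obtain Q' where Q': "is_ideal Q'" "Q \<subseteq> Q'" "1 \<notin> Q'" "\<forall>v\<in>A. \<exists>\<beta>. Var v - Const \<beta> \<in> Q'" by blast
    obtain \<beta> where \<beta>: "1 \<notin> adjoin (Var v - Const \<beta>) Q'" using nullstellensatz_step[OF Q'(1,3)] by blast
    show ?case
    proof (intro exI[of _ "adjoin (Var v - Const \<beta>) Q'"] conjI)
      show "is_ideal (adjoin (Var v - Const \<beta>) Q')" by (rule is_ideal_adjoin[OF Q'(1)])
      show "Q \<subseteq> adjoin (Var v - Const \<beta>) Q'" using adjoin_subset[OF Q'(1)] Q'(2) by blast
      show "1 \<notin> adjoin (Var v - Const \<beta>) Q'" by (rule \<beta>)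
      show "\<forall>u\<in>insert v A. \<exists>\<beta>'. Var u - Const \<beta>' \<in> adjoin (Var v - Const \<beta>) Q'"
        using adjoin_subset[OF Q'(1)] adjoin_mem[OF Q'(1)] Q'(4) by blast
    qed
  qed
  from this[of UNIV] obtain Q' where Q': "is_ideal Q'" "Q \<subseteq> Q'" "1 \<notin> Q'" "\<forall>v. \<exists>\<beta>. Var v - Const \<beta> \<in> Q'" by auto
  obtain \<beta> where \<beta>: "\<And>v. Var v - Const (\<beta> v) \<in> Q'" using Q'(4) by metis
  show thesis
  proof (rule that)
    fix p assume "p \<in> Q"
    have "p - insertion Const (\<lambda>v. Const (\<beta> v)) p \<in> Q'" by (rule insertion_cong_mod_ideal[OF Q'(1) \<beta>])
    moreover have "insertion Const (\<lambda>v. Const (\<beta> v)) p = Const (poly_eval p (\<chi> v. \<beta> v))"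
    proof (induction p rule: mpoly_induct)
      case (monom a c)
      show ?case
        by (simp add: insertion_single[OF is_hom_Const] poly_eval_insertion insertion_single[OF is_hom_id] Const_mult Const_prod Const_power)
    qed (simp add: insertion_add[OF is_hom_Const] poly_eval_add Const_add)
    ultimately have "Const (poly_eval p (\<chi> v. \<beta> v)) \<in> Q'"
      using \<open>p \<in> Q\<close> Q'(2) ideal_cong[OF Q'(1)] by (metis subsetD)
    then have "Const (1 / poly_eval p (\<chi> v. \<beta> v)) * Const (poly_eval p (\<chi> v. \<beta> v)) \<in> Q'"
      by (rule ideal_mult[OF Q'(1)])
    then show "poly_eval p (\<chi> v. \<beta> v) = 0" using Q'(3)
      by (cases "poly_eval p (\<chi> v. \<beta> v) = 0") (simp_all add: Const_mult[symmetric])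
  qed
qed

text \<open>On \<open>x\<^sub>v = 1\<close> the ideal has no zeros, so
  \<open>1 = e * (x\<^sub>v - 1)\<close> modulo \<open>J\<close>. Comparing components of degree
  \<open>k\<close> gives \<open>e\<^sub>k = - x\<^sub>v\<^sup>k\<close> modulo \<open>J\<close>, and
  \<open>e\<^sub>k = 0\<close> for large \<open>k\<close>.\<close>

theorem projective_nullstellensatz:
  fixes J :: "('v::finite) mpoly set"
  assumes J: "homogeneous_ideal J" and Z: "\<And>x. x \<noteq> 0 \<Longrightarrow> \<exists>p\<in>J. poly_eval p x \<noteq> 0"
  shows "primary_mod J"
  unfolding primary_mod_def
proof
  fix v
  note Ji = homogeneous_idealD[OF J]
  have "1 \<in> adjoin (Var v - 1) J"
  proof (rule ccontr)
    assume "1 \<notin> adjoin (Var v - 1) J"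
    then obtain x where x: "\<And>p. p \<in> adjoin (Var v - 1) J \<Longrightarrow> poly_eval p x = 0"
      using weak_nullstellensatz[OF is_ideal_adjoin[OF Ji]] by blast
    have "poly_eval (Var v - 1) x = 0" by (rule x[OF adjoin_mem[OF Ji]])
    then have "x \<noteq> 0" by (auto simp: poly_eval_diff poly_eval_Var poly_eval_1)
    then show False using Z x adjoin_subset[OF Ji] by blast
  qed
  then obtain e where e: "1 - e * (Var v - 1) \<in> J" by (auto simp: adjoin_def)
  have hc: "homogeneous_component k (1 - e * (Var v - 1)) \<in> J" for k
    using J e unfolding homogeneous_ideal_def by blast
  have eq: "1 - e * (Var v - 1) = 1 - e * Var v + e" by (simp add: algebra_simps)
  have "homogeneous_component k e + Var v ^ k \<in> J" for k
  proof (induction k)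
    case 0
    show ?case using hc[of 0] unfolding eq
      by (simp add: homogeneous_component_add homogeneous_component_diff homogeneous_component_mult[OF Var_hom]
          homogeneous_component_homogeneous[OF homogeneous_part_1] add.commute)
  next
    case (Suc k)
    have "homogeneous_component (Suc k) e - homogeneous_component k e * Var v \<in> J"
      using hc[of "Suc k"] unfolding eq
      by (simp add: homogeneous_component_add homogeneous_component_diff homogeneous_component_mult[OF Var_hom]
          homogeneous_component_homogeneous[OF homogeneous_part_1])
    from ideal_add[OF Ji this ideal_mult[OF Ji Suc, of "Var v"]] show ?case by (simp add: algebra_simps)
  qed
  moreover obtain D where D: "\<And>E. D \<le> E \<Longrightarrow> e = (\<Sum>k\<le>E. homogeneous_component k e)"
    using homogeneous_decomposition[of e] by blast
  have "e + homogeneous_component (Suc D) e = e"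
    using D[of D] D[of "Suc D"] by simp
  then have "homogeneous_component (Suc D) e = 0" by simp
  ultimately have "Var v ^ Suc D \<in> J" by (metis add_0)
  then show "\<exists>k. Var v ^ k \<in> J" by blast
qed

section \<open>Taylor approximation of holomorphic germs\<close>

text \<open>The parametrization of \<open>circlepath\<close> without its center. Contour integrals
  become integrals over \<open>{0..1}\<close>, to which the theorems on parameters apply.\<close>

definition circle :: "real \<Rightarrow> real \<Rightarrow> complex" where
  "circle \<rho> \<theta> = of_real \<rho> * exp (2 * of_real pi * \<i> * of_real \<theta>)"

lemma circlepath_eq_circle: "circlepath w \<rho> \<theta> = w + circle \<rho> \<theta>"
  by (simp add: circlepath circle_def)

lemma norm_circle: "0 \<le> \<rho> \<Longrightarrow> norm (circle \<rho> \<theta>) = \<rho>"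
  by (simp add: circle_def norm_mult)

lemma vector_derivative_circle:
  "vector_derivative (circlepath w \<rho>) (at \<theta>) = 2 * of_real pi * \<i> * circle \<rho> \<theta>"
  by (simp add: vector_derivative_circlepath circle_def)

lemma continuous_on_circle [continuous_intros]:
  "continuous_on S g \<Longrightarrow> continuous_on S (\<lambda>x. circle \<rho> (g x))"
  unfolding circle_def by (intro continuous_intros)

lemma cauchy_mean:
  assumes "continuous_on (cball 0 \<rho>) f" "f holomorphic_on ball 0 \<rho>" "norm w < \<rho>"
  shows "f w = integral {0..1} (\<lambda>\<theta>. f (circle \<rho> \<theta>) * circle \<rho> \<theta> / (circle \<rho> \<theta> - w))"
proof -
  have "((\<lambda>u. f u / (u - w)) has_contour_integral (2 * of_real pi * \<i> * f w)) (circlepath 0 \<rho>)"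
    using assms by (intro Cauchy_integral_circlepath) auto
  then have "2 * of_real pi * \<i> * f w = contour_integral (circlepath 0 \<rho>) (\<lambda>u. f u / (u - w))"
    by (simp add: contour_integral_unique)
  also have "\<dots> = integral {0..1} (\<lambda>\<theta>. (2 * of_real pi * \<i>) * (f (circle \<rho> \<theta>) * circle \<rho> \<theta> / (circle \<rho> \<theta> - w)))"
    unfolding contour_integral_integral vector_derivative_circle circlepath_eq_circle
    by (intro integral_cong) simp
  also have "\<dots> = (2 * of_real pi * \<i>) * integral {0..1} (\<lambda>\<theta>. f (circle \<rho> \<theta>) * circle \<rho> \<theta> / (circle \<rho> \<theta> - w))"
    by (rule integral_mult_right)
  finally show ?thesis by simp
qed

text \<open>The Leibniz rule asks for a jointly continuous derivative in \<open>t\<close>. Cauchy's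
  formula on a small circle expresses this derivative as an integral of \<open>\<phi>\<close>
  itself, so it inherits joint continuity from \<open>\<phi>\<close>.\<close>

lemma parametric_integral_holomorphic:
  fixes \<phi> :: "complex \<Rightarrow> real \<Rightarrow> complex"
  assumes cont: "continuous_on (ball 0 r \<times> {0..1}) (\<lambda>(t, \<theta>). \<phi> t \<theta>)"
    and hol: "\<And>\<theta>. \<theta> \<in> {0..1} \<Longrightarrow> (\<lambda>t. \<phi> t \<theta>) holomorphic_on ball 0 r"
  shows "(\<lambda>t. integral {0..1} (\<phi> t)) holomorphic_on ball 0 r"
  unfolding holomorphic_on_open[OF open_ball]
proof
  fix w assume w: "w \<in> ball (0::complex) r"
  then obtain s where s: "s > 0" "cball w s \<subseteq> ball 0 r" by (meson open_ball open_contains_cball)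
  have cs: "w + circle s \<eta> \<in> ball 0 r" for \<eta>
  proof -
    have "w + circle s \<eta> \<in> cball w s" using s(1) norm_circle[of s \<eta>] by (simp add: dist_norm)
    then show ?thesis using s(2) by blast
  qed
  define fx where "fx t \<theta> = 1 / (2 * of_real pi * \<i>) *
      integral {0..1} (\<lambda>\<eta>. \<phi> (w + circle s \<eta>) \<theta> / (w + circle s \<eta> - t)\<^sup>2 * (2 * of_real pi * \<i> * circle s \<eta>))" for t \<theta>
  have "(\<lambda>t. integral (cbox 0 1) (\<phi> t)) holomorphic_on ball w s"
  proof (rule leibniz_rule_holomorphic[where fx = fx])
    fix t and \<theta> :: real assume t: "t \<in> ball w s" and \<theta>: "\<theta> \<in> cbox 0 1"
    have h: "(\<lambda>t. \<phi> t \<theta>) holomorphic_on cball w s"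
      using holomorphic_on_subset[OF hol[of \<theta>] s(2)] \<theta> by simp
    have "((\<lambda>t. \<phi> t \<theta>) has_field_derivative (1 / (2 * of_real pi * \<i>) *
        contour_integral (circlepath w s) (\<lambda>u. \<phi> u \<theta> / (u - t)\<^sup>2))) (at t)"
      by (rule Cauchy_derivative_integral_circlepath(2)[OF holomorphic_on_imp_continuous_on[OF h] holomorphic_on_subset[OF h ball_subset_cball] t])
    then have "((\<lambda>t. \<phi> t \<theta>) has_field_derivative fx t \<theta>) (at t)"
      unfolding contour_integral_integral vector_derivative_circle circlepath_eq_circle fx_def .
    then show "((\<lambda>t. \<phi> t \<theta>) has_field_derivative fx t \<theta>) (at t within ball w s)"
      by (rule has_field_derivative_at_within)
  next
    fix t assume "t \<in> ball w s"
    then have "t \<in> ball 0 r" using s(2) ball_subset_cball by blast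
    then show "\<phi> t integrable_on cbox 0 1"
      by (intro integrable_continuous) (auto intro!: continuous_on_compose2[OF cont, of _ "\<lambda>\<theta>. (t, \<theta>)", simplified] continuous_intros)
  next
    have c1: "continuous_on ((ball w s \<times> {0..1}) \<times> {0..1}) (\<lambda>x. \<phi> (w + circle s (snd x)) (snd (fst x)))"
      by (rule continuous_on_compose2[OF cont, of _ "\<lambda>x. (w + circle s (snd x), snd (fst x))", simplified])
         (use cs in \<open>auto intro!: continuous_intros\<close>)
    have nz: "w + circle s \<eta> - t \<noteq> 0" if "t \<in> ball w s" for t \<eta>
    proof
      assume "w + circle s \<eta> - t = 0"
      then have "t = w + circle s \<eta>" by (simp add: algebra_simps)
      then show False using that norm_circle[of s \<eta>] s(1) by (simp add: dist_norm)
    qed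
    have "continuous_on (ball w s \<times> {0..1}) (\<lambda>x. integral (cbox 0 1) (\<lambda>\<eta>.
        \<phi> (w + circle s \<eta>) (snd x) / (w + circle s \<eta> - fst x)\<^sup>2 * (2 * of_real pi * \<i> * circle s \<eta>)))"
      by (rule integral_continuous_on_param)
         (use c1 nz in \<open>auto intro!: continuous_intros simp: split_def\<close>)
    then show "continuous_on (ball w s \<times> cbox 0 1) (\<lambda>(t, \<theta>). fx t \<theta>)"
      unfolding fx_def split_def by (intro continuous_intros) simp_all
  qed simp
  then show "\<exists>f'. ((\<lambda>t. integral {0..1} (\<phi> t)) has_field_derivative f') (at w)"
    using s(1) by (auto simp: holomorphic_on_open)
qed

section \<open>Division by coordinates on polydiscs\<close>

definition polydisc :: "real \<Rightarrow> (complex ^ 'n) set" where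
  "polydisc r = {z. \<forall>i. norm (z $ i) < r}"

definition upd :: "complex ^ 'n \<Rightarrow> 'n \<Rightarrow> complex \<Rightarrow> complex ^ 'n" where
  "upd z i t = (\<chi> k. if k = i then t else z $ k)"

text \<open>By Osgood's lemma this is equivalent to holomorphy, but unlike Frechet differentiability
  it is visibly preserved by Cauchy integrals.\<close>

definition separately_holomorphic :: "real \<Rightarrow> (complex ^ ('n::finite) \<Rightarrow> complex) \<Rightarrow> bool" where
  "separately_holomorphic r F \<longleftrightarrow> continuous_on (polydisc r) F \<and>
     (\<forall>z\<in>polydisc r. \<forall>i. (\<lambda>t. F (upd z i t)) holomorphic_on ball 0 r)"

lemma polydisc_mono: "r \<le> s \<Longrightarrow> polydisc r \<subseteq> polydisc s"
  unfolding polydisc_def by (auto intro: less_le_trans)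

lemma upd_in_polydisc: "z \<in> polydisc r \<Longrightarrow> norm t < r \<Longrightarrow> upd z i t \<in> polydisc r"
  by (auto simp: polydisc_def upd_def)

lemma continuous_on_upd [continuous_intros]:
  fixes g :: "_ \<Rightarrow> complex ^ ('n::finite)"
  assumes "continuous_on S g" "continuous_on S t"
  shows "continuous_on S (\<lambda>x. upd (g x) i (t x))"
  unfolding upd_def
proof (rule continuous_on_vec_lambda)
  fix k show "continuous_on S (\<lambda>x. if k = i then t x else g x $ k)"
    using assms by (cases "k = i") (auto intro!: continuous_intros)
qed

text \<open>The quotient is a Cauchy integral: subtracting the formulas for \<open>z $ i\<close> and
  for 0 leaves the kernel \<open>1 / (c - z $ i)\<close> with a factor \<open>z $ i\<close> in
  front. Nothing is divided by \<open>z $ i\<close>, so nothing has to be extended across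
  \<open>z $ i = 0\<close>.\<close>

lemma separately_holomorphic_divide:
  assumes F: "separately_holomorphic r F" and r: "0 < r'" "r' < r"
  obtains H where "separately_holomorphic r' H"
    "\<And>z. z \<in> polydisc r' \<Longrightarrow> F z = F (upd z i 0) + z $ i * H z"
proof -
  define \<rho> where "\<rho> = (r' + r) / 2"
  have \<rho>: "r' < \<rho>" "\<rho> < r" "0 < \<rho>" using r by (auto simp: \<rho>_def)
  note Fc = F[unfolded separately_holomorphic_def, THEN conjunct1]
  note Fh = F[unfolded separately_holomorphic_def, THEN conjunct2, rule_format]
  let ?c = "circle \<rho>"
  have c: "norm (?c \<theta>) = \<rho>" for \<theta> using norm_circle \<rho> by simp
  have nz: "?c \<theta> - t \<noteq> 0" if "norm t < \<rho>" for t \<theta> using c[of \<theta>] that by auto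
  have c0: "?c \<theta> \<noteq> 0" for \<theta> using nz[of 0 \<theta>] \<rho> by simp
  have pd: "polydisc r' \<subseteq> polydisc r" using r by (intro polydisc_mono) simp
  have zi: "norm (z $ i) < \<rho>" if "z \<in> polydisc r'" for z :: "complex ^ 'a" and i
    using that \<rho>(1) by (auto simp: polydisc_def intro: less_trans)
  have uc: "upd z i (?c \<theta>) \<in> polydisc r" if "z \<in> polydisc r'" for z i \<theta>
    using that pd c \<rho> by (intro upd_in_polydisc) auto
  define G where "G z \<theta> = F (upd z i (?c \<theta>)) / (?c \<theta> - z $ i)" for z \<theta>
  define H where "H z = integral {0..1} (G z)" for z
  have Gc: "continuous_on (polydisc r' \<times> {0..1}) (\<lambda>(z, \<theta>). G z \<theta>)"
  proof -
    have "continuous_on (polydisc r' \<times> {0..1}) (\<lambda>x. F (upd (fst x) i (?c (snd x))))"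
      by (rule continuous_on_compose2[OF Fc]) (use uc in \<open>auto intro!: continuous_intros\<close>)
    then show ?thesis unfolding G_def split_def
      using nz zi by (intro continuous_intros) auto
  qed
  have "separately_holomorphic r' H"
    unfolding separately_holomorphic_def
  proof (intro conjI ballI allI)
    show "continuous_on (polydisc r') H"
      unfolding H_def using integral_continuous_on_param[of "polydisc r'" 0 1 G] Gc by simp
  next
    fix z :: "complex ^ 'a" and k assume z: "z \<in> polydisc r'"
    have zr: "z \<in> polydisc r" using z pd by auto
    have "(\<lambda>t. integral {0..1} (\<lambda>\<theta>. G (upd z k t) \<theta>)) holomorphic_on ball 0 r'"
    proof (rule parametric_integral_holomorphic)
      show "continuous_on (ball 0 r' \<times> {0..1}) (\<lambda>(t, \<theta>). G (upd z k t) \<theta>)"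
      proof -
        have "continuous_on (ball 0 r' \<times> {0..1}) (\<lambda>x. case (upd z k (fst x), snd x) of (z, \<theta>) \<Rightarrow> G z \<theta>)"
          by (rule continuous_on_compose2[OF Gc]) (auto intro!: continuous_intros upd_in_polydisc z)
        then show ?thesis by (simp add: split_def)
      qed
    next
      fix \<theta> :: real
      show "(\<lambda>t. G (upd z k t) \<theta>) holomorphic_on ball 0 r'"
      proof (cases "k = i")
        case True
        have "upd (upd z i t) i s = upd z i s" "upd z i t $ i = t" for t s
          by (auto simp: upd_def vec_eq_iff)
        then have "(\<lambda>t. G (upd z k t) \<theta>) = (\<lambda>t. F (upd z i (?c \<theta>)) / (?c \<theta> - t))"
          using True by (simp add: G_def)
        moreover have "?c \<theta> - t \<noteq> 0" if "t \<in> ball 0 r'" for t using that \<rho> by (intro nz) auto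
        ultimately show ?thesis by (auto intro!: holomorphic_intros)
      next
        case False
        then have "upd (upd z k t) i s = upd (upd z i s) k t" "upd z k t $ i = z $ i" for t s
          by (auto simp: upd_def vec_eq_iff)
        then have "(\<lambda>t. G (upd z k t) \<theta>) = (\<lambda>t. F (upd (upd z i (?c \<theta>)) k t) / (?c \<theta> - z $ i))"
          by (simp add: G_def)
        moreover have "(\<lambda>t. F (upd (upd z i (?c \<theta>)) k t)) holomorphic_on ball 0 r'"
          using holomorphic_on_subset[OF Fh[OF uc[OF z]]] r by (simp add: subset_ball)
        ultimately show ?thesis using nz[OF zi[OF z]] by (auto intro!: holomorphic_intros)
      qed
    qed
    then show "(\<lambda>t. H (upd z k t)) holomorphic_on ball 0 r'" by (simp add: H_def)
  qed
  moreover have "F z = F (upd z i 0) + z $ i * H z" if z: "z \<in> polydisc r'" for z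
  proof -
    define f where "f t = F (upd z i t)" for t
    have h: "f holomorphic_on ball 0 r" unfolding f_def using Fh z pd by blast
    have sub: "cball 0 \<rho> \<subseteq> ball (0::complex) r" "ball 0 \<rho> \<subseteq> ball (0::complex) r" using \<rho> by auto
    have fc: "continuous_on (cball 0 \<rho>) f"
      by (rule holomorphic_on_imp_continuous_on[OF holomorphic_on_subset[OF h sub(1)]])
    have fh: "f holomorphic_on ball 0 \<rho>" by (rule holomorphic_on_subset[OF h sub(2)])
    have fcc: "continuous_on {0..1} (\<lambda>\<theta>. f (?c \<theta>))"
      by (rule continuous_on_compose2[OF fc]) (auto intro!: continuous_intros simp: c)
    have int: "(\<lambda>\<theta>. f (?c \<theta>) * ?c \<theta> / (?c \<theta> - w)) integrable_on {0..1}" if "norm w < \<rho>" for w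
      using nz[OF that] fcc by (intro integrable_continuous_interval continuous_intros) auto
    have "f (z $ i) - f 0 = integral {0..1} (\<lambda>\<theta>. f (?c \<theta>) * ?c \<theta> / (?c \<theta> - z $ i) - f (?c \<theta>) * ?c \<theta> / (?c \<theta> - 0))"
      using cauchy_mean[OF fc fh zi[OF z, of i]] cauchy_mean[OF fc fh, of 0] int[OF zi[OF z, of i]] int[of 0] \<rho>
      by (simp add: integral_diff)
    also have "\<dots> = integral {0..1} (\<lambda>\<theta>. z $ i * G z \<theta>)"
    proof (rule integral_cong)
      fix \<theta> :: real
      show "f (?c \<theta>) * ?c \<theta> / (?c \<theta> - z $ i) - f (?c \<theta>) * ?c \<theta> / (?c \<theta> - 0) = z $ i * G z \<theta>"
        using nz[OF zi[OF z, of i], of \<theta>] c0[of \<theta>] by (simp add: G_def f_def field_simps)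
    qed
    also have "\<dots> = z $ i * H z" unfolding H_def by (rule integral_mult_right)
    finally have "f (z $ i) = f 0 + z $ i * H z" by (simp add: algebra_simps)
    moreover have "upd z i (z $ i) = z" by (auto simp: upd_def vec_eq_iff)
    ultimately show ?thesis by (simp add: f_def)
  qed
  ultimately show thesis by (rule that)
qed

text \<open>Coordinates are set to 0 one at a time. Each division starts from \<open>F\<close>
  composed with a zeroing map, which is still separately holomorphic on the radius \<open>r\<close>,
  so that the radius shrinks only once.\<close>

lemma hadamard:
  fixes F :: "complex ^ ('n::finite) \<Rightarrow> complex"
  assumes F: "separately_holomorphic r F" and r: "0 < r'" "r' < r"
  obtains H where "\<And>i. separately_holomorphic r' (H i)"
    "\<And>z. z \<in> polydisc r' \<Longrightarrow> F z = F 0 + (\<Sum>i\<in>UNIV. z $ i * H i z)"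
proof -
  define zeroed where "zeroed A z = (\<chi> k. if k \<in> A then 0 else z $ k)" for A :: "'n set" and z :: "complex ^ 'n"
  have "\<exists>H. (\<forall>i\<in>A. separately_holomorphic r' (H i)) \<and>
      (\<forall>z\<in>polydisc r'. F z = F (zeroed A z) + (\<Sum>i\<in>A. z $ i * H i z))" if "finite A" for A
    using that
  proof (induction A rule: finite_induct)
    case empty
    have "zeroed {} z = z" for z by (simp add: zeroed_def)
    then show ?case by simp
  next
    case (insert i A)
    then obtain H where H: "\<forall>i\<in>A. separately_holomorphic r' (H i)"
      "\<forall>z\<in>polydisc r'. F z = F (zeroed A z) + (\<Sum>i\<in>A. z $ i * H i z)" by blast
    have zr: "zeroed A z \<in> polydisc r" if "z \<in> polydisc r" for z
      using that r by (auto simp: polydisc_def zeroed_def)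
    have zc: "continuous_on S (zeroed A)" for S
      unfolding zeroed_def
    proof (rule continuous_on_vec_lambda)
      fix k show "continuous_on S (\<lambda>x. if k \<in> A then 0 else x $ k)"
        by (cases "k \<in> A") (auto intro!: continuous_intros)
    qed
    have "separately_holomorphic r (\<lambda>z. F (zeroed A z))"
      unfolding separately_holomorphic_def
    proof (intro conjI ballI allI)
      show "continuous_on (polydisc r) (\<lambda>z. F (zeroed A z))"
        by (rule continuous_on_compose2[of "polydisc r" F]) (use F zr zc in \<open>auto simp: separately_holomorphic_def\<close>)
    next
      fix z :: "complex ^ 'n" and k assume z: "z \<in> polydisc r"
      show "(\<lambda>t. F (zeroed A (upd z k t))) holomorphic_on ball 0 r"
      proof (cases "k \<in> A")
        case True
        then have "zeroed A (upd z k t) = zeroed A z" for t by (auto simp: zeroed_def upd_def vec_eq_iff)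
        then show ?thesis by simp
      next
        case False
        then have "zeroed A (upd z k t) = upd (zeroed A z) k t" for t by (auto simp: zeroed_def upd_def vec_eq_iff)
        then show ?thesis using F zr[OF z] by (simp add: separately_holomorphic_def)
      qed
    qed
    then obtain H' where H': "separately_holomorphic r' H'"
      "\<And>z. z \<in> polydisc r' \<Longrightarrow> F (zeroed A z) = F (zeroed A (upd z i 0)) + z $ i * H' z"
      using separately_holomorphic_divide[OF _ r] by blast
    have "zeroed A (upd z i 0) = zeroed (insert i A) z" for z by (auto simp: zeroed_def upd_def vec_eq_iff)
    moreover have "(\<Sum>j\<in>A. z $ j * (H(i := H')) j z) = (\<Sum>j\<in>A. z $ j * H j z)" for z
      using insert by (intro sum.cong) auto
    ultimately have "F z = F (zeroed (insert i A) z) + (\<Sum>j\<in>insert i A. z $ j * (H(i := H')) j z)"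
      if "z \<in> polydisc r'" for z
      using H(2)[rule_format, OF that] H'(2)[OF that] insert.hyps by simp
    moreover have "separately_holomorphic r' ((H(i := H')) j)" if "j \<in> insert i A" for j
      using H(1) H'(1) that by (cases "j = i") auto
    ultimately show ?case by blast
  qed
  from this[of UNIV] obtain H where H: "\<And>i. separately_holomorphic r' (H i)"
    "\<And>z. z\<in>polydisc r' \<Longrightarrow> F z = F (zeroed UNIV z) + (\<Sum>i\<in>UNIV. z $ i * H i z)" by auto
  have z0: "zeroed UNIV z = 0" for z by (simp add: zeroed_def vec_eq_iff)
  show thesis by (rule that[OF H(1)]) (rule H(2)[unfolded z0])
qed

lemma open_polydisc: "open (polydisc r :: (complex ^ ('n::finite)) set)"
proof -
  have "polydisc r = (\<Inter>i. {z :: complex ^ 'n. norm (z $ i) < r})" by (auto simp: polydisc_def)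
  also have "open \<dots>" by (intro open_INT ballI open_Collect_less continuous_intros) auto
  finally show ?thesis .
qed

lemma eventually_polydisc: "0 < r \<Longrightarrow> \<forall>\<^sub>F z in nhds 0. z \<in> (polydisc r :: (complex ^ ('n::finite)) set)"
  using open_polydisc by (rule eventually_nhds_in_open) (simp add: polydisc_def)

text \<open>The approximation of order \<open>N + 1\<close> is assembled from those of order
  \<open>N\<close> for the Hadamard quotients, at the price of halving the radius.\<close>

lemma separately_holomorphic_taylor:
  fixes F :: "complex ^ ('n::finite) \<Rightarrow> complex"
  assumes "0 < r" "separately_holomorphic r F"
  shows "\<exists>P C. \<forall>\<^sub>F z in nhds 0. norm (F z - poly_eval P z) \<le> C * norm z ^ N"
  using assms
proof (induction N arbitrary: r F)
  case 0
  have z: "(0 :: complex ^ 'n) \<in> polydisc r" using 0 by (simp add: polydisc_def)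
  have "isCont F 0"
    using 0 z open_polydisc continuous_on_eq_continuous_at by (auto simp: separately_holomorphic_def)
  then have "(F \<longlongrightarrow> F 0) (nhds 0)" by (simp add: isCont_def tendsto_nhds_iff)
  then have "\<forall>\<^sub>F z in nhds 0. dist (F z) (F 0) < 1" by (rule tendstoD) simp
  then have "\<forall>\<^sub>F z in nhds 0. norm (F z - poly_eval 0 z) \<le> (norm (F 0) + 1) * norm z ^ 0"
  proof eventually_elim
    case (elim z)
    then show ?case using norm_triangle_ineq2[of "F z" "F 0"] by (simp add: dist_norm poly_eval_0)
  qed
  then show ?case by blast
next
  case (Suc N)
  obtain H where H: "\<And>i. separately_holomorphic (r / 2) (H i)"
    "\<And>z. z \<in> polydisc (r / 2) \<Longrightarrow> F z = F 0 + (\<Sum>i\<in>UNIV. z $ i * H i z)"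
    using hadamard[OF Suc.prems(2), of "r / 2"] Suc.prems(1) by auto
  have "\<forall>i. \<exists>P C. \<forall>\<^sub>F z in nhds 0. norm (H i z - poly_eval P z) \<le> C * norm z ^ N"
    using Suc.IH[OF _ H(1)] Suc.prems(1) by simp
  then obtain P C where PC: "\<And>i. \<forall>\<^sub>F z in nhds 0. norm (H i z - poly_eval (P i) z) \<le> C i * norm z ^ N" by metis
  then have "\<forall>\<^sub>F z in nhds 0. \<forall>i. norm (H i z - poly_eval (P i) z) \<le> C i * norm z ^ N"
    by (rule eventually_all_finite)
  moreover have "\<forall>\<^sub>F z in nhds 0. z \<in> (polydisc (r / 2) :: (complex ^ 'n) set)"
    using Suc.prems by (intro eventually_polydisc) simp
  ultimately have "\<forall>\<^sub>F z in nhds 0. norm (F z - poly_eval (Const (F 0) + (\<Sum>i\<in>UNIV. Var i * P i)) z)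
      \<le> (\<Sum>i\<in>UNIV. C i) * norm z ^ Suc N"
  proof eventually_elim
    case (elim z)
    have "F z - poly_eval (Const (F 0) + (\<Sum>i\<in>UNIV. Var i * P i)) z = (\<Sum>i\<in>UNIV. z $ i * (H i z - poly_eval (P i) z))"
      using H(2)[OF elim(2)]
      by (simp add: poly_eval_add poly_eval_Const poly_eval_sum poly_eval_mult poly_eval_Var right_diff_distrib sum_subtractf)
    also have "norm \<dots> \<le> (\<Sum>i\<in>UNIV. norm z * (C i * norm z ^ N))"
      using elim(1) by (intro sum_norm_le) (auto simp: norm_mult intro!: mult_mono Finite_Cartesian_Product.norm_nth_le)
    also have "\<dots> = (\<Sum>i\<in>UNIV. C i) * norm z ^ Suc N" by (simp add: sum_distrib_right sum_distrib_left ac_simps)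
    finally show ?case .
  qed
  then show ?case by blast
qed

lemma norm_polydisc_le: fixes r :: real shows "z \<in> polydisc r \<Longrightarrow> norm (z :: complex ^ ('n::finite)) \<le> CARD('n) * r"
proof -
  assume z: "z \<in> polydisc r"
  have "norm z \<le> (\<Sum>i\<in>UNIV. norm (z $ i))" unfolding norm_vec_def by (rule L2_set_le_sum) simp
  also have "\<dots> \<le> (\<Sum>i\<in>(UNIV::'n set). r)" using z by (intro sum_mono) (auto simp: polydisc_def less_imp_le)
  finally show ?thesis by simp
qed

lemma holomorphic_at_origin_separately:
  fixes F :: "complex ^ ('n::finite) \<Rightarrow> complex"
  assumes "holomorphic_at_origin F"
  obtains r where "0 < r" "separately_holomorphic r F"
proof -
  obtain S where S: "open S" "0 \<in> S" and D: "\<And>z. z \<in> S \<Longrightarrow> \<exists>D. (F has_derivative D) (at z) \<and> (\<forall>c v. D (c *s v) = c * D v)"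
    using assms unfolding holomorphic_at_origin_def eventually_nhds by blast
  obtain e where e: "0 < e" "ball 0 e \<subseteq> S" using S open_contains_ball by blast
  \<comment> \<open>The Euclidean norm is at most \<open>CARD('n)\<close> times the radius of the
    polydisc, so this polydisc lies in the ball of radius \<open>e\<close>.\<close>
  define r where "r = e / (2 * CARD('n))"
  have r: "0 < r" using e by (simp add: r_def)
  have "norm z < e" if "z \<in> polydisc r" for z :: "complex ^ 'n"
  proof -
    have "norm z \<le> e / 2" using norm_polydisc_le[OF that] by (simp add: r_def)
    then show ?thesis using e by simp
  qed
  then have sub: "polydisc r \<subseteq> S" using e by auto
  have "separately_holomorphic r F"
    unfolding separately_holomorphic_def
  proof (intro conjI ballI allI)
    show "continuous_on (polydisc r) F"
      using D sub by (meson continuous_at_imp_continuous_on has_derivative_continuous subsetD)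
  next
    fix z :: "complex ^ 'n" and i assume z: "z \<in> polydisc r"
    show "(\<lambda>t. F (upd z i t)) holomorphic_on ball 0 r"
      unfolding holomorphic_on_open[OF open_ball]
    proof
      fix t assume "t \<in> ball (0::complex) r"
      then have "upd z i t \<in> S" using upd_in_polydisc[OF z] sub by auto
      then obtain D where D: "(F has_derivative D) (at (upd z i t))" "\<And>c v. D (c *s v) = c * D v" using D by blast
      have u: "upd z i s = upd z i 0 + s *s axis i 1" for s
        by (auto simp: upd_def vec_eq_iff axis_def)
      have "bounded_linear (\<lambda>s. s *s (axis i 1 :: complex ^ 'n))"
        by (rule bounded_linear_intros linear_conv_bounded_linear[THEN iffD1])
           (auto intro!: linearI simp: vec_eq_iff algebra_simps)
      then have "((\<lambda>s. upd z i 0 + s *s axis i 1) has_derivative (\<lambda>s. 0 + s *s axis i 1)) (at t)"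
        by (intro has_derivative_add has_derivative_const bounded_linear_imp_has_derivative)
      then have "((\<lambda>s. upd z i s) has_derivative (\<lambda>s. s *s axis i 1)) (at t)" by (simp flip: u)
      from diff_chain_at[OF this D(1)] have "((\<lambda>s. F (upd z i s)) has_derivative (\<lambda>s. D (axis i 1) * s)) (at t)"
        by (simp add: o_def D(2) mult.commute)
      then show "\<exists>f'. ((\<lambda>t. F (upd z i t)) has_field_derivative f') (at t)"
        unfolding has_field_derivative_def by blast
    qed
  qed
  then show thesis using that r by blast
qed

theorem holomorphic_at_origin_taylor:
  fixes F :: "complex ^ ('n::finite) \<Rightarrow> complex"
  assumes "holomorphic_at_origin F"
  obtains P C where "\<forall>\<^sub>F z in nhds 0. norm (F z - poly_eval P z) \<le> C * norm z ^ N"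
proof -
  obtain r where "0 < r" "separately_holomorphic r F" using holomorphic_at_origin_separately[OF assms] .
  from separately_holomorphic_taylor[OF this, of N] show thesis using that by blast
qed

section \<open>Partial derivatives\<close>

lemma euler_formula:
  assumes "f \<in> homogeneous_part N"
  shows "(\<Sum>v\<in>UNIV. Var v * poly_partial v f) = of_nat N * f"
proof -
  have "Var v * Poly_Mapping.single (a - Poly_Mapping.single v 1) (of_nat (Poly_Mapping.lookup a v) * c) =
      of_nat (Poly_Mapping.lookup a v) * Poly_Mapping.single a c" for v :: 'a and a c
  proof (cases "Poly_Mapping.lookup a v = 0")
    case False
    then have "Poly_Mapping.single v 1 + (a - Poly_Mapping.single v 1) = a"
      by (intro poly_mapping_eqI) (auto simp: lookup_add lookup_minus lookup_single when_def)
    then show ?thesis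
      by (simp add: Var_def mult_single of_nat_single[symmetric] single_of_nat[symmetric] del: single_of_nat)
  qed simp
  then have "(\<Sum>v\<in>UNIV. Var v * poly_partial v f) =
      (\<Sum>v\<in>UNIV. \<Sum>a\<in>Poly_Mapping.keys f. of_nat (Poly_Mapping.lookup a v) * Poly_Mapping.single a (Poly_Mapping.lookup f a))"
    by (simp add: poly_partial_def sum_distrib_left)
  also have "\<dots> = (\<Sum>a\<in>Poly_Mapping.keys f. (\<Sum>v\<in>UNIV. of_nat (Poly_Mapping.lookup a v)) * Poly_Mapping.single a (Poly_Mapping.lookup f a))"
    by (subst sum.swap) (simp add: sum_distrib_right)
  also have "\<dots> = (\<Sum>a\<in>Poly_Mapping.keys f. of_nat N * Poly_Mapping.single a (Poly_Mapping.lookup f a))"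
    using assms by (intro sum.cong refl) (simp add: homogeneous_part_def monom_degree_def flip: of_nat_sum)
  also have "\<dots> = of_nat N * f"
    unfolding sum_distrib_left[symmetric] mpoly_eq_sum_single[symmetric] ..
  finally show ?thesis .
qed

lemma poly_partial_hom:
  assumes "f \<in> homogeneous_part N"
  shows "poly_partial v f \<in> homogeneous_part (N - 1)"
  unfolding poly_partial_def
proof (rule homogeneous_part_sum)
  fix a assume a: "a \<in> Poly_Mapping.keys f"
  show "Poly_Mapping.single (a - Poly_Mapping.single v 1) (of_nat (Poly_Mapping.lookup a v) * Poly_Mapping.lookup f a)
      \<in> homogeneous_part (N - 1)"
  proof (cases "Poly_Mapping.lookup a v = 0")
    case False
    then have "Poly_Mapping.single v 1 + (a - Poly_Mapping.single v 1) = a"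
      by (intro poly_mapping_eqI) (auto simp: lookup_add lookup_minus lookup_single when_def)
    then have "1 + monom_degree (a - Poly_Mapping.single v 1) = monom_degree a"
      by (metis monom_degree_add monom_degree_single)
    then have "monom_degree (a - Poly_Mapping.single v 1) = N - 1"
      using assms a by (simp add: homogeneous_part_def)
    then show ?thesis by (metis homogeneous_part_single)
  qed simp
qed

text \<open>The link between formal partial derivatives and the complex derivatives in
  \<open>fun_partial\<close>.\<close>

lemma poly_eval_partial:
  "((\<lambda>t. poly_eval f (z + t *s axis v 1)) has_field_derivative poly_eval (poly_partial v f) z) (at 0)"
proof -
  have *: "((\<lambda>t. \<Prod>u\<in>UNIV. ((z + t *s axis v 1) $ u) ^ Poly_Mapping.lookup a u) has_field_derivative
      of_nat (Poly_Mapping.lookup a v) * (\<Prod>u\<in>UNIV. (z $ u) ^ Poly_Mapping.lookup (a - Poly_Mapping.single v 1) u)) (at 0)" for a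
  proof -
    let ?c = "\<Prod>u\<in>UNIV - {v}. (z $ u) ^ Poly_Mapping.lookup a u"
    let ?k = "Poly_Mapping.lookup a v"
    have "(\<Prod>u\<in>UNIV. ((z + t *s axis v 1) $ u) ^ Poly_Mapping.lookup a u) = (z $ v + t) ^ ?k * ?c" for t
    proof -
      have "(\<Prod>u\<in>UNIV - {v}. ((z + t *s axis v 1) $ u) ^ Poly_Mapping.lookup a u) = ?c"
        by (intro prod.cong) (auto simp: axis_def)
      then show ?thesis by (simp add: prod.remove[of UNIV v] axis_def)
    qed
    moreover have "(\<Prod>u\<in>UNIV. (z $ u) ^ Poly_Mapping.lookup (a - Poly_Mapping.single v 1) u) = (z $ v) ^ (?k - 1) * ?c"
    proof -
      have "(\<Prod>u\<in>UNIV - {v}. (z $ u) ^ Poly_Mapping.lookup (a - Poly_Mapping.single v 1) u) = ?c"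
        by (intro prod.cong) (auto simp: lookup_minus lookup_single when_def)
      then show ?thesis by (simp add: prod.remove[of UNIV v] lookup_minus)
    qed
    moreover have "((\<lambda>t. (z $ v + t) ^ ?k * ?c) has_field_derivative of_nat ?k * ((z $ v) ^ (?k - 1) * ?c)) (at 0)"
      by (auto intro!: derivative_eq_intros simp: mult_ac)
    ultimately show ?thesis by simp
  qed
  have "poly_eval (poly_partial v f) z = (\<Sum>a\<in>Poly_Mapping.keys f. Poly_Mapping.lookup f a *
      (of_nat (Poly_Mapping.lookup a v) * (\<Prod>u\<in>UNIV. (z $ u) ^ Poly_Mapping.lookup (a - Poly_Mapping.single v 1) u)))"
    unfolding poly_partial_def poly_eval_sum
    by (simp add: poly_eval_insertion insertion_single[OF is_hom_id] mult_ac)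
  moreover have "((\<lambda>t. poly_eval f (z + t *s axis v 1)) has_field_derivative (\<Sum>a\<in>Poly_Mapping.keys f. Poly_Mapping.lookup f a *
      (of_nat (Poly_Mapping.lookup a v) * (\<Prod>u\<in>UNIV. (z $ u) ^ Poly_Mapping.lookup (a - Poly_Mapping.single v 1) u)))) (at 0)"
    unfolding poly_eval_def by (intro DERIV_sum DERIV_cmult *)
  ultimately show ?thesis by simp
qed

section \<open>Germs\<close>

lemma holomorphic_at_origin_component: "holomorphic_at_origin (\<lambda>y. y $ i)"
  unfolding holomorphic_at_origin_def
  by (intro always_eventually allI exI[of _ "\<lambda>h. h $ i"] conjI bounded_linear_imp_has_derivative bounded_linear_vec_nth) simp

lemma holomorphic_at_origin_sum:
  "(\<And>x. x \<in> A \<Longrightarrow> holomorphic_at_origin (F x)) \<Longrightarrow> holomorphic_at_origin (\<lambda>y. \<Sum>x\<in>A. F x y)"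
  by (induction A rule: infinite_finite_induct) (auto simp: holomorphic_at_origin_const holomorphic_at_origin_add)

lemma holomorphic_at_origin_prod:
  "(\<And>x. x \<in> A \<Longrightarrow> holomorphic_at_origin (F x)) \<Longrightarrow> holomorphic_at_origin (\<lambda>y. \<Prod>x\<in>A. F x y)"
  by (induction A rule: infinite_finite_induct) (auto simp: holomorphic_at_origin_const holomorphic_at_origin_mult)

lemma holomorphic_at_origin_power:
  "holomorphic_at_origin F \<Longrightarrow> holomorphic_at_origin (\<lambda>y. F y ^ k)"
  by (induction k) (auto simp: holomorphic_at_origin_const holomorphic_at_origin_mult)

lemma holomorphic_at_origin_poly_eval:
  fixes F :: "complex ^ 'n \<Rightarrow> complex ^ ('v::finite)"
  assumes "\<And>k. holomorphic_at_origin (\<lambda>y. F y $ k)"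
  shows "holomorphic_at_origin (\<lambda>y. poly_eval p (F y))"
  unfolding poly_eval_def
  by (intro holomorphic_at_origin_sum holomorphic_at_origin_mult holomorphic_at_origin_const
      holomorphic_at_origin_prod holomorphic_at_origin_power assms)

lemma germ_eq_iff:
  "holomorphic_at_origin F \<Longrightarrow> holomorphic_at_origin G \<Longrightarrow> germ F = germ G \<longleftrightarrow> (\<forall>\<^sub>F z in nhds 0. F z = G z)"
  using Quotient3_rel[OF Quotient3_holo_germ, of F G] by (auto simp: same_germ_def)

lemma germ_cases:
  obtains F where "holomorphic_at_origin F" "h = germ F"
proof
  show "holomorphic_at_origin (rep_holo_germ h)"
    using Quotient3_rep_reflp[OF Quotient3_holo_germ, of h] by (simp add: same_germ_def)
  show "h = germ (rep_holo_germ h)" by (rule Quotient3_abs_rep[OF Quotient3_holo_germ, symmetric])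
qed

lemma same_germ_refl: "holomorphic_at_origin F \<Longrightarrow> same_germ F F"
  by (simp add: same_germ_def)

lemma germ_add: "holomorphic_at_origin F \<Longrightarrow> holomorphic_at_origin G \<Longrightarrow> germ F + germ G = germ (\<lambda>z. F z + G z)"
  by (rule plus_holo_germ.abs_eq) (auto simp: same_germ_refl)

lemma germ_mult: "holomorphic_at_origin F \<Longrightarrow> holomorphic_at_origin G \<Longrightarrow> germ F * germ G = germ (\<lambda>z. F z * G z)"
  by (rule times_holo_germ.abs_eq) (auto simp: same_germ_refl)

lemma germ_sum:
  "finite A \<Longrightarrow> (\<And>x. x \<in> A \<Longrightarrow> holomorphic_at_origin (F x)) \<Longrightarrow> (\<Sum>x\<in>A. germ (F x)) = germ (\<lambda>z. \<Sum>x\<in>A. F x z)"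
proof (induction A rule: finite_induct)
  case empty
  then show ?case by (simp add: zero_holo_germ_def)
next
  case (insert x A)
  then show ?case by (simp add: germ_add holomorphic_at_origin_sum)
qed

lemma module_times: "module ((*) :: 'a::comm_ring_1 \<Rightarrow> 'a \<Rightarrow> 'a)"
  by standard (auto simp: algebra_simps)

lemma span_times_subset_ideal:
  assumes "is_ideal J" "S \<subseteq> J" shows "module.span (*) S \<subseteq> J"
proof (rule module.span_minimal[OF module_times assms(2)])
  show "module.subspace (*) J"
    using assms(1) unfolding module.subspace_def[OF module_times] is_ideal_def by auto
qed

lemma is_ideal_tjurina_ideal: "is_ideal (tjurina_ideal g)"
  unfolding tjurina_ideal_def is_ideal_def
  by (auto intro: module.span_zero[OF module_times] module.span_add[OF module_times] module.span_scale[OF module_times])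

section \<open>From germs to polynomials at a singular point\<close>

definition chart :: "complex ^ (('n::finite) option) \<Rightarrow> 'n option \<Rightarrow> complex ^ 'n \<Rightarrow> complex ^ 'n option" where
  "chart x j y = x + hyperplane_embedding j y"

definition chart_position :: "'n option \<Rightarrow> 'n \<Rightarrow> 'n option" where
  "chart_position j i = (if j = Some i then None else Some i)"

lemma embedding_position: "hyperplane_embedding j y $ chart_position j i = y $ i"
  by (auto simp: hyperplane_embedding_def chart_position_def)

lemma embedding_self: "hyperplane_embedding j y $ j = 0"
  by (simp add: hyperplane_embedding_def)

lemma chart_position_surj: "k \<noteq> j \<Longrightarrow> \<exists>i. k = chart_position j i"
  by (rule exI[of _ "case k of Some i \<Rightarrow> i | None \<Rightarrow> the j"]) (auto simp: chart_position_def split: option.splits)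

lemma embedding_component:
  "(\<lambda>y. hyperplane_embedding j y $ k) = (if k = j then (\<lambda>_. 0) else (\<lambda>y. y $ (SOME i. k = chart_position j i)))"
proof (cases "k = j")
  case False
  define i0 where "i0 = (SOME i. k = chart_position j i)"
  have k: "k = chart_position j i0"
    unfolding i0_def by (rule someI_ex[OF chart_position_surj[OF False]])
  have "hyperplane_embedding j y $ k = y $ i0" for y
    unfolding k by (rule embedding_position)
  then show ?thesis unfolding i0_def[symmetric] using False by simp
qed (simp add: embedding_self)

lemma holomorphic_at_origin_chart: "holomorphic_at_origin (\<lambda>y. poly_eval p (chart x j y))"
proof (rule holomorphic_at_origin_poly_eval)
  fix k
  have "holomorphic_at_origin (\<lambda>y. hyperplane_embedding j y $ k)"
    unfolding embedding_component by (simp add: holomorphic_at_origin_const holomorphic_at_origin_component)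
  then show "holomorphic_at_origin (\<lambda>y. chart x j y $ k)"
    using holomorphic_at_origin_add[OF holomorphic_at_origin_const[of "x $ k"]] by (simp add: chart_def)
qed

lemma chart_add_axis: "chart x j (y + t *s axis i 1) = chart x j y + t *s axis (chart_position j i) 1"
proof -
  have "hyperplane_embedding j (y + t *s axis i 1) $ k = (hyperplane_embedding j y + t *s axis (chart_position j i) 1) $ k" for k
    by (cases k; cases j) (auto simp: hyperplane_embedding_def chart_position_def axis_def)
  then show ?thesis by (simp add: chart_def vec_eq_iff)
qed

lemma fun_partial_chart:
  "fun_partial i (\<lambda>y. poly_eval f (chart x j y)) = (\<lambda>y. poly_eval (poly_partial (chart_position j i) f) (chart x j y))"
  unfolding fun_partial_def chart_add_axis by (rule ext) (rule DERIV_imp_deriv[OF poly_eval_partial])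

text \<open>Euler's formula expresses the dehomogenized \<open>f\<close> by all partial derivatives,
  including the one with respect to \<open>x\<^sub>j\<close>; the other generators are partial
  derivatives already. Thus only elements that lie in \<open>Q\<close> globally remain.\<close>

lemma tjurina_ideal_subset_jacobian:
  assumes f: "f \<in> homogeneous_part N" "N > 0"
  shows "tjurina_ideal (\<lambda>y. poly_eval f (chart x j y)) \<subseteq>
    gen (\<lambda>v. germ (\<lambda>y. poly_eval (poly_partial v f) (chart x j y))) UNIV {0}"
  unfolding tjurina_ideal_def
proof (rule span_times_subset_ideal)
  let ?J = "gen (\<lambda>v. germ (\<lambda>y. poly_eval (poly_partial v f) (chart x j y))) UNIV {0}"
  show J: "is_ideal ?J" by (rule is_ideal_gen[OF finite is_ideal_0])
  have p: "germ (\<lambda>y. poly_eval (poly_partial v f) (chart x j y)) \<in> ?J" for v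
    using gen_mem[OF finite is_ideal_0 UNIV_I] .
  have "(\<lambda>y. poly_eval f (chart x j y)) =
      (\<lambda>y. \<Sum>v\<in>UNIV. poly_eval (Const (1 / of_nat N) * Var v) (chart x j y) * poly_eval (poly_partial v f) (chart x j y))"
  proof
    fix y
    have "of_nat N * poly_eval f (chart x j y) = poly_eval (of_nat N * f) (chart x j y)"
      using poly_eval_Const[of "of_nat N" "chart x j y"] by (simp add: poly_eval_mult Const_def)
    also have "\<dots> = (\<Sum>v\<in>UNIV. poly_eval (Var v) (chart x j y) * poly_eval (poly_partial v f) (chart x j y))"
      unfolding euler_formula[OF f(1), symmetric] by (simp add: poly_eval_sum poly_eval_mult)
    finally have *: "of_nat N * poly_eval f (chart x j y) = (\<Sum>v\<in>UNIV. poly_eval (Var v) (chart x j y) * poly_eval (poly_partial v f) (chart x j y))" .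
    have "poly_eval f (chart x j y) = (1 / of_nat N) * (of_nat N * poly_eval f (chart x j y))" using f(2) by simp
    then show "poly_eval f (chart x j y) = (\<Sum>v\<in>UNIV. poly_eval (Const (1 / of_nat N) * Var v) (chart x j y) * poly_eval (poly_partial v f) (chart x j y))"
      unfolding * by (simp add: sum_distrib_left poly_eval_mult poly_eval_Const mult.assoc)
  qed
  then have "germ (\<lambda>y. poly_eval f (chart x j y)) =
      (\<Sum>v\<in>UNIV. germ (\<lambda>y. poly_eval (Const (1 / of_nat N) * Var v) (chart x j y)) * germ (\<lambda>y. poly_eval (poly_partial v f) (chart x j y)))"
    by (simp add: germ_mult germ_sum holomorphic_at_origin_chart holomorphic_at_origin_mult)
  also have "\<dots> \<in> ?J" by (rule ideal_sum[OF J ideal_mult[OF J p]])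
  finally have "germ (\<lambda>y. poly_eval f (chart x j y)) \<in> ?J" .
  then show "insert (germ (\<lambda>y. poly_eval f (chart x j y)))
      (range (\<lambda>i. germ (fun_partial i (\<lambda>y. poly_eval f (chart x j y))))) \<subseteq> ?J"
    using p by (auto simp: fun_partial_chart)
qed

text \<open>The holomorphic coefficients are replaced by Taylor polynomials; the forms
  \<open>\<theta> v\<close> are bounded near the origin, so the order of the error is kept.\<close>

lemma jacobian_taylor:
  fixes \<theta> :: "'v \<Rightarrow> ('n::finite) option mpoly"
  assumes c: "germ (\<lambda>y. poly_eval c (chart x j y)) \<in> gen (\<lambda>v. germ (\<lambda>y. poly_eval (\<theta> v) (chart x j y))) V {0}"
    and V: "finite V"
  obtains P C where "\<forall>\<^sub>F y in nhds 0.
    norm (poly_eval c (chart x j y) - (\<Sum>v\<in>V. poly_eval (P v) y * poly_eval (\<theta> v) (chart x j y))) \<le> C * norm y ^ N"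
proof -
  obtain a where a: "germ (\<lambda>y. poly_eval c (chart x j y)) = (\<Sum>v\<in>V. a v * germ (\<lambda>y. poly_eval (\<theta> v) (chart x j y)))"
    using c by (auto simp: gen_def)
  have "\<forall>v. \<exists>F. holomorphic_at_origin F \<and> a v = germ F" using germ_cases by metis
  then obtain F where F: "\<And>v. holomorphic_at_origin (F v)" "\<And>v. a v = germ (F v)" by metis
  have "germ (\<lambda>y. poly_eval c (chart x j y)) = germ (\<lambda>y. \<Sum>v\<in>V. F v y * poly_eval (\<theta> v) (chart x j y))"
    unfolding a F(2) using F(1) V by (simp add: germ_mult germ_sum holomorphic_at_origin_chart holomorphic_at_origin_mult)
  then have eq: "\<forall>\<^sub>F y in nhds 0. poly_eval c (chart x j y) = (\<Sum>v\<in>V. F v y * poly_eval (\<theta> v) (chart x j y))"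
    using F(1) by (subst (asm) germ_eq_iff) (auto intro!: holomorphic_at_origin_chart holomorphic_at_origin_sum holomorphic_at_origin_mult)
  have "\<exists>P C. \<forall>\<^sub>F y in nhds 0. norm (F v y - poly_eval P y) \<le> C * norm y ^ N" for v
    using holomorphic_at_origin_taylor[OF F(1)] by metis
  then obtain P C where P: "\<And>v. \<forall>\<^sub>F y in nhds 0. norm (F v y - poly_eval (P v) y) \<le> C v * norm y ^ N" by metis
  have bd: "\<exists>B. \<forall>\<^sub>F y in nhds 0. norm (poly_eval (\<theta> v) (chart x j y)) \<le> B" for v
  proof -
    obtain r where r: "0 < r" "separately_holomorphic r (\<lambda>y. poly_eval (\<theta> v) (chart x j y))"
      using holomorphic_at_origin_separately[OF holomorphic_at_origin_chart] .
    have "continuous_on (polydisc r) (\<lambda>y. poly_eval (\<theta> v) (chart x j y))"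
      using r(2) unfolding separately_holomorphic_def by (rule conjunct1)
    moreover have "(0 :: complex ^ 'n) \<in> polydisc r" using r(1) by (simp add: polydisc_def)
    ultimately have "isCont (\<lambda>y. poly_eval (\<theta> v) (chart x j y)) 0"
      unfolding continuous_on_eq_continuous_at[OF open_polydisc] by blast
    then have "((\<lambda>y. norm (poly_eval (\<theta> v) (chart x j y))) \<longlongrightarrow> norm (poly_eval (\<theta> v) (chart x j 0))) (nhds 0)"
      by (intro tendsto_norm) (simp add: isCont_def tendsto_nhds_iff)
    then have "\<forall>\<^sub>F y in nhds 0. norm (poly_eval (\<theta> v) (chart x j y)) < norm (poly_eval (\<theta> v) (chart x j 0)) + 1"
      by (rule order_tendstoD) simp
    then show ?thesis by (auto elim!: eventually_mono intro: less_imp_le)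
  qed
  obtain B where B: "\<And>v. \<forall>\<^sub>F y in nhds 0. norm (poly_eval (\<theta> v) (chart x j y)) \<le> B v" using bd by metis
  have "\<forall>\<^sub>F y in nhds 0. \<forall>v\<in>V. norm (F v y - poly_eval (P v) y) \<le> C v * norm y ^ N"
    using V P by (simp add: eventually_ball_finite)
  moreover have "\<forall>\<^sub>F y in nhds 0. \<forall>v\<in>V. norm (poly_eval (\<theta> v) (chart x j y)) \<le> B v"
    using V B by (simp add: eventually_ball_finite)
  ultimately have "\<forall>\<^sub>F y in nhds 0.
    norm (poly_eval c (chart x j y) - (\<Sum>v\<in>V. poly_eval (P v) y * poly_eval (\<theta> v) (chart x j y))) \<le> (\<Sum>v\<in>V. C v * B v) * norm y ^ N"
    using eq
  proof eventually_elim
    case (elim y)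
    have "poly_eval c (chart x j y) - (\<Sum>v\<in>V. poly_eval (P v) y * poly_eval (\<theta> v) (chart x j y)) =
      (\<Sum>v\<in>V. (F v y - poly_eval (P v) y) * poly_eval (\<theta> v) (chart x j y))"
      unfolding elim(3) by (simp add: left_diff_distrib sum_subtractf)
    also have "norm \<dots> \<le> (\<Sum>v\<in>V. (C v * norm y ^ N) * B v)"
    proof (rule sum_norm_le)
      fix v assume v: "v \<in> V"
      have "0 \<le> C v * norm y ^ N" using elim(1) v norm_ge_zero order.trans by blast
      then show "norm ((F v y - poly_eval (P v) y) * poly_eval (\<theta> v) (chart x j y)) \<le> (C v * norm y ^ N) * B v"
        unfolding norm_mult using elim v by (intro mult_mono) auto
    qed
    also have "\<dots> = (\<Sum>v\<in>V. C v * B v) * norm y ^ N" by (simp add: sum_distrib_right sum_distrib_left mult_ac)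
    finally show ?case .
  qed
  then show thesis by (rule that)
qed

text \<open>Once the coefficients below \<open>r\<close> are known to be 0, divide by
  \<open>t ^ r\<close> and let \<open>t\<close> tend to 0; the bound still tends to 0 as
  \<open>r < N\<close>.\<close>

lemma low_coefficients_vanish:
  fixes c :: "nat \<Rightarrow> complex"
  assumes "\<forall>\<^sub>F t in at_right (0::real). norm (\<Sum>r\<le>n. c r * of_real t ^ r) \<le> C * t ^ N"
  shows "r < N \<Longrightarrow> r \<le> n \<Longrightarrow> c r = 0"
proof (induction r rule: less_induct)
  case (less r)
  define q where "q t = (\<Sum>s\<in>{r..n}. c s * of_real t ^ (s - r))" for t :: real
  have "(\<Sum>s\<le>n. c s * of_real t ^ s) = of_real t ^ r * q t" for t :: real
  proof -
    have "(\<Sum>s\<le>n. c s * of_real t ^ s) = (\<Sum>s\<in>{r..n}. c s * of_real t ^ s)"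
      using less by (intro sum.mono_neutral_right) auto
    also have "\<dots> = of_real t ^ r * q t"
      unfolding q_def sum_distrib_left by (intro sum.cong) (auto simp: mult_ac simp flip: power_add)
    finally show ?thesis .
  qed
  then have "\<forall>\<^sub>F t in at_right 0. norm (of_real t ^ r * q t) \<le> C * t ^ N" using assms by simp
  then have le: "\<forall>\<^sub>F t in at_right 0. norm (q t) \<le> C * t ^ (N - r)"
    using eventually_at_right_less[of 0]
  proof eventually_elim
    case (elim t)
    have "t ^ r * norm (q t) \<le> t ^ r * (C * t ^ (N - r))"
      using elim less(2) by (simp add: norm_mult norm_power mult_ac flip: power_add)
    then show ?case using elim(2) by simp
  qed
  have "(q \<longlongrightarrow> q 0) (at_right 0)" unfolding q_def by (intro tendsto_intros)
  then have "((\<lambda>t. norm (q t)) \<longlongrightarrow> norm (q 0)) (at_right 0)" by (rule tendsto_norm)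
  moreover have "((\<lambda>t. C * t ^ (N - r)) \<longlongrightarrow> C * 0 ^ (N - r)) (at_right 0)" by (intro tendsto_intros)
  ultimately have "norm (q 0) \<le> C * 0 ^ (N - r)"
    using le by (intro tendsto_le[OF trivial_limit_at_right_real])
  then have "q 0 = 0" using less(2) by (simp add: zero_power)
  moreover have "q 0 = (\<Sum>s\<in>{r..n}. if s = r then c r else 0)"
    unfolding q_def by (intro sum.cong) (auto simp: power_0_left)
  ultimately show ?case using less(3) by simp
qed

lemma poly_eval_insertion_Const:
  "poly_eval (insertion Const \<phi> p) z = poly_eval p (\<chi> v. poly_eval (\<phi> v) z)"
  unfolding insertion_def poly_eval_sum poly_eval_mult poly_eval_prod poly_eval_power poly_eval_Const poly_eval_def[of p]
  by simp

lemma insertion_Const_compose: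
  "insertion Const \<phi> (insertion Const \<psi> p) = insertion Const (\<lambda>v. insertion Const \<phi> (\<psi> v)) p"
  unfolding insertion_def[of Const \<psi> p] insertion_def[of Const "\<lambda>v. insertion Const \<phi> (\<psi> v)" p]
  by (simp add: insertion_sum[OF is_hom_Const] insertion_mult[OF is_hom_Const] insertion_Const[OF is_hom_Const]
      insertion_prod[OF is_hom_Const] insertion_power[OF is_hom_Const])

lemma insertion_Const_Var: "insertion Const Var p = p"
  by (subst (2) mpoly_eq_sum_single[of p]) (simp add: insertion_def single_eq_Const_mult_prod[symmetric])

lemma insertion_Const_hom:
  assumes "p \<in> homogeneous_part m" "\<And>v. \<phi> v \<in> homogeneous_part 1"
  shows "insertion Const \<phi> p \<in> homogeneous_part m"
  unfolding insertion_def
proof (intro homogeneous_part_sum homogeneous_part_Const_mult)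
  fix a assume "a \<in> Poly_Mapping.keys p"
  then have m: "m = (\<Sum>v\<in>UNIV. Poly_Mapping.lookup a v * 1)"
    using assms(1) by (auto simp: homogeneous_part_def monom_degree_def)
  show "(\<Prod>v\<in>UNIV. \<phi> v ^ Poly_Mapping.lookup a v) \<in> homogeneous_part m"
    unfolding m by (intro homogeneous_part_prod homogeneous_part_power assms(2)) simp
qed

text \<open>The last hypothesis says that \<open>Q\<close> contains the \<open>N\<close>-th power of the homogeneous ideal of the point \<open>x\<close>.\<close>

lemma vanishing_order_ideal:
  fixes x :: "complex ^ (('n::finite) option)" and j :: "'n option" and p :: "'n option mpoly"
  defines "Y \<equiv> \<lambda>u. Var u - Const (x $ u) * Var j"
  assumes xj: "x $ j = 1" and p: "p \<in> homogeneous_part m"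
    and O: "\<forall>\<^sub>F y in nhds 0. norm (poly_eval p (chart x j y)) \<le> C * norm y ^ N"
    and Q: "is_ideal Q" "\<And>\<alpha>. (\<Sum>u\<in>UNIV - {j}. \<alpha> u) \<ge> N \<Longrightarrow> (\<Prod>u\<in>UNIV - {j}. Y u ^ \<alpha> u) \<in> Q"
  shows "p \<in> Q"
proof -
  let ?A = "UNIV - {j}"
  \<comment> \<open>Mutually inverse linear substitutions: \<open>s\<close> passes to the
    coordinates \<open>x\<^sub>j\<close> and \<open>Y\<^sub>u\<close>, the latter centered at
    \<open>x\<close>, and \<open>t\<close> passes back.\<close>
  define s where "s u = (if u = j then Var j else Var u + Const (x $ u) * Var j)" for u
  define t where "t u = (if u = j then Var j else Y u)" for u
  define p' where "p' = insertion Const s p"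
  have p': "p' \<in> homogeneous_part m" unfolding p'_def
    by (rule insertion_Const_hom[OF p]) (auto simp: s_def simp del: One_nat_def intro!: Var_hom homogeneous_part_add homogeneous_part_Const_mult)
  have "insertion Const t (s u) = Var u" for u
    by (simp add: s_def t_def Y_def insertion_add[OF is_hom_Const] insertion_mult[OF is_hom_Const] insertion_Var[OF is_hom_Const]
        insertion_Const[OF is_hom_Const])
  then have pt: "p = insertion Const t p'"
    unfolding p'_def insertion_Const_compose by (simp add: insertion_Const_Var)
  define deg where "deg a = (\<Sum>u\<in>?A. Poly_Mapping.lookup a u)" for a :: "'n option \<Rightarrow>\<^sub>0 nat"
  have deg: "deg a \<le> m" "Poly_Mapping.lookup a j = m - deg a" if "a \<in> Poly_Mapping.keys p'" for a
  proof -
    have "monom_degree a = m" using p' that by (simp add: homogeneous_part_def)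
    then have "Poly_Mapping.lookup a j + deg a = m" by (simp add: monom_degree_def deg_def sum.remove[of UNIV j])
    then show "deg a \<le> m" "Poly_Mapping.lookup a j = m - deg a" by auto
  qed
  have ev: "poly_eval p (chart x j y) = (\<Sum>a\<in>Poly_Mapping.keys p'. Poly_Mapping.lookup p' a *
      (\<Prod>u\<in>?A. (hyperplane_embedding j y $ u) ^ Poly_Mapping.lookup a u))" for y
  proof -
    have "poly_eval (t u) (chart x j y) = (if u = j then 1 else hyperplane_embedding j y $ u)" for u
      using xj by (simp add: t_def Y_def poly_eval_diff poly_eval_mult poly_eval_Const poly_eval_Var chart_def embedding_self)
    then have "poly_eval p (chart x j y) = poly_eval p' (\<chi> u. if u = j then 1 else hyperplane_embedding j y $ u)"
      unfolding pt poly_eval_insertion_Const by simp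
    also have "\<dots> = (\<Sum>a\<in>Poly_Mapping.keys p'. Poly_Mapping.lookup p' a *
      (\<Prod>u\<in>?A. (hyperplane_embedding j y $ u) ^ Poly_Mapping.lookup a u))"
      unfolding poly_eval_def
    proof (intro sum.cong refl arg_cong2[where f = times])
      fix a :: "'n option \<Rightarrow>\<^sub>0 nat"
      have "(\<Prod>u\<in>?A. ((\<chi> u. if u = j then 1 else hyperplane_embedding j y $ u) $ u) ^ Poly_Mapping.lookup a u) =
        (\<Prod>u\<in>?A. (hyperplane_embedding j y $ u) ^ Poly_Mapping.lookup a u)"
        by (intro prod.cong) auto
      then show "(\<Prod>u\<in>UNIV. ((\<chi> u. if u = j then 1 else hyperplane_embedding j y $ u) $ u) ^ Poly_Mapping.lookup a u) =
        (\<Prod>u\<in>?A. (hyperplane_embedding j y $ u) ^ Poly_Mapping.lookup a u)"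
        by (simp add: prod.remove[of UNIV j])
    qed
    finally show ?thesis .
  qed
  \<comment> \<open>The part of order \<open>r\<close> at \<open>x\<close>, evaluated in the
    direction \<open>y\<close>: the coefficient of \<open>\<tau> ^ r\<close> along the ray
    \<open>\<tau> * y\<close>.\<close>
  define c where "c y r = (\<Sum>a\<in>{a\<in>Poly_Mapping.keys p'. deg a = r}. Poly_Mapping.lookup p' a *
      (\<Prod>u\<in>?A. (hyperplane_embedding j y $ u) ^ Poly_Mapping.lookup a u))" for y r
  have c0: "c y r = 0" if r: "r < N" "r \<le> m" for y r
  proof (rule low_coefficients_vanish[where n = m and c = "c y", OF _ r])
    have lim: "((\<lambda>\<tau>::real. of_real \<tau> *s y) \<longlongrightarrow> 0) (at_right 0)"
    proof (rule vec_tendstoI)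
      fix i
      have "((\<lambda>\<tau>::real. of_real \<tau> * (y $ i)) \<longlongrightarrow> of_real 0 * (y $ i)) (at_right 0)" by (intro tendsto_intros)
      then show "((\<lambda>\<tau>::real. (of_real \<tau> *s y) $ i) \<longlongrightarrow> 0 $ i) (at_right 0)" by simp
    qed
    have "\<forall>\<^sub>F \<tau> in at_right (0::real). norm (poly_eval p (chart x j (of_real \<tau> *s y))) \<le> C * norm (of_real \<tau> *s y :: complex ^ 'n) ^ N"
      using eventually_compose_filterlim[OF O lim] .
    then show "\<forall>\<^sub>F \<tau> in at_right (0::real). norm (\<Sum>r\<le>m. c y r * of_real \<tau> ^ r) \<le> (C * norm y ^ N) * \<tau> ^ N"
      using eventually_at_right_less[of 0]
    proof eventually_elim
      case (elim \<tau>)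
      have sc: "hyperplane_embedding j (of_real \<tau> *s y) $ u = of_real \<tau> * (hyperplane_embedding j y $ u)" for u
        by (auto simp: hyperplane_embedding_def split: option.split)
      have nm: "norm (of_real \<tau> *s y :: complex ^ 'n) = \<tau> * norm y"
        using elim(2) by (simp add: norm_vec_def norm_mult L2_set_right_distrib)
      have "poly_eval p (chart x j (of_real \<tau> *s y)) = (\<Sum>a\<in>Poly_Mapping.keys p'. of_real \<tau> ^ deg a * (Poly_Mapping.lookup p' a *
        (\<Prod>u\<in>?A. (hyperplane_embedding j y $ u) ^ Poly_Mapping.lookup a u)))"
        unfolding ev sc by (intro sum.cong refl) (simp add: power_mult_distrib prod.distrib deg_def power_sum mult_ac)
      also have "\<dots> = (\<Sum>r\<le>m. \<Sum>a\<in>{a\<in>Poly_Mapping.keys p'. deg a = r}. of_real \<tau> ^ deg a * (Poly_Mapping.lookup p' a *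
        (\<Prod>u\<in>?A. (hyperplane_embedding j y $ u) ^ Poly_Mapping.lookup a u)))"
        by (rule sum.group[symmetric]) (use deg in auto)
      also have "\<dots> = (\<Sum>r\<le>m. c y r * of_real \<tau> ^ r)"
        unfolding c_def sum_distrib_right by (intro sum.cong refl) (simp add: mult_ac)
      finally show ?case using elim(1) unfolding nm by (simp add: power_mult_distrib mult_ac)
    qed
  qed
  have big: "deg a \<ge> N" if a: "a \<in> Poly_Mapping.keys p'" for a
  proof (rule ccontr)
    assume "\<not> deg a \<ge> N"
    define K where "K = {b\<in>Poly_Mapping.keys p'. deg b = deg a}"
    define X where "X \<alpha> = Poly_Mapping.lookup p' (Poly_Mapping.Abs_poly_mapping \<alpha>)" for \<alpha>
    have X: "X (Poly_Mapping.lookup b) = Poly_Mapping.lookup p' b" for b by (simp add: X_def lookup_inverse)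
    have inj: "inj_on Poly_Mapping.lookup K" by (rule inj_onI) (simp only: lookup_inject)
    have "\<exists>q. (\<forall>u\<in>?A. q u \<noteq> 0) \<and> (\<Sum>\<alpha>\<in>Poly_Mapping.lookup ` K. X \<alpha> * (\<Prod>u\<in>?A. q u ^ \<alpha> u)) \<noteq> 0"
    proof (rule nonvanishing_point)
      show "Poly_Mapping.lookup a \<in> Poly_Mapping.lookup ` K" using a by (simp add: K_def)
      show "X (Poly_Mapping.lookup a) \<noteq> 0" using a by (simp add: X in_keys_iff)
      show "finite (Poly_Mapping.lookup ` K)" by (simp add: K_def)
      fix \<alpha> \<beta> assume "\<alpha> \<in> Poly_Mapping.lookup ` K" "\<beta> \<in> Poly_Mapping.lookup ` K" and eq: "\<forall>u\<in>?A. \<alpha> u = \<beta> u"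
      then obtain b b' where b: "b \<in> K" "b' \<in> K" "\<alpha> = Poly_Mapping.lookup b" "\<beta> = Poly_Mapping.lookup b'" by blast
      \<comment> \<open>Homogeneity recovers the exponent of \<open>x\<^sub>j\<close> from the
        order.\<close>
      then have "\<alpha> j = \<beta> j" using deg(2) by (simp add: K_def)
      then show "\<alpha> = \<beta>" using eq by (intro ext) (metis DiffI UNIV_I singletonD)
    qed simp
    then obtain q where q: "(\<Sum>\<alpha>\<in>Poly_Mapping.lookup ` K. X \<alpha> * (\<Prod>u\<in>?A. q u ^ \<alpha> u)) \<noteq> 0" by blast
    define y where "y = (\<chi> i. q (chart_position j i))"
    have "hyperplane_embedding j y $ u = q u" if "u \<in> ?A" for u
      using chart_position_surj[of u j] that embedding_position[of j y] by (auto simp: y_def)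
    then have "c y (deg a) = (\<Sum>b\<in>K. Poly_Mapping.lookup p' b * (\<Prod>u\<in>?A. q u ^ Poly_Mapping.lookup b u))"
      unfolding c_def K_def by (intro sum.cong refl arg_cong2[where f = times] prod.cong) auto
    also have "\<dots> = (\<Sum>\<alpha>\<in>Poly_Mapping.lookup ` K. X \<alpha> * (\<Prod>u\<in>?A. q u ^ \<alpha> u))"
      by (simp add: sum.reindex[OF inj] X)
    finally show False using q c0[of "deg a" y] deg(1)[OF a] \<open>\<not> deg a \<ge> N\<close> by simp
  qed
  have mem: "(\<Prod>v\<in>UNIV. t v ^ Poly_Mapping.lookup a v) \<in> Q" if "a \<in> Poly_Mapping.keys p'" for a
  proof -
    have "(\<Prod>u\<in>?A. Y u ^ Poly_Mapping.lookup a u) \<in> Q" using big[OF that] by (intro Q(2)) (simp add: deg_def)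
    moreover have "(\<Prod>u\<in>?A. Y u ^ Poly_Mapping.lookup a u) = (\<Prod>u\<in>?A. t u ^ Poly_Mapping.lookup a u)"
      by (intro prod.cong) (auto simp: t_def)
    ultimately show ?thesis
      using ideal_mult[OF Q(1), of _ "t j ^ Poly_Mapping.lookup a j"] by (simp add: prod.remove[of UNIV j])
  qed
  have "insertion Const t p' \<in> Q"
    unfolding insertion_def by (rule ideal_sum[OF Q(1)], rule ideal_mult[OF Q(1)], rule mem)
  then show ?thesis unfolding pt[symmetric] .
qed

text \<open>Homogenizing the polynomial approximation of the germ identity gives a form
  \<open>p\<close> vanishing to order \<open>r\<close> at \<open>x\<close>, hence in
  \<open>Q\<close>; the combination of partial derivatives lies in \<open>Q\<close> as well. What is
  left of the identity is \<open>c\<close> times a power of \<open>x\<^sub>j\<close>, the price of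
  homogenizing.\<close>

theorem tjurina_ideal_membership:
  fixes f :: "('n::finite) option mpoly" and x :: "complex ^ 'n option"
  assumes f: "f \<in> homogeneous_part N" "N > 0" and xj: "x $ j = 1" and c: "c \<in> homogeneous_part k"
    and germ: "germ (\<lambda>y. poly_eval c (chart x j y)) \<in> tjurina_ideal (\<lambda>y. poly_eval f (chart x j y))"
    and Q: "is_ideal Q" "\<And>v. poly_partial v f \<in> Q"
      "\<And>\<alpha>. (\<Sum>u\<in>UNIV - {j}. \<alpha> u) \<ge> r \<Longrightarrow> (\<Prod>u\<in>UNIV - {j}. (Var u - Const (x $ u) * Var j) ^ \<alpha> u) \<in> Q"
  shows "\<exists>e. Var j ^ e * c \<in> Q"
proof -
  let ?\<theta> = "\<lambda>v. poly_partial v f"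
  define Y where "Y u = Var u - Const (x $ u) * Var j" for u
  have "germ (\<lambda>y. poly_eval c (chart x j y)) \<in> gen (\<lambda>v. germ (\<lambda>y. poly_eval (?\<theta> v) (chart x j y))) UNIV {0}"
    using tjurina_ideal_subset_jacobian[OF f] germ by blast
  from jacobian_taylor[OF this finite, of r]
  obtain P C where PC: "\<forall>\<^sub>F y in nhds 0.
    norm (poly_eval c (chart x j y) - (\<Sum>v\<in>UNIV. poly_eval (P v) y * poly_eval (?\<theta> v) (chart x j y))) \<le> C * norm y ^ r" .
  define D where "D = (\<Sum>v\<in>UNIV. \<Sum>a\<in>Poly_Mapping.keys (P v). monom_degree a)"
  have D: "monom_degree a \<le> D" if "a \<in> Poly_Mapping.keys (P v)" for a v
  proof -
    have "monom_degree a \<le> (\<Sum>a\<in>Poly_Mapping.keys (P v). monom_degree a)" using that by (intro member_le_sum) auto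
    also have "\<dots> \<le> D" unfolding D_def by (rule member_le_sum[where f = "\<lambda>v. \<Sum>a\<in>Poly_Mapping.keys (P v). monom_degree a"]) auto
    finally show ?thesis .
  qed
  have Y: "Y u \<in> homogeneous_part 1" for u
    unfolding Y_def by (intro homogeneous_part_diff homogeneous_part_Const_mult Var_hom)
  \<comment> \<open>\<open>P v\<close> homogenized to degree \<open>D\<close> in the local
    coordinates \<open>Y\<close>; on the chart it takes the same values as
    \<open>P v\<close>.\<close>
  define h where "h v = (\<Sum>a\<in>Poly_Mapping.keys (P v). Const (Poly_Mapping.lookup (P v) a) *
     ((\<Prod>i\<in>UNIV. Y (chart_position j i) ^ Poly_Mapping.lookup a i) * Var j ^ (D - monom_degree a)))" for v
  have h: "h v \<in> homogeneous_part D" for v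
    unfolding h_def
  proof (intro homogeneous_part_sum homogeneous_part_Const_mult)
    fix a assume a: "a \<in> Poly_Mapping.keys (P v)"
    have "(\<Prod>i\<in>UNIV. Y (chart_position j i) ^ Poly_Mapping.lookup a i) \<in> homogeneous_part (\<Sum>i\<in>UNIV. Poly_Mapping.lookup a i * 1)"
      by (intro homogeneous_part_prod homogeneous_part_power Y) simp
    moreover have "Var j ^ (D - monom_degree a) \<in> homogeneous_part ((D - monom_degree a) * 1)"
      by (rule homogeneous_part_power[OF Var_hom])
    ultimately show "(\<Prod>i\<in>UNIV. Y (chart_position j i) ^ Poly_Mapping.lookup a i) * Var j ^ (D - monom_degree a) \<in> homogeneous_part D"
      using homogeneous_part_mult D[OF a] by (fastforce simp: monom_degree_def)
  qed
  have evY: "poly_eval (Y u) (chart x j y) = hyperplane_embedding j y $ u" for u y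
    using xj by (simp add: Y_def poly_eval_diff poly_eval_mult poly_eval_Const poly_eval_Var chart_def embedding_self)
  have evj: "poly_eval (Var j) (chart x j y) = 1" for y
    using xj by (simp add: poly_eval_Var chart_def embedding_self)
  have evh: "poly_eval (h v) (chart x j y) = poly_eval (P v) y" for v y
    by (simp add: h_def poly_eval_sum poly_eval_mult poly_eval_prod poly_eval_power poly_eval_Const evY evj embedding_position)
       (simp add: poly_eval_def)
  \<comment> \<open>Both terms have degree \<open>D + (N - 1) + k\<close>: the factor
    \<open>Var j ^ k\<close> balances the degree of \<open>c\<close>.\<close>
  define p where "p = Var j ^ (D + (N - 1)) * c - (\<Sum>v\<in>UNIV. Var j ^ k * h v * ?\<theta> v)"
  have vp: "Var j ^ l \<in> homogeneous_part l" for l using homogeneous_part_power[OF Var_hom[of j], of l] by simp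
  have summand: "Var j ^ k * h v * ?\<theta> v \<in> homogeneous_part (D + (N - 1) + k)" for v
  proof -
    have "Var j ^ k * h v * ?\<theta> v \<in> homogeneous_part (k + D + (N - 1))"
      by (rule homogeneous_part_mult[OF homogeneous_part_mult[OF vp h] poly_partial_hom[OF f(1)]])
    then show ?thesis by (simp add: ac_simps)
  qed
  have hom: "p \<in> homogeneous_part (D + (N - 1) + k)"
    unfolding p_def
    by (rule homogeneous_part_diff[OF homogeneous_part_mult[OF vp c] homogeneous_part_sum[OF summand]])
  have "\<forall>\<^sub>F y in nhds 0. norm (poly_eval p (chart x j y)) \<le> C * norm y ^ r"
    using PC by (simp add: p_def poly_eval_diff poly_eval_mult poly_eval_sum poly_eval_power evj evh)
  from vanishing_order_ideal[OF xj hom this Q(1) Q(3)] have "p \<in> Q" .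
  moreover have "(\<Sum>v\<in>UNIV. Var j ^ k * h v * ?\<theta> v) \<in> Q"
    by (rule ideal_sum[OF Q(1) ideal_mult[OF Q(1) Q(2)]])
  ultimately show ?thesis using ideal_cong[OF Q(1)] unfolding p_def by blast
qed

section \<open>One-dimensional graded quotients\<close>

definition colon :: "'a::comm_ring_1 set \<Rightarrow> 'a \<Rightarrow> 'a set" where
  "colon I w = {q. q * w \<in> I}"

lemma is_ideal_colon: "is_ideal I \<Longrightarrow> is_ideal (colon I w)"
  unfolding is_ideal_def colon_def by (auto simp: distrib_right mult.assoc)

text \<open>The quotient by \<open>I\<close> is finitely generated over the polynomials in
  \<open>L\<close>, so its graded pieces have dimension at most \<open>card M\<close>. In degrees
  above \<open>K\<close> every form is a multiple of \<open>L\<close> modulo \<open>I\<close>, and a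
  factor \<open>L\<close> is split off.\<close>

lemma graded_quotient_span:
  fixes I :: "('v::finite) mpoly set"
  assumes I: "homogeneous_ideal I" and L: "L \<in> homogeneous_part 1" and P: "primary_mod (adjoin L I)"
  obtains M where "finite M" "\<And>m p. p \<in> homogeneous_part m \<Longrightarrow>
    \<exists>c. p - (\<Sum>a\<in>M. Const (c a) * (L ^ (m - monom_degree a) * Poly_Mapping.single a 1)) \<in> I"
proof -
  note Ii = homogeneous_idealD[OF I]
  note Ai = is_ideal_adjoin[OF Ii, of L]
  obtain k where k: "\<And>v. Var v ^ k v \<in> adjoin L I" using P unfolding primary_mod_def by metis
  define K where "K = (\<Sum>v\<in>UNIV. k v)"
  define M where "M = {a :: 'v \<Rightarrow>\<^sub>0 nat. monom_degree a \<le> K \<and> Poly_Mapping.keys a \<subseteq> UNIV}"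
  have M: "finite M" unfolding M_def by (rule card_bounded_monomials)
  have big: "p \<in> adjoin L I" if p: "p \<in> homogeneous_part m" and m: "m > K" for p m
  proof -
    have "Poly_Mapping.single a (Poly_Mapping.lookup p a) \<in> adjoin L I" if a: "a \<in> Poly_Mapping.keys p" for a
    proof -
      have "\<exists>v. k v \<le> Poly_Mapping.lookup a v"
      proof (rule ccontr)
        assume "\<nexists>v. k v \<le> Poly_Mapping.lookup a v"
        then have "monom_degree a \<le> K" unfolding monom_degree_def K_def by (intro sum_mono) (auto simp: not_le less_imp_le)
        then show False using p a m by (auto simp: homogeneous_part_def)
      qed
      then obtain v where v: "k v \<le> Poly_Mapping.lookup a v" by blast
      have "Var v ^ Poly_Mapping.lookup a v = Var v ^ (Poly_Mapping.lookup a v - k v) * Var v ^ k v"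
        using v by (simp flip: power_add)
      then have "Var v ^ Poly_Mapping.lookup a v \<in> adjoin L I" using ideal_mult[OF Ai k] by simp
      then have "Const (Poly_Mapping.lookup p a) * (Var v ^ Poly_Mapping.lookup a v * (\<Prod>u\<in>UNIV - {v}. Var u ^ Poly_Mapping.lookup a u)) \<in> adjoin L I"
        by (intro ideal_mult[OF Ai] ideal_mult_right[OF Ai])
      then show ?thesis by (simp add: single_eq_Const_mult_prod[of a] prod.remove[of UNIV v])
    qed
    then show ?thesis by (subst mpoly_eq_sum_single) (rule ideal_sum[OF Ai])
  qed
  have "\<exists>c. p - (\<Sum>a\<in>M. Const (c a) * (L ^ (m - monom_degree a) * Poly_Mapping.single a 1)) \<in> I"
    if "p \<in> homogeneous_part m" for m p
    using that
  proof (induction m arbitrary: p)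
    case 0
    have "p = (\<Sum>a\<in>M. Const (Poly_Mapping.lookup p a) * Poly_Mapping.single a 1)"
      using 0 by (intro monomial_expansion[OF M]) (auto simp: M_def homogeneous_part_def)
    then have "p - (\<Sum>a\<in>M. Const (Poly_Mapping.lookup p a) * (L ^ (0 - monom_degree a) * Poly_Mapping.single a 1)) = 0" by simp
    then show ?case using ideal_0[OF Ii] by (intro exI[of _ "Poly_Mapping.lookup p"]) (simp only:)
  next
    case (Suc m)
    show ?case
    proof (cases "Suc m \<le> K")
      case True
      have "p = (\<Sum>a\<in>M. Const (Poly_Mapping.lookup p a) * Poly_Mapping.single a 1)"
        using Suc True by (intro monomial_expansion[OF M]) (auto simp: M_def homogeneous_part_def)
      also have "\<dots> = (\<Sum>a\<in>M. Const (Poly_Mapping.lookup p a) * (L ^ (Suc m - monom_degree a) * Poly_Mapping.single a 1))"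
      proof (rule sum.cong[OF refl])
        fix a
        show "Const (Poly_Mapping.lookup p a) * Poly_Mapping.single a 1 =
          Const (Poly_Mapping.lookup p a) * (L ^ (Suc m - monom_degree a) * Poly_Mapping.single a 1)"
          using Suc.prems by (cases "Poly_Mapping.lookup p a = 0") (auto simp: homogeneous_part_iff)
      qed
      finally have eq: "p = \<dots>" .
      have "p - p \<in> I" using ideal_0[OF Ii] by simp
      then show ?thesis by (subst (asm) (2) eq) (rule exI)
    next
      case False
      then have "p \<in> adjoin L I" using big[OF Suc.prems] by simp
      from homogeneous_adjoinE[OF I L this Suc.prems]
      obtain e where e: "p - e * L \<in> I" "e \<in> homogeneous_part (Suc m - 1)" by blast
      then have em: "e \<in> homogeneous_part m" by simp
      obtain c where c: "e - (\<Sum>a\<in>M. Const (c a) * (L ^ (m - monom_degree a) * Poly_Mapping.single a 1)) \<in> I"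
        using Suc.IH[OF em] by blast
      have "(p - e * L) + L * (e - (\<Sum>a\<in>M. Const (c a) * (L ^ (m - monom_degree a) * Poly_Mapping.single a 1))) \<in> I"
        by (rule ideal_add[OF Ii e(1) ideal_mult[OF Ii c]])
      also have "(p - e * L) + L * (e - (\<Sum>a\<in>M. Const (c a) * (L ^ (m - monom_degree a) * Poly_Mapping.single a 1))) =
         p - (\<Sum>a\<in>M. L * (Const (c a) * (L ^ (m - monom_degree a) * Poly_Mapping.single a 1)))"
        by (simp add: right_diff_distrib sum_distrib_left mult.commute)
      also have "(\<Sum>a\<in>M. L * (Const (c a) * (L ^ (m - monom_degree a) * Poly_Mapping.single a 1))) =
         (\<Sum>a\<in>M. Const (c a) * (L ^ (Suc m - monom_degree a) * Poly_Mapping.single a 1))"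
        using False by (intro sum.cong) (auto simp: M_def Suc_diff_le mult_ac)
      finally show ?thesis by blast
    qed
  qed
  then show thesis using that M by blast
qed

section \<open>Commuting multiplications and their common eigenvectors\<close>

lemma regular_mod_powerD:
  assumes "regular_mod L I" "L ^ k * p \<in> I" shows "p \<in> I"
  using regular_mod_power[OF assms(1), of k, unfolded regular_mod_def] assms(2) by blast

lemma ideal_Const_cancel:
  assumes "is_ideal I" "Const c * p \<in> I" "c \<noteq> 0" shows "p \<in> I"
  using ideal_mult[OF assms(1,2), of "Const (1 / c)"] assms(3) by (simp add: mult.assoc[symmetric] Const_mult[symmetric])

text \<open>A homogeneous substitute for the characteristic polynomial: the \<open>D + 1\<close>
  products \<open>y ^ r * L ^ (D - r) * a\<close> lie in a space of dimension at most
  \<open>D\<close>, their linear relation is a binary form in \<open>y\<close> and \<open>L\<close>,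
  and this splits into linear factors. The power of \<open>L\<close> among them is
  cancelled.\<close>

lemma killing_form:
  fixes I :: "('v::finite) mpoly set"
  assumes I: "homogeneous_ideal I" and L: "L \<in> homogeneous_part 1" "regular_mod L I" and P: "primary_mod (adjoin L I)"
    and y: "y \<in> homogeneous_part 1" and a: "a \<in> homogeneous_part m"
  obtains \<gamma>s where "(\<Prod>\<gamma>\<leftarrow>\<gamma>s. y - Const \<gamma> * L) * a \<in> I"
proof -
  note Ii = homogeneous_idealD[OF I]
  obtain M where M: "finite M" "\<And>m p. p \<in> homogeneous_part m \<Longrightarrow>
    \<exists>c. p - (\<Sum>a\<in>M. Const (c a) * (L ^ (m - monom_degree a) * Poly_Mapping.single a 1)) \<in> I"
    using graded_quotient_span[OF I L(1) P] by blast
  define D where "D = card M"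
  have "y ^ r * L ^ (D - r) * a \<in> homogeneous_part (D + m)" if "r \<in> {..D}" for r
  proof -
    have "y ^ r * L ^ (D - r) * a \<in> homogeneous_part (r * 1 + (D - r) * 1 + m)"
      by (intro homogeneous_part_mult[OF homogeneous_part_mult[OF homogeneous_part_power[OF y] homogeneous_part_power[OF L(1)]] a])
    then show ?thesis using that by simp
  qed
  then have "\<forall>r\<in>{..D}. \<exists>c. y ^ r * L ^ (D - r) * a - (\<Sum>b\<in>M. Const (c b) * (L ^ (D + m - monom_degree b) * Poly_Mapping.single b 1)) \<in> I"
    using M(2) by blast
  from bchoice[OF this] obtain c where
    c: "\<forall>r\<in>{..D}. y ^ r * L ^ (D - r) * a - (\<Sum>b\<in>M. Const (c r b) * (L ^ (D + m - monom_degree b) * Poly_Mapping.single b 1)) \<in> I" ..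
  have cD: "card M < card {..D}" by (simp add: D_def)
  obtain x where x: "\<exists>r\<in>{..D}. x r \<noteq> 0" "(\<Sum>r\<in>{..D}. Const (x r) * (y ^ r * L ^ (D - r) * a)) \<in> I"
    by (rule dependent_mod_ideal[OF Ii M(1) finite_atMost cD c[rule_format]])
  define P where "P = (\<Sum>r\<le>D. monom (x r) r)"
  have cP: "coeff P i = x i" if "i \<le> D" for i
    using that by (simp add: P_def coeff_sum)
  then have P0: "P \<noteq> 0" using x(1) by auto
  have dP: "degree P \<le> D"
    unfolding P_def by (intro degree_sum_le) (auto intro: order.trans[OF degree_monom_le])
  have "binary_form P D y L * a = (\<Sum>r\<in>{..D}. Const (x r) * (y ^ r * L ^ (D - r) * a))"
    unfolding binary_form_def sum_distrib_right by (intro sum.cong) (auto simp: cP mult.assoc)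
  then have B: "binary_form P D y L * a \<in> I" using x(2) by simp
  obtain b \<gamma>s where b: "b \<noteq> 0"
    "\<And>y z :: 'v mpoly. binary_form P D y z = Const b * (z ^ (D - length \<gamma>s) * (\<Prod>\<gamma>\<leftarrow>\<gamma>s. y - Const \<gamma> * z))"
    using binary_form_factor[where 'v = 'v, OF P0 dP] by blast
  have "Const b * (L ^ (D - length \<gamma>s) * ((\<Prod>\<gamma>\<leftarrow>\<gamma>s. y - Const \<gamma> * L) * a)) \<in> I"
    using B unfolding b(2) by (simp add: mult.assoc)
  then have "(\<Prod>\<gamma>\<leftarrow>\<gamma>s. y - Const \<gamma> * L) * a \<in> I"
    using ideal_Const_cancel[OF Ii _ b(1)] regular_mod_powerD[OF L(2)] by blast
  then show thesis by (rule that)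
qed

lemma homogeneous_part_prod_list:
  "(\<And>p. p \<in> set ps \<Longrightarrow> p \<in> homogeneous_part 1) \<Longrightarrow> prod_list ps \<in> homogeneous_part (length ps)"
proof (induction ps)
  case (Cons p ps)
  then show ?case using homogeneous_part_mult[of p 1 "prod_list ps" "length ps"] by simp
qed (simp add: homogeneous_part_1)

text \<open>The last nonzero partial product is an eigenvector.\<close>

lemma eigen_step:
  fixes I :: "('v::finite) mpoly set"
  assumes "(\<Prod>\<gamma>\<leftarrow>\<gamma>s. y - Const \<gamma> * L) * w \<in> I" "w \<notin> I"
  shows "\<exists>\<gamma>s' \<gamma>. (\<Prod>\<gamma>\<leftarrow>\<gamma>s'. y - Const \<gamma> * L) * w \<notin> I \<and> (y - Const \<gamma> * L) * ((\<Prod>\<gamma>\<leftarrow>\<gamma>s'. y - Const \<gamma> * L) * w) \<in> I"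
  using assms
proof (induction \<gamma>s)
  case (Cons \<gamma> \<gamma>s)
  show ?case
  proof (cases "(\<Prod>\<gamma>\<leftarrow>\<gamma>s. y - Const \<gamma> * L) * w \<in> I")
    case True
    then show ?thesis using Cons by blast
  next
    case False
    moreover have "(y - Const \<gamma> * L) * ((\<Prod>\<gamma>\<leftarrow>\<gamma>s. y - Const \<gamma> * L) * w) \<in> I"
      using Cons.prems(1) by (simp add: mult.assoc)
    ultimately show ?thesis by blast
  qed
qed simp

text \<open>Multiplications commute, so the eigenvector equations obtained for earlier variables
  survive when the element is multiplied further. Eigenvalues are taken relative to
  \<open>L\<close>, which keeps the equations homogeneous.\<close>

lemma common_eigenvector:
  fixes I :: "('v::finite) mpoly set"
  assumes I: "homogeneous_ideal I" and L: "L \<in> homogeneous_part 1" "regular_mod L I" and P: "primary_mod (adjoin L I)"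
    and w: "w \<in> homogeneous_part m" "w \<notin> I"
  obtains u q where "u * w \<notin> I" "\<And>v. (Var v - Const (q $ v) * L) * (u * w) \<in> I"
proof -
  note Ii = homogeneous_idealD[OF I]
  have "\<exists>u e q. u \<in> homogeneous_part e \<and> u * w \<notin> I \<and> (\<forall>v\<in>A. (Var v - Const (q v) * L) * (u * w) \<in> I)" if "finite A" for A
    using that
  proof (induction A rule: finite_induct)
    case empty
    show ?case using w homogeneous_part_1 by (intro exI[of _ 1] exI[of _ 0]) auto
  next
    case (insert v A)
    then obtain u e q where u: "u \<in> homogeneous_part e" "u * w \<notin> I" "\<forall>v\<in>A. (Var v - Const (q v) * L) * (u * w) \<in> I" by blast
    obtain \<gamma>s where "(\<Prod>\<gamma>\<leftarrow>\<gamma>s. Var v - Const \<gamma> * L) * (u * w) \<in> I"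
      using killing_form[OF I L P Var_hom homogeneous_part_mult[OF u(1) w(1)]] by blast
    from eigen_step[OF this u(2)] obtain \<gamma>s' \<gamma> where
      g: "(\<Prod>\<gamma>\<leftarrow>\<gamma>s'. Var v - Const \<gamma> * L) * (u * w) \<notin> I" "(Var v - Const \<gamma> * L) * ((\<Prod>\<gamma>\<leftarrow>\<gamma>s'. Var v - Const \<gamma> * L) * (u * w)) \<in> I"
      by blast
    let ?p = "\<Prod>\<gamma>\<leftarrow>\<gamma>s'. Var v - Const \<gamma> * L"
    have lin: "Var v - Const \<gamma> * L \<in> homogeneous_part 1" for \<gamma>
      by (rule homogeneous_part_diff[OF Var_hom homogeneous_part_Const_mult[OF L(1)]])
    have "?p \<in> homogeneous_part (length \<gamma>s')"
      using homogeneous_part_prod_list[of "map (\<lambda>\<gamma>. Var v - Const \<gamma> * L) \<gamma>s'"] lin by auto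
    from homogeneous_part_mult[OF this u(1)] have 1: "?p * u \<in> homogeneous_part (length \<gamma>s' + e)" .
    have 2: "(Var v' - Const ((q(v := \<gamma>)) v') * L) * (?p * u * w) \<in> I" if "v' \<in> insert v A" for v'
    proof (cases "v' = v")
      case True
      then show ?thesis using g(2) by (simp add: mult.assoc)
    next
      case False
      then have "(Var v' - Const (q v') * L) * (u * w) \<in> I" using u(3) that by simp
      from ideal_mult[OF Ii this, of ?p] show ?thesis using False by (simp add: mult_ac)
    qed
    have 3: "?p * u * w \<notin> I" using g(1) by (simp add: mult.assoc)
    show ?case using 1 2 3 by blast
  qed
  from this[of UNIV] obtain u q where "u * w \<notin> I" "\<And>v. (Var v - Const (q v) * L) * (u * w) \<in> I" by auto
  then show thesis using that[of u "\<chi> v. q v"] by simp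
qed

lemma insertion_point:
  assumes h: "h \<in> homogeneous_part e"
  shows "insertion Const (\<lambda>v. Const (q $ v) * L) h = Const (poly_eval h q) * L ^ e"
proof -
  have "insertion Const (\<lambda>v. Const (q $ v) * L) h = (\<Sum>a\<in>Poly_Mapping.keys h.
      Const (Poly_Mapping.lookup h a * (\<Prod>v\<in>UNIV. (q $ v) ^ Poly_Mapping.lookup a v)) * L ^ e)"
    unfolding insertion_def
  proof (rule sum.cong[OF refl])
    fix a assume "a \<in> Poly_Mapping.keys h"
    then have "e = (\<Sum>v\<in>UNIV. Poly_Mapping.lookup a v)" using h by (auto simp: homogeneous_part_def monom_degree_def)
    then show "Const (Poly_Mapping.lookup h a) * (\<Prod>v\<in>UNIV. (Const (q $ v) * L) ^ Poly_Mapping.lookup a v) =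
      Const (Poly_Mapping.lookup h a * (\<Prod>v\<in>UNIV. (q $ v) ^ Poly_Mapping.lookup a v)) * L ^ e"
      by (simp add: power_mult_distrib prod.distrib Const_mult Const_prod Const_power power_sum mult.assoc)
  qed
  then show ?thesis by (simp add: poly_eval_def Const_sum sum_distrib_right)
qed

text \<open>Each variable acts on \<open>w\<close> as \<open>q $ v\<close> times \<open>L\<close>,
  so a form of degree \<open>e\<close> acts as its value at \<open>q\<close> times
  \<open>L ^ e\<close>.\<close>

lemma eigenvector_eval:
  assumes I: "is_ideal I" and w: "\<And>v. (Var v - Const (q $ v) * L) * w \<in> I" and h: "h \<in> homogeneous_part e"
  shows "h * w - Const (poly_eval h q) * (L ^ e * w) \<in> I"
proof -
  have "h - insertion Const (\<lambda>v. Const (q $ v) * L) h \<in> colon I w"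
    by (rule insertion_cong_mod_ideal[OF is_ideal_colon[OF I]]) (simp add: colon_def w)
  then show ?thesis unfolding insertion_point[OF h] colon_def by (simp add: left_diff_distrib mult.assoc)
qed

lemma eigenvector_annihilator:
  assumes I: "is_ideal I" and L: "regular_mod L I" and w: "\<And>v. (Var v - Const (q $ v) * L) * w \<in> I" "w \<notin> I"
    and h: "h \<in> homogeneous_part e" "h * w \<in> I"
  shows "poly_eval h q = 0"
proof (rule ccontr)
  assume n: "poly_eval h q \<noteq> 0"
  have "Const (poly_eval h q) * (L ^ e * w) \<in> I"
    using ideal_diff[OF I h(2) eigenvector_eval[OF I w(1) h(1)]] by simp
  then show False using ideal_Const_cancel[OF I _ n] regular_mod_powerD[OF L] w(2) by blast
qed

section \<open>Singular points\<close>

lemma poly_eval_scale: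
  assumes "h \<in> homogeneous_part e" shows "poly_eval h (c *s x) = c ^ e * poly_eval h x"
  unfolding poly_eval_def sum_distrib_left
proof (rule sum.cong[OF refl])
  fix a assume "a \<in> Poly_Mapping.keys h"
  then have "e = (\<Sum>v\<in>UNIV. Poly_Mapping.lookup a v)" using assms by (auto simp: homogeneous_part_def monom_degree_def)
  then show "Poly_Mapping.lookup h a * (\<Prod>v\<in>UNIV. ((c *s x) $ v) ^ Poly_Mapping.lookup a v) =
      c ^ e * (Poly_Mapping.lookup h a * (\<Prod>v\<in>UNIV. (x $ v) ^ Poly_Mapping.lookup a v))"
    by (simp add: power_mult_distrib prod.distrib power_sum)
qed

lemma euler_vanishing:
  assumes f: "f \<in> homogeneous_part N" "N > 0" and z: "\<And>v. poly_eval (poly_partial v f) x = 0"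
  shows "poly_eval f x = 0"
proof -
  have "poly_eval (of_nat N * f) x = 0"
    unfolding euler_formula[OF f(1), symmetric] by (simp add: poly_eval_sum poly_eval_mult z)
  then show ?thesis using f(2) poly_eval_Const[of "of_nat N" x] by (simp add: poly_eval_mult Const_def)
qed

section \<open>Homogeneous coordinates of singular points\<close>

definition proj_point :: "complex ^ ('v::finite) \<Rightarrow> (complex ^ 'v) set" where
  "proj_point x = {y. \<exists>c. c \<noteq> 0 \<and> y = c *s x}"

lemma proj_space_eq: "proj_space = proj_point ` (- {0})"
  by (auto simp: proj_space_def proj_point_def quotient_def)

lemma proj_point_self: "x \<in> proj_point x"
  by (auto simp: proj_point_def intro!: exI[of _ 1])

lemma proj_point_eqI:
  assumes "y \<in> proj_point x" shows "proj_point y = proj_point x"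
proof -
  obtain c where c: "c \<noteq> 0" "y = c *s x" using assms by (auto simp: proj_point_def)
  show ?thesis
  proof (intro set_eqI iffI)
    fix z assume "z \<in> proj_point y"
    then obtain d where "d \<noteq> 0" "z = d *s y" by (auto simp: proj_point_def)
    then have "d * c \<noteq> 0" "z = (d * c) *s x" using c by (auto simp: vec_eq_iff)
    then show "z \<in> proj_point x" unfolding proj_point_def by blast
  next
    fix z assume "z \<in> proj_point x"
    then obtain d where "d \<noteq> 0" "z = d *s x" by (auto simp: proj_point_def)
    then have "d / c \<noteq> 0" "z = (d / c) *s y" using c by (auto simp: vec_eq_iff)
    then show "z \<in> proj_point y" unfolding proj_point_def by blast
  qed
qed

lemma proj_spaceD: "P \<in> proj_space \<Longrightarrow> x \<in> P \<Longrightarrow> P = proj_point x \<and> x \<noteq> 0"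
proof -
  assume "P \<in> proj_space" "x \<in> P"
  then obtain y where y: "y \<noteq> 0" "P = proj_point y" by (auto simp: proj_space_eq)
  then show ?thesis using \<open>x \<in> P\<close> proj_point_eqI[of x y] by (auto simp: proj_point_def vec_eq_iff)
qed

lemma singular_points_iff:
  assumes f: "f \<in> homogeneous_part N" "N > 0" and x: "x \<noteq> 0"
  shows "proj_point x \<in> singular_points f \<longleftrightarrow> (\<forall>v. poly_eval (poly_partial v f) x = 0)"
proof
  assume "proj_point x \<in> singular_points f"
  then show "\<forall>v. poly_eval (poly_partial v f) x = 0" using proj_point_self by (auto simp: singular_points_def)
next
  assume z: "\<forall>v. poly_eval (poly_partial v f) x = 0"
  have "poly_eval (poly_partial v f) y = 0" if "y \<in> proj_point x" for y v
    using that z by (auto simp: proj_point_def poly_eval_scale[OF poly_partial_hom[OF f(1)]])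
  then show "proj_point x \<in> singular_points f"
    using euler_vanishing[OF f] x by (auto simp: singular_points_def hypersurface_def proj_space_eq)
qed

text \<open>Separates local from remote factors: at a point where \<open>y\<close> vanishes but
  \<open>L\<close> does not, exactly the factors with \<open>\<gamma> \<noteq> 0\<close> are
  nonzero.\<close>

lemma prod_list_split_zeros:
  "(\<Prod>\<gamma>\<leftarrow>\<gamma>s. y - Const \<gamma> * L) = y ^ count_list \<gamma>s 0 * (\<Prod>\<gamma>\<leftarrow>filter (\<lambda>\<gamma>. \<gamma> \<noteq> 0) \<gamma>s. y - Const \<gamma> * L)"
  by (induction \<gamma>s) (auto simp: mult_ac)

text \<open>If \<open>c * a\<close> were not in \<open>I\<close>, the module generated by it would contain a common eigenvector of the
  multiplications by the coordinates, whose eigenvalues form a singular point; but there \<open>c\<close> is locally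
  in the Jacobian ideal, which annihilates \<open>a\<close>.\<close>

theorem local_to_global:
  fixes f :: "('n::finite) option mpoly"
  assumes f: "f \<in> homogeneous_part N" "N > 0"
    and I: "homogeneous_ideal I" and L: "L = linear_form l" "regular_mod L I" and P: "primary_mod (adjoin L I)"
    and a: "a \<in> homogeneous_part m" "\<And>v. poly_partial v f * a \<in> I" and c: "c \<in> homogeneous_part k"
    and loc: "\<And>S. S \<in> singular_points f \<Longrightarrow> \<exists>(x :: complex ^ 'n option) j. x \<in> S \<and> x $ j = 1 \<and>
      germ (\<lambda>y. poly_eval c (chart x j y)) \<in> tjurina_ideal (\<lambda>y. poly_eval f (chart x j y))"
  shows "c * a \<in> I"
proof (rule ccontr)
  assume na: "c * a \<notin> I"
  note Ii = homogeneous_idealD[OF I]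
  have L1: "L \<in> homogeneous_part 1" unfolding L by (rule linear_form_hom)
  obtain u q where u: "u * (c * a) \<notin> I" "\<And>v. (Var v - Const (q $ v) * L) * (u * (c * a)) \<in> I"
    using common_eigenvector[OF I L1 L(2) P homogeneous_part_mult[OF c a(1)] na] by blast
  let ?w = "u * (c * a)"
  note ann = eigenvector_annihilator[OF Ii L(2) u(2,1)]
  \<comment> \<open>\<open>L\<close> acts on the eigenvector both as itself and as its value at
    \<open>q\<close> times \<open>L\<close>, and \<open>L\<close> is regular.\<close>
  have Lq: "poly_eval L q = 1"
  proof (rule ccontr)
    assume n: "poly_eval L q \<noteq> 1"
    have "L * ?w - Const (poly_eval L q) * (L ^ 1 * ?w) \<in> I"
      by (rule eigenvector_eval[OF Ii u(2) L1])
    also have "L * ?w - Const (poly_eval L q) * (L ^ 1 * ?w) = Const (1 - poly_eval L q) * (L * ?w)"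
      by (simp add: Const_diff left_diff_distrib)
    finally have "L * ?w \<in> I" using ideal_Const_cancel[OF Ii] n by simp
    then show False using L(2) u(1) by (auto simp: regular_mod_def)
  qed
  have q0: "q \<noteq> 0"
  proof
    assume "q = 0"
    then have "poly_eval L q = 0"
      by (simp add: L(1) linear_form_def poly_eval_sum poly_eval_mult poly_eval_Const poly_eval_Var)
    then show False using Lq by simp
  qed
  have "poly_eval (poly_partial v f) q = 0" for v
  proof (rule ann[OF poly_partial_hom[OF f(1)]])
    have "(u * c) * (poly_partial v f * a) \<in> I" by (rule ideal_mult[OF Ii a(2)])
    then show "poly_partial v f * ?w \<in> I" by (simp add: mult_ac)
  qed
  then have "proj_point q \<in> singular_points f" using singular_points_iff[OF f q0] by blast
  from loc[OF this] obtain x :: "complex ^ 'n option" and j where x: "x \<in> proj_point q" "x $ j = 1"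
    and germ: "germ (\<lambda>y. poly_eval c (chart x j y)) \<in> tjurina_ideal (\<lambda>y. poly_eval f (chart x j y))" by blast
  obtain s where s: "s \<noteq> 0" "x = s *s q" using x(1) by (auto simp: proj_point_def)
  have sj: "s * q $ j = 1" using x(2) s(2) by simp
  define Y where "Y v = Var v - Const (x $ v) * Var j" for v
  have Y: "Y v \<in> homogeneous_part 1" for v
    unfolding Y_def by (intro homogeneous_part_diff homogeneous_part_Const_mult Var_hom)
  have Yq: "poly_eval (Y v) q = 0" for v
  proof -
    have "poly_eval (Y v) q = q $ v - (s * q $ j) * q $ v"
      by (simp add: Y_def s(2) poly_eval_diff poly_eval_mult poly_eval_Const poly_eval_Var)
    then show ?thesis by (simp add: sj)
  qed
  have "\<exists>\<gamma>s. (\<Prod>\<gamma>\<leftarrow>\<gamma>s. Y v - Const \<gamma> * L) * a \<in> I" for v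
    using killing_form[OF I L1 L(2) P Y a(1)] by blast
  then obtain \<gamma>s where \<gamma>s: "\<And>v. (\<Prod>\<gamma>\<leftarrow>\<gamma>s v. Y v - Const \<gamma> * L) * a \<in> I" by metis
  \<comment> \<open>The factors collected in \<open>U v\<close> do not vanish at \<open>q\<close>;
    up to them \<open>a\<close> is killed by \<open>Y v ^ K v\<close>.\<close>
  define K where "K v = count_list (\<gamma>s v) 0" for v
  define U where "U v = (\<Prod>\<gamma>\<leftarrow>filter (\<lambda>\<gamma>. \<gamma> \<noteq> 0) (\<gamma>s v). Y v - Const \<gamma> * L)" for v
  have KU: "Y v ^ K v * U v * a \<in> I" for v
    using \<gamma>s[of v] prod_list_split_zeros[where y = "Y v" and L = L and \<gamma>s = "\<gamma>s v"]
    unfolding K_def U_def by (simp only:)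
  have "\<exists>e. U v \<in> homogeneous_part e" for v
  proof -
    have "p \<in> homogeneous_part 1" if p: "p \<in> set (map (\<lambda>\<gamma>. Y v - Const \<gamma> * L) \<gamma>l)" for p \<gamma>l
    proof -
      obtain \<gamma> where "p = Y v - Const \<gamma> * L" using p by auto
      then show ?thesis using homogeneous_part_diff[OF Y homogeneous_part_Const_mult[OF L1]] by simp
    qed
    then show ?thesis unfolding U_def by (intro exI) (rule homogeneous_part_prod_list)
  qed
  then obtain eU where eU: "\<And>v. U v \<in> homogeneous_part (eU v)" by metis
  have Uq: "poly_eval (U v) q \<noteq> 0" for v
  proof -
    have "poly_eval (\<Prod>\<gamma>\<leftarrow>\<gamma>l. Y v - Const \<gamma> * L) q = (\<Prod>\<gamma>\<leftarrow>\<gamma>l. - \<gamma>)" for \<gamma>l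
      by (induction \<gamma>l) (simp_all add: poly_eval_1 poly_eval_mult poly_eval_diff poly_eval_Const Yq Lq)
    then show ?thesis by (auto simp: U_def prod_list_zero_iff)
  qed
  let ?A = "UNIV - {j}"
  define UU where "UU = (\<Prod>v\<in>?A. U v)"
  have UU: "UU \<in> homogeneous_part (\<Sum>v\<in>?A. eU v)"
    unfolding UU_def by (rule homogeneous_part_prod) (auto intro: eU)
  have UUq: "poly_eval UU q \<noteq> 0" using Uq by (simp add: UU_def poly_eval_prod)
  have "\<exists>e. Var j ^ e * c \<in> colon I (UU * a)"
  \<comment> \<open>The order \<open>r\<close> comes from the pigeonhole principle: if the exponents
    add up to more than the sum of the \<open>K v\<close>, some exponent is at least
    \<open>K v\<close>.\<close>
  proof (rule tjurina_ideal_membership[OF f x(2) c germ is_ideal_colon[OF Ii], where r = "Suc (\<Sum>v\<in>?A. K v)"])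
    fix v
    have "UU * (poly_partial v f * a) \<in> I" by (rule ideal_mult[OF Ii a(2)])
    then show "poly_partial v f \<in> colon I (UU * a)" by (simp add: colon_def mult_ac)
  next
    fix \<alpha> :: "'n option \<Rightarrow> nat" assume \<alpha>: "Suc (\<Sum>v\<in>?A. K v) \<le> (\<Sum>v\<in>?A. \<alpha> v)"
    have "\<exists>v\<in>?A. K v \<le> \<alpha> v"
    proof (rule ccontr)
      assume "\<not> (\<exists>v\<in>?A. K v \<le> \<alpha> v)"
      then have "(\<Sum>v\<in>?A. \<alpha> v) \<le> (\<Sum>v\<in>?A. K v)" by (intro sum_mono) (auto simp: not_le less_imp_le)
      then show False using \<alpha> by simp
    qed
    then obtain v where v: "v \<in> ?A" "K v \<le> \<alpha> v" by blast
    have "(Y v ^ (\<alpha> v - K v) * (\<Prod>u\<in>?A - {v}. Y u ^ \<alpha> u) * (\<Prod>u\<in>?A - {v}. U u)) * (Y v ^ K v * U v * a) \<in> I"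
      by (rule ideal_mult[OF Ii KU])
    also have "(Y v ^ (\<alpha> v - K v) * (\<Prod>u\<in>?A - {v}. Y u ^ \<alpha> u) * (\<Prod>u\<in>?A - {v}. U u)) * (Y v ^ K v * U v * a) =
      ((Y v ^ (\<alpha> v - K v) * Y v ^ K v) * (\<Prod>u\<in>?A - {v}. Y u ^ \<alpha> u)) * ((U v * (\<Prod>u\<in>?A - {v}. U u)) * a)"
      by (simp add: mult_ac)
    also have "Y v ^ (\<alpha> v - K v) * Y v ^ K v = Y v ^ \<alpha> v" using v(2) by (simp flip: power_add)
    also have "U v * (\<Prod>u\<in>?A - {v}. U u) = UU"
      unfolding UU_def by (rule prod.remove[symmetric]) (use v in auto)
    also have "Y v ^ \<alpha> v * (\<Prod>u\<in>?A - {v}. Y u ^ \<alpha> u) = (\<Prod>u\<in>?A. Y u ^ \<alpha> u)"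
      by (rule prod.remove[symmetric]) (use v in auto)
    finally show "(\<Prod>u\<in>?A. (Var u - Const (x $ u) * Var j) ^ \<alpha> u) \<in> colon I (UU * a)"
      by (simp add: colon_def Y_def)
  qed
  then obtain e where e: "Var j ^ e * c * (UU * a) \<in> I" by (auto simp: colon_def)
  \<comment> \<open>A form that annihilates the eigenvector must vanish at \<open>q\<close>, but
    neither \<open>x\<^sub>j\<close> nor \<open>UU\<close> does.\<close>
  have "u * (Var j ^ e * c * (UU * a)) \<in> I" by (rule ideal_mult[OF Ii e])
  then have "Var j ^ e * UU * ?w \<in> I" by (simp add: mult_ac)
  then have "poly_eval (Var j ^ e * UU) q = 0"
    by (rule ann[OF homogeneous_part_mult[OF homogeneous_part_power[OF Var_hom] UU]])
  moreover have "q $ j \<noteq> 0" using sj by auto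
  ultimately show False using UUq by (simp add: poly_eval_mult poly_eval_power poly_eval_Var)
qed

section \<open>Finiteness of the singular locus\<close>

lemma continuous_on_poly_eval: "continuous_on S (poly_eval p)"
  unfolding poly_eval_def by (intro continuous_intros)

text \<open>The unit vectors over singular points form a compact set, covered by the cones over the
  isolating neighbourhoods. Each cone meets the cone over the singular locus in one point of
  projective space, so a finite subcover bounds their number.\<close>

lemma finite_singular_points:
  fixes f :: "('v::finite) mpoly"
  assumes f: "f \<in> homogeneous_part N" "N > 0" and iso: "only_isolated_singularities f"
  shows "finite (singular_points f)"
proof -
  define K where "K = sphere 0 1 \<inter> (\<Inter>v. {x. poly_eval (poly_partial v f) x = 0})"
  have "closed (\<Inter>v. {x. poly_eval (poly_partial v f) x = 0})"
    by (intro closed_INT ballI closed_Collect_eq continuous_on_poly_eval continuous_on_const)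
  then have K: "compact K" unfolding K_def by (intro compact_Int_closed compact_sphere)
  have mem: "proj_point x \<in> singular_points f" if "x \<in> K" for x
  proof -
    have "norm x = 1" using that by (simp add: K_def)
    then have "x \<noteq> 0" by auto
    then show ?thesis using that singular_points_iff[OF f] by (auto simp: K_def)
  qed
  have rep: "\<exists>x\<in>K. P = proj_point x" if P: "P \<in> singular_points f" for P
  proof -
    have "P \<in> proj_space" using P by (simp add: singular_points_def hypersurface_def)
    then obtain x where x: "x \<noteq> 0" "P = proj_point x" by (auto simp: proj_space_eq)
    define y where "y = (1 / norm x) *\<^sub>R x"
    have y: "y = complex_of_real (1 / norm x) *s x"
      unfolding y_def vec_eq_iff vector_scaleR_component vector_smult_component by (simp add: scaleR_conv_of_real)
    have n: "norm y = 1" using x(1) by (simp add: y_def)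
    have "y \<in> proj_point x" using x(1) by (auto simp: y proj_point_def intro!: exI[of _ "complex_of_real (1 / norm x)"])
    then have Py: "P = proj_point y" using proj_point_eqI x(2) by metis
    have "y \<noteq> 0" using n by auto
    then have "\<forall>v. poly_eval (poly_partial v f) y = 0" using singular_points_iff[OF f] P Py by blast
    then have "y \<in> K" using n by (simp add: K_def)
    then show ?thesis using Py by blast
  qed
  have "\<forall>P\<in>singular_points f. \<exists>U. proj_open U \<and> U \<inter> singular_points f = {P}"
    using iso by (simp add: only_isolated_singularities_def)
  from bchoice[OF this] obtain U where
    U': "\<forall>P\<in>singular_points f. proj_open (U P) \<and> U P \<inter> singular_points f = {P}" ..
  note U = U'[rule_format]
  have "K \<subseteq> (\<Union>P\<in>singular_points f. \<Union>(U P))"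
  proof
    fix x assume "x \<in> K"
    then have "proj_point x \<in> singular_points f" by (rule mem)
    then have "proj_point x \<in> U (proj_point x)" using U by blast
    then show "x \<in> (\<Union>P\<in>singular_points f. \<Union>(U P))" using proj_point_self mem[OF \<open>x \<in> K\<close>] by blast
  qed
  then obtain F where F: "F \<subseteq> singular_points f" "finite F" "K \<subseteq> (\<Union>P\<in>F. \<Union>(U P))"
    using compactE_image[OF K, of "singular_points f" "\<lambda>P. \<Union>(U P)"] U unfolding proj_open_def by metis
  have "singular_points f \<subseteq> F"
  proof
    fix P assume P: "P \<in> singular_points f"
    then obtain x where x: "x \<in> K" "P = proj_point x" using rep by blast
    then obtain P' V where V: "P' \<in> F" "V \<in> U P'" "x \<in> V" using F(3) by blast
    have "V \<in> proj_space" using V U F(1) unfolding proj_open_def by blast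
    then have "V = P" using proj_spaceD V(3) x(2) by blast
    then have "P \<in> U P' \<inter> singular_points f" using V P by blast
    moreover have "U P' \<inter> singular_points f = {P'}"
      using U[OF subsetD[OF F(1) V(1)]] by (rule conjunct2)
    ultimately have "P = P'" by simp
    then show "P \<in> F" using V(1) by simp
  qed
  then show ?thesis using F(2) finite_subset by blast
qed

text \<open>A form that is good for \<open>F\<close> is perturbed by \<open>t\<close> times a
  coordinate that is nonzero at \<open>x\<close>; each point excludes at most one
  \<open>t\<close>.\<close>

lemma avoiding_linear_form:
  fixes F :: "(complex ^ ('v::finite)) set"
  assumes "finite F" "0 \<notin> F"
  shows "\<exists>l. \<forall>x\<in>F. (\<Sum>v\<in>UNIV. l v * x $ v) \<noteq> 0"
  using assms
proof (induction F rule: finite_induct)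
  case (insert x F)
  then obtain l where l: "\<forall>y\<in>F. (\<Sum>v\<in>UNIV. l v * y $ v) \<noteq> 0" by auto
  have "x \<noteq> 0" using insert by auto
  then obtain u where u: "x $ u \<noteq> 0" by (auto simp: vec_eq_iff)
  define ev where "ev y = (\<Sum>v\<in>UNIV. l v * y $ v)" for y :: "complex ^ 'v"
  define bad where "bad y = {t. ev y + t * y $ u = 0}" for y
  have "finite (bad y)" if "ev y \<noteq> 0 \<or> y $ u \<noteq> 0" for y
  proof (rule finite_subset)
    show "bad y \<subseteq> {- ev y / y $ u}"
    proof
      fix t assume "t \<in> bad y"
      then have e: "ev y + t * y $ u = 0" by (simp add: bad_def)
      then have "y $ u \<noteq> 0" using that by auto
      moreover have "t * y $ u = - ev y" using e by (simp add: add_eq_0_iff)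
      ultimately show "t \<in> {- ev y / y $ u}" by (simp add: field_simps)
    qed
  qed simp
  then have "finite (\<Union>y\<in>insert x F. bad y)" using insert.hyps l u by (auto simp: ev_def)
  then obtain t where t: "t \<notin> (\<Union>y\<in>insert x F. bad y)"
    using ex_new_if_finite infinite_UNIV_char_0 by blast
  have "(\<Sum>v\<in>UNIV. (l v + (if v = u then t else 0)) * y $ v) = ev y + t * y $ u" for y :: "complex ^ 'v"
    by (simp add: ev_def distrib_right sum.distrib if_mult)
  then show ?case using t by (intro exI[of _ "\<lambda>v. l v + (if v = u then t else 0)"]) (auto simp: bad_def)
qed simp

section \<open>Tjurina numbers and linear dependence\<close>

text \<open>A finite infimum is attained, so a finite Tjurina number comes with an actual
  basis.\<close>

lemma tjurina_basis:
  assumes "tjurina g = enat \<tau>"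
  obtains B where "quotient_basis scale_germ (tjurina_ideal g) B" "card B = \<tau>"
proof -
  define A where "A = (\<lambda>B. enat (card B)) ` {B. quotient_basis scale_germ (tjurina_ideal g) B}"
  have I: "Inf A = enat \<tau>" using assms by (simp add: tjurina_def quotient_dim_def A_def)
  then have "A \<noteq> {}" by (auto simp: Inf_enat_def)
  then have "Inf A \<in> A" unfolding Inf_enat_def by (auto intro: LeastI)
  then obtain B where "quotient_basis scale_germ (tjurina_ideal g) B" "enat (card B) = enat \<tau>"
    unfolding I by (auto simp: A_def)
  then show thesis using that by simp
qed

lemma germ_chart_linear_combination:
  assumes "finite T"
  shows "germ (\<lambda>y. poly_eval (\<Sum>t\<in>T. Const (x t) * e t) (chart z j y)) =
    (\<Sum>t\<in>T. scale_germ (x t) (germ (\<lambda>y. poly_eval (e t) (chart z j y))))"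
  using assms
  by (simp add: scale_germ_def germ_mult germ_sum poly_eval_sum poly_eval_mult poly_eval_Const
      holomorphic_at_origin_const holomorphic_at_origin_chart holomorphic_at_origin_mult)

lemma scale_germ_sum:
  "finite A \<Longrightarrow> (\<Sum>t\<in>A. scale_germ (c t) b) = scale_germ (\<Sum>t\<in>A. c t) b"
  by (simp add: scale_germ_def sum_distrib_right[symmetric] germ_sum holomorphic_at_origin_const)

lemma scale_germ_scale: "scale_germ c (scale_germ d b) = scale_germ (d * c) b"
  unfolding scale_germ_def mult.assoc[symmetric]
  by (simp only: germ_mult holomorphic_at_origin_const mult.commute[of c d])

lemma scale_germ_0: "scale_germ 0 b = 0"
  by (simp add: scale_germ_def flip: zero_holo_germ_def)

lemma local_equation_chart:
  fixes f :: "('n::finite) option mpoly"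
  assumes "f \<in> homogeneous_part N" "N > 0" "S \<in> singular_points f"
  obtains x :: "complex ^ 'n option" and j where "x \<in> S" "x $ j = 1" "tjurina_at f S = tjurina (\<lambda>y. poly_eval f (chart x j y))"
proof -
  have "S \<in> proj_space" using assms by (simp add: singular_points_def hypersurface_def)
  then obtain q where q: "q \<noteq> 0" "S = proj_point q" by (auto simp: proj_space_eq)
  then obtain j where j: "q $ j \<noteq> 0" by (auto simp: vec_eq_iff)
  have "(1 / q $ j) *s q \<in> S" "((1 / q $ j) *s q) $ j = 1"
    using j q(2) by (auto simp: proj_point_def intro!: exI[of _ "1 / q $ j"])
  then have "\<exists>g. local_equation f S g" unfolding local_equation_def by blast
  then have "local_equation f S (SOME g. local_equation f S g)" by (rule someI_ex)
  then obtain j and x :: "complex ^ 'n option" where "x \<in> S" "x $ j = 1"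
    "(SOME g. local_equation f S g) = (\<lambda>y. poly_eval f (x + hyperplane_embedding j y))"
    unfolding local_equation_def by blast
  then show thesis using that[of x j] by (simp add: tjurina_at_def chart_def)
qed

text \<open>It suffices that the coordinates in a basis of each local algebra vanish. At each point
  these are as many linear conditions on the coefficients as the local Tjurina number,
  \<open>\<tau>\<close> in total, against more than \<open>\<tau>\<close> unknowns.\<close>

theorem locally_jacobian_combination:
  fixes f :: "('n::finite) option mpoly"
  assumes f: "f \<in> homogeneous_part N" "N > 0" and fin: "finite (singular_points f)"
    and \<tau>: "total_tjurina f = enat \<tau>" and T: "finite T" "\<tau> < card T"
  obtains x where "\<exists>t\<in>T. x t \<noteq> 0"
    "\<And>S. S \<in> singular_points f \<Longrightarrow> \<exists>(z :: complex ^ 'n option) j. z \<in> S \<and> z $ j = 1 \<and>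
      germ (\<lambda>y. poly_eval (\<Sum>t\<in>T. Const (x t) * e t) (chart z j y)) \<in> tjurina_ideal (\<lambda>y. poly_eval f (chart z j y))"
proof -
  have "\<exists>k. tjurina_at f S = enat k" if S: "S \<in> singular_points f" for S
  proof -
    have "tjurina_at f S \<le> total_tjurina f"
      unfolding total_tjurina_def using fin S by (intro member_le_sum) auto
    then show ?thesis unfolding \<tau> by (cases "tjurina_at f S") auto
  qed
  then have "\<forall>S\<in>singular_points f. \<exists>k. tjurina_at f S = enat k" by blast
  from bchoice[OF this] obtain k where k': "\<forall>S\<in>singular_points f. tjurina_at f S = enat (k S)" ..
  note k = k'[rule_format]
  have "total_tjurina f = (\<Sum>S\<in>singular_points f. enat (k S))"
    unfolding total_tjurina_def by (intro sum.cong k refl)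
  also have "\<dots> = enat (\<Sum>S\<in>singular_points f. k S)"
    using fin by (induction rule: finite_induct) (auto simp: zero_enat_def)
  finally have sk: "(\<Sum>S\<in>singular_points f. k S) = \<tau>" using \<tau> by simp
  \<comment> \<open>Chart and basis are chosen together, since the Tjurina number at
    \<open>S\<close> refers to the local equation picked by the choice operator in
    \<open>tjurina_at\<close>.\<close>
  have "\<forall>S\<in>singular_points f. \<exists>zjB. case zjB of (z :: complex ^ 'n option, j, B) \<Rightarrow> z \<in> S \<and> z $ j = 1 \<and>
      quotient_basis scale_germ (tjurina_ideal (\<lambda>y. poly_eval f (chart z j y))) B \<and> card B = k S"
  proof
    fix S assume S: "S \<in> singular_points f"
    obtain z :: "complex ^ 'n option" and j where z: "z \<in> S" "z $ j = 1" "tjurina_at f S = tjurina (\<lambda>y. poly_eval f (chart z j y))"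
      by (rule local_equation_chart[OF f S])
    then have "tjurina (\<lambda>y. poly_eval f (chart z j y)) = enat (k S)" using k[OF S] by simp
    then obtain B where "quotient_basis scale_germ (tjurina_ideal (\<lambda>y. poly_eval f (chart z j y))) B" "card B = k S"
      by (rule tjurina_basis)
    then show "\<exists>zjB. case zjB of (z :: complex ^ 'n option, j, B) \<Rightarrow> z \<in> S \<and> z $ j = 1 \<and>
      quotient_basis scale_germ (tjurina_ideal (\<lambda>y. poly_eval f (chart z j y))) B \<and> card B = k S"
      using z by (intro exI[of _ "(z, j, B)"]) simp
  qed
  from bchoice[OF this] obtain zjB where zjB: "\<forall>S\<in>singular_points f. case zjB S of (z :: complex ^ 'n option, j, B) \<Rightarrow> z \<in> S \<and> z $ j = 1 \<and>
      quotient_basis scale_germ (tjurina_ideal (\<lambda>y. poly_eval f (chart z j y))) B \<and> card B = k S" ..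
  define z where "z S = fst (zjB S)" for S
  define j where "j S = fst (snd (zjB S))" for S
  define B where "B S = snd (snd (zjB S))" for S
  define W where "W S = tjurina_ideal (\<lambda>y. poly_eval f (chart (z S) (j S) y))" for S
  define G where "G S t = germ (\<lambda>y. poly_eval (e t) (chart (z S) (j S) y))" for S t
  have z: "z S \<in> S" "z S $ j S = 1" and B: "quotient_basis scale_germ (W S) (B S)" "card (B S) = k S"
    if "S \<in> singular_points f" for S
    using zjB[rule_format, OF that] by (auto simp: z_def j_def B_def W_def split: prod.splits)
  have finB: "finite (B S)" if "S \<in> singular_points f" for S
    using B[OF that] by (simp add: quotient_basis_def)
  have "\<forall>S\<in>singular_points f. \<forall>t. \<exists>c. G S t - (\<Sum>b\<in>B S. scale_germ (c b) b) \<in> W S"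
    using B unfolding quotient_basis_def by blast
  then have "\<forall>S\<in>singular_points f. \<exists>c. \<forall>t. G S t - (\<Sum>b\<in>B S. scale_germ (c t b) b) \<in> W S"
    by (intro ballI choice) (rule bspec)
  from bchoice[OF this] obtain c where
    c': "\<forall>S\<in>singular_points f. \<forall>t. G S t - (\<Sum>b\<in>B S. scale_germ (c S t b) b) \<in> W S" ..
  note c = c'[rule_format]
  define E where "E = Sigma (singular_points f) B"
  have E: "finite E" using fin finB by (simp add: E_def)
  have "card E = (\<Sum>S\<in>singular_points f. card (B S))"
    unfolding E_def using fin finB by (intro card_SigmaI) auto
  also have "\<dots> = \<tau>" using sk B(2) by simp
  finally have cE: "card E < card T" using T by simp
  obtain x where x: "\<exists>t\<in>T. x t \<noteq> 0" "\<forall>p\<in>E. (\<Sum>t\<in>T. c (fst p) t (snd p) * x t) = 0"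
    using underdetermined_system[OF E T(1) cE, of "\<lambda>p t. c (fst p) t (snd p)"] by blast
  show thesis
  proof (rule that[OF x(1)])
    fix S assume S: "S \<in> singular_points f"
    have Wi: "is_ideal (W S)" unfolding W_def by (rule is_ideal_tjurina_ideal)
    have "(\<Sum>t\<in>T. scale_germ (x t) (G S t - (\<Sum>b\<in>B S. scale_germ (c S t b) b))) \<in> W S"
      unfolding scale_germ_def[of "x _"] by (intro ideal_sum[OF Wi] ideal_mult[OF Wi] c S)
    also have "(\<Sum>t\<in>T. scale_germ (x t) (G S t - (\<Sum>b\<in>B S. scale_germ (c S t b) b))) =
      (\<Sum>t\<in>T. scale_germ (x t) (G S t)) - (\<Sum>t\<in>T. \<Sum>b\<in>B S. scale_germ (c S t b * x t) b)"
      unfolding scale_germ_scale[symmetric] unfolding scale_germ_def[of "x _"]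
      by (simp add: right_diff_distrib sum_subtractf sum_distrib_left)
    also have "(\<Sum>t\<in>T. \<Sum>b\<in>B S. scale_germ (c S t b * x t) b) = (\<Sum>b\<in>B S. scale_germ (\<Sum>t\<in>T. c S t b * x t) b)"
      by (subst sum.swap) (simp add: scale_germ_sum[OF T(1)])
    also have "\<dots> = 0"
    proof (rule sum.neutral, rule ballI)
      fix b assume "b \<in> B S"
      then have "(S, b) \<in> E" using S by (simp add: E_def)
      then have "(\<Sum>t\<in>T. c S t b * x t) = 0" using x(2) by fastforce
      then show "scale_germ (\<Sum>t\<in>T. c S t b * x t) b = 0" by (simp only: scale_germ_0)
    qed
    finally have "(\<Sum>t\<in>T. scale_germ (x t) (G S t)) \<in> W S" by simp
    then show "\<exists>(z :: complex ^ 'n option) j. z \<in> S \<and> z $ j = 1 \<and>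
      germ (\<lambda>y. poly_eval (\<Sum>t\<in>T. Const (x t) * e t) (chart z j y)) \<in> tjurina_ideal (\<lambda>y. poly_eval f (chart z j y))"
      using z[OF S] germ_chart_linear_combination[OF T(1), of x e "z S" "j S"]
      by (intro exI[of _ "z S"] exI[of _ "j S"]) (simp add: G_def W_def)
  qed
qed

section \<open>Essential relations\<close>

text \<open>Euler's formula, divided by the degree.\<close>

lemma homogeneous_part_Suc_sum_Var:
  assumes "p \<in> homogeneous_part (Suc k)"
  obtains q where "\<And>v. q v \<in> homogeneous_part k" "p = (\<Sum>v\<in>UNIV. Var v * q v)"
proof
  define N where "N = Suc k"
  let ?q = "\<lambda>v. Const (1 / of_nat N) * poly_partial v p"
  show "?q v \<in> homogeneous_part k" for v
    using poly_partial_hom[OF assms, of v] by (intro homogeneous_part_Const_mult) simp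
  have "(\<Sum>v\<in>UNIV. Var v * ?q v) = Const (1 / of_nat N) * (\<Sum>v\<in>UNIV. Var v * poly_partial v p)"
    by (simp add: sum_distrib_left mult_ac)
  also have "\<dots> = Const (1 / of_nat N) * (Const (of_nat N) * p)"
    unfolding euler_formula[OF assms] by (simp add: N_def Const_def del: of_nat_Suc)
  also have "\<dots> = p" by (simp add: mult.assoc[symmetric] Const_mult[symmetric] N_def del: of_nat_Suc)
  finally show "p = (\<Sum>v\<in>UNIV. Var v * ?q v)" by simp
qed

text \<open>By \<open>dep\<close> the space \<open>S\<^sub>\<tau>/Q\<^sub>\<tau>\<close> has dimension at most \<open>\<tau>\<close>. If multiplication by \<open>L\<close> were not onto
  in any degree below \<open>\<tau>\<close>, elements outside its images would yield \<open>\<tau> + 1\<close> independent ones in degree \<open>\<tau>\<close>.\<close>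

lemma multiplication_stabilizes:
  fixes Q :: "('v::finite) mpoly set"
  assumes Q: "is_ideal Q" "1 \<notin> Q" and L: "L \<in> homogeneous_part 1" "regular_mod L Q"
    and dep: "\<And>e. (\<And>t. t \<le> \<tau> \<Longrightarrow> e t \<in> homogeneous_part \<tau>) \<Longrightarrow>
      \<exists>x. (\<exists>t\<le>\<tau>. x t \<noteq> 0) \<and> (\<Sum>t\<le>\<tau>. Const (x t) * e t) \<in> Q"
    and k: "\<tau> \<le> k" and h: "h \<in> homogeneous_part k"
  shows "k > 0 \<and> h \<in> adjoin L Q"
proof -
  \<comment> \<open>Note the shift: \<open>onto k\<close> speaks of the target degree
    \<open>Suc k\<close>.\<close>
  define onto where "onto k \<longleftrightarrow> (\<forall>h\<in>homogeneous_part (Suc k). h \<in> adjoin L Q)" for k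
  note Ai = is_ideal_adjoin[OF Q(1), of L]
  have step: "onto (Suc k)" if "onto k" for k
    unfolding onto_def
  proof
    fix h :: "'v mpoly" assume "h \<in> homogeneous_part (Suc (Suc k))"
    then obtain q where q: "\<And>v. q v \<in> homogeneous_part (Suc k)" "h = (\<Sum>v\<in>UNIV. Var v * q v)"
      by (rule homogeneous_part_Suc_sum_Var) blast
    have "q v \<in> adjoin L Q" for v using that q(1) by (simp add: onto_def)
    then show "h \<in> adjoin L Q" unfolding q(2) by (intro ideal_sum[OF Ai] ideal_mult[OF Ai])
  qed
  have ex: "\<exists>k<\<tau>. onto k"
  proof (rule ccontr)
    assume no: "\<not> (\<exists>k<\<tau>. onto k)"
    \<comment> \<open>\<open>e 0 = 1\<close> and, for \<open>0 < t \<le> \<tau>\<close>, a form of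
      degree \<open>t\<close> outside the image of \<open>L\<close>. Multiplied by powers of
      \<open>L\<close> they become \<open>\<tau> + 1\<close> elements of degree
      \<open>\<tau>\<close>.\<close>
    have "\<forall>t. \<exists>e. e \<in> homogeneous_part t \<and> (t \<le> \<tau> \<longrightarrow> (if t = 0 then e = 1 else e \<notin> adjoin L Q))"
    proof
      fix t show "\<exists>e. e \<in> homogeneous_part t \<and> (t \<le> \<tau> \<longrightarrow> (if t = 0 then e = (1 :: 'v mpoly) else e \<notin> adjoin L Q))"
      proof (cases t)
        case 0
        then show ?thesis using homogeneous_part_1 by auto
      next
        case (Suc k)
        show ?thesis
        proof (cases "t \<le> \<tau>")
          case True
          then have "\<not> onto k" using no Suc by simp
          then show ?thesis using Suc by (auto simp: onto_def)
        next
          case False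
          then show ?thesis using homogeneous_part_0 by blast
        qed
      qed
    qed
    then obtain e where e: "\<And>t. e t \<in> homogeneous_part t"
      "\<And>t. t \<le> \<tau> \<Longrightarrow> if t = 0 then e t = 1 else e t \<notin> adjoin L Q" by metis
    have "L ^ (\<tau> - t) * e t \<in> homogeneous_part \<tau>" if "t \<le> \<tau>" for t
      using homogeneous_part_mult[OF homogeneous_part_power[OF L(1), of "\<tau> - t"] e(1)[of t]] that by simp
    then have "\<exists>x. (\<exists>t\<le>\<tau>. x t \<noteq> 0) \<and> (\<Sum>t\<le>\<tau>. Const (x t) * (L ^ (\<tau> - t) * e t)) \<in> Q"
      by (rule dep)
    then obtain x where x: "\<exists>t\<le>\<tau>. x t \<noteq> 0" "(\<Sum>t\<le>\<tau>. Const (x t) * (L ^ (\<tau> - t) * e t)) \<in> Q"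
      using that by blast
    define K where "K = {t. t \<le> \<tau> \<and> x t \<noteq> 0}"
    \<comment> \<open>After \<open>L ^ (\<tau> - s)\<close> is cancelled, every summand but the last
      is a multiple of \<open>L\<close>. So the last one would be in the image of \<open>L\<close>,
      or be a nonzero constant in \<open>Q\<close> if \<open>s = 0\<close>.\<close>
    define s where "s = Max K"
    have K: "finite K" "K \<noteq> {}" using x(1) by (auto simp: K_def)
    have s: "s \<le> \<tau>" "x s \<noteq> 0" using Max_in[OF K] by (auto simp: K_def s_def)
    have smax: "x t = 0" if "s < t" "t \<le> \<tau>" for t
    proof (rule ccontr)
      assume "x t \<noteq> 0"
      then have "t \<in> K" using that(2) by (simp add: K_def)
      from Max_ge[OF K(1) this] show False using that(1) by (simp add: s_def)
    qed
    have "(\<Sum>t\<le>\<tau>. Const (x t) * (L ^ (\<tau> - t) * e t)) = (\<Sum>t\<le>s. Const (x t) * (L ^ (\<tau> - t) * e t))"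
      using s smax by (intro sum.mono_neutral_right) auto
    also have "\<dots> = L ^ (\<tau> - s) * (\<Sum>t\<le>s. Const (x t) * (L ^ (s - t) * e t))"
      unfolding sum_distrib_left
    proof (rule sum.cong[OF refl])
      fix t assume "t \<in> {..s}"
      then have "L ^ (\<tau> - t) = L ^ (\<tau> - s) * L ^ (s - t)" using s by (simp flip: power_add)
      then show "Const (x t) * (L ^ (\<tau> - t) * e t) = L ^ (\<tau> - s) * (Const (x t) * (L ^ (s - t) * e t))" by (simp add: mult_ac)
    qed
    finally have "L ^ (\<tau> - s) * (\<Sum>t\<le>s. Const (x t) * (L ^ (s - t) * e t)) \<in> Q" using x(2) by simp
    then have "(\<Sum>t\<le>s. Const (x t) * (L ^ (s - t) * e t)) \<in> Q" by (rule regular_mod_powerD[OF L(2)])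
    also have "(\<Sum>t\<le>s. Const (x t) * (L ^ (s - t) * e t)) = (\<Sum>t<s. Const (x t) * (L ^ (s - t) * e t)) + Const (x s) * e s"
      by (simp add: lessThan_Suc_atMost[symmetric])
    finally have *: "(\<Sum>t<s. Const (x t) * (L ^ (s - t) * e t)) + Const (x s) * e s \<in> Q" .
    show False
    proof (cases "s = 0")
      case True
      then have "Const (x s) * 1 \<in> Q" using * e(2)[of 0] by simp
      then show False using ideal_Const_cancel[OF Q(1) _ s(2)] Q(2) by blast
    next
      case False
      have "Const (x t) * (L ^ (s - t) * e t) \<in> adjoin L Q" if "t < s" for t
      proof -
        have "s - t = Suc (s - t - 1)" using that by simp
        then have "L ^ (s - t) = L ^ (s - t - 1) * L" by (metis power_Suc2)
        then have "L ^ (s - t) \<in> adjoin L Q" using ideal_mult[OF Ai adjoin_mem[OF Q(1)]] by simp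
        then show ?thesis by (intro ideal_mult[OF Ai] ideal_mult_right[OF Ai])
      qed
      then have 1: "(\<Sum>t<s. Const (x t) * (L ^ (s - t) * e t)) \<in> adjoin L Q" by (intro ideal_sum[OF Ai]) simp
      have "(\<Sum>t<s. Const (x t) * (L ^ (s - t) * e t)) + Const (x s) * e s \<in> adjoin L Q"
        using * adjoin_subset[OF Q(1)] by blast
      from ideal_diff[OF Ai this 1] have "Const (x s) * e s \<in> adjoin L Q" by simp
      then have "e s \<in> adjoin L Q" using ideal_Const_cancel[OF Ai _ s(2)] by blast
      then show False using e(2)[OF s(1)] False by simp
    qed
  qed
  then obtain k0 where k0: "k0 < \<tau>" "onto k0" by blast
  have "onto (k0 + i)" for i by (induction i) (use k0 step in auto)
  then have "onto (k - 1)" using k0 k by (metis add_diff_inverse_nat diff_Suc_1 less_imp_Suc_add less_le_trans not_less_eq add_Suc_right)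
  then show ?thesis using h k0 k by (auto simp: onto_def)
qed

text \<open>Splitting off factors \<open>L\<close> lowers the degree and must stop, since a form of
  degree 0 that is a multiple of \<open>L\<close> modulo \<open>I\<close> lies in
  \<open>I\<close>.\<close>

lemma divide_out:
  fixes I :: "('v::finite) mpoly set"
  assumes I: "homogeneous_ideal I" and L: "L \<in> homogeneous_part 1"
  shows "a \<in> homogeneous_part m \<Longrightarrow> a \<notin> I \<Longrightarrow>
    \<exists>e b j. j \<le> m \<and> b \<in> homogeneous_part j \<and> a - L ^ e * b \<in> I \<and> b \<notin> adjoin L I"
proof (induction m arbitrary: a)
  note Ii = homogeneous_idealD[OF I]
  case 0
  have "a \<notin> adjoin L I"
  proof
    assume "a \<in> adjoin L I"
    then obtain e where "a - e * L \<in> I" "(0::nat) < 1 \<Longrightarrow> e = 0" using homogeneous_adjoinE[OF I L _ 0(1)] by metis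
    then show False using 0 by simp
  qed
  then show ?case using 0 ideal_0[OF Ii] by (intro exI[of _ 0] exI[of _ a]) auto
next
  note Ii = homogeneous_idealD[OF I]
  case (Suc m)
  show ?case
  proof (cases "a \<in> adjoin L I")
    case False
    then show ?thesis using Suc ideal_0[OF Ii] by (intro exI[of _ 0] exI[of _ a] exI[of _ "Suc m"]) auto
  next
    case True
    obtain a' where a': "a - a' * L \<in> I" "a' \<in> homogeneous_part (Suc m - 1)"
      using homogeneous_adjoinE[OF I L True Suc.prems(1)] by metis
    have "a' \<notin> I" using Suc.prems(2) ideal_cong[OF Ii a'(1)] ideal_mult_right[OF Ii] by blast
    moreover have "a' \<in> homogeneous_part m" using a'(2) by simp
    ultimately obtain e b j where b: "j \<le> m" "b \<in> homogeneous_part j" "a' - L ^ e * b \<in> I" "b \<notin> adjoin L I"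
      using Suc.IH by blast
    have "(a - a' * L) + L * (a' - L ^ e * b) \<in> I" by (intro ideal_add[OF Ii] ideal_mult[OF Ii] a' b)
    then have "a - L ^ Suc e * b \<in> I" by (simp add: algebra_simps)
    then show ?thesis using b le_SucI by blast
  qed
qed

text \<open>Below degree \<open>r\<close> a nonzero class is not in the socle, so some variable
  keeps it nonzero and it climbs one degree at a time.\<close>

lemma socle_multiple:
  assumes "socle_above r Q" "b \<in> homogeneous_part j" "b \<notin> Q"
  shows "j + t \<le> r \<Longrightarrow> \<exists>c\<in>homogeneous_part t. c * b \<notin> Q"
proof (induction t)
  case 0
  then show ?case using assms(3) homogeneous_part_1 by (intro bexI[of _ 1]) auto
next
  case (Suc t)
  then obtain c where c: "c \<in> homogeneous_part t" "c * b \<notin> Q" by auto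
  have "c * b \<in> homogeneous_part (t + j)" by (rule homogeneous_part_mult[OF c(1) assms(2)])
  moreover have "t + j < r" using Suc by simp
  ultimately obtain v where "Var v * (c * b) \<notin> Q" using assms(1) c(2) unfolding socle_above_def by blast
  then show ?case using homogeneous_part_mult[OF Var_hom c(1)] by (intro bexI[of _ "Var v * c"]) (auto simp: mult.assoc)
qed

section \<open>The Koszul submodule and its cosets\<close>

lemma module_vec: "module ((*s) :: 'a::comm_ring_1 \<Rightarrow> 'a ^ 'n \<Rightarrow> 'a ^ 'n)"
  by standard (auto simp: vec_eq_iff algebra_simps)

text \<open>The generators of \<open>KR f\<close> are indexed by pairs \<open>i < j\<close>. In the
  component \<open>k\<close>, pairs with first entry \<open>k\<close> give the columns right of the
  diagonal and, by skewness, those with second entry \<open>k\<close> give the columns left of it;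
  the diagonal is 0.\<close>

lemma mem_KR_of_skew:
  fixes f :: "('v::{finite,linorder}) mpoly" and a :: "('v mpoly, 'v) vec"
  assumes B: "\<And>i j. B i j = - B j i" and a: "\<And>i. a $ i = (\<Sum>j\<in>UNIV. B i j * poly_partial j f)"
  shows "a \<in> KR f"
proof -
  let ?P = "{p :: 'v \<times> 'v. fst p < snd p}"
  have Bii: "B i i = 0" for i
  proof (rule mpoly_double_eq_0)
    show "B i i + B i i = 0" using B[of i i] by (metis add.right_inverse)
  qed
  have "a = (\<Sum>p\<in>?P. B (fst p) (snd p) *s koszul_relation f (fst p) (snd p))"
  proof (rule vec_eq_iff[THEN iffD2], rule allI)
    fix k
    have "(\<Sum>p\<in>?P. B (fst p) (snd p) *s koszul_relation f (fst p) (snd p)) $ k =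
      (\<Sum>p\<in>?P. (if fst p = k then B k (snd p) * poly_partial (snd p) f else 0) +
        (if snd p = k then B k (fst p) * poly_partial (fst p) f else 0))"
      unfolding sum_component
    proof (rule sum.cong[OF refl])
      fix p :: "'v \<times> 'v" assume "p \<in> ?P"
      then have "fst p \<noteq> snd p" by auto
      then show "(B (fst p) (snd p) *s koszul_relation f (fst p) (snd p)) $ k =
        (if fst p = k then B k (snd p) * poly_partial (snd p) f else 0) + (if snd p = k then B k (fst p) * poly_partial (fst p) f else 0)"
        using B[of "fst p" k] by (auto simp: koszul_relation_def)
    qed
    also have "\<dots> = (\<Sum>p\<in>?P. if fst p = k then B k (snd p) * poly_partial (snd p) f else 0) +
        (\<Sum>p\<in>?P. if snd p = k then B k (fst p) * poly_partial (fst p) f else 0)"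
      by (rule sum.distrib)
    also have "(\<Sum>p\<in>?P. if fst p = k then B k (snd p) * poly_partial (snd p) f else 0) = (\<Sum>j\<in>{k<..}. B k j * poly_partial j f)"
    proof -
      have "(\<Sum>p\<in>?P. if fst p = k then B k (snd p) * poly_partial (snd p) f else 0) =
        (\<Sum>p\<in>{p\<in>?P. fst p = k}. B k (snd p) * poly_partial (snd p) f)"
        by (rule sum.inter_filter[symmetric]) simp
      also have "\<dots> = (\<Sum>j\<in>{k<..}. B k j * poly_partial j f)"
        by (rule sum.reindex_bij_witness[of _ "\<lambda>j. (k, j)" snd]) auto
      finally show ?thesis .
    qed
    also have "(\<Sum>p\<in>?P. if snd p = k then B k (fst p) * poly_partial (fst p) f else 0) = (\<Sum>j\<in>{..<k}. B k j * poly_partial j f)"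
    proof -
      have "(\<Sum>p\<in>?P. if snd p = k then B k (fst p) * poly_partial (fst p) f else 0) =
        (\<Sum>p\<in>{p\<in>?P. snd p = k}. B k (fst p) * poly_partial (fst p) f)"
        by (rule sum.inter_filter[symmetric]) simp
      also have "\<dots> = (\<Sum>j\<in>{..<k}. B k j * poly_partial j f)"
        by (rule sum.reindex_bij_witness[of _ "\<lambda>j. (j, k)" fst]) auto
      finally show ?thesis .
    qed
    also have "(\<Sum>j\<in>{k<..}. B k j * poly_partial j f) + (\<Sum>j\<in>{..<k}. B k j * poly_partial j f) =
      (\<Sum>j\<in>{k<..} \<union> {..<k}. B k j * poly_partial j f)"
      by (rule sum.union_disjoint[symmetric]) auto
    also have "\<dots> = (\<Sum>j\<in>UNIV. B k j * poly_partial j f)"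
      using Bii by (intro sum.mono_neutral_left) auto
    finally show "a $ k = (\<Sum>p\<in>?P. B (fst p) (snd p) *s koszul_relation f (fst p) (snd p)) $ k" using a by simp
  qed
  moreover have "(\<Sum>p\<in>?P. B (fst p) (snd p) *s koszul_relation f (fst p) (snd p)) \<in> KR f"
    unfolding KR_def
    by (intro module.span_sum[OF module_vec] module.span_scale[OF module_vec] module.span_base[OF module_vec]) auto
  ultimately show ?thesis by simp
qed

lemma KR_coset: "a \<in> KR f \<Longrightarrow> a +o KR f = 0 +o KR f"
proof -
  assume a: "a \<in> KR f"
  have "a + x \<in> KR f" if "x \<in> KR f" for x
    using a that unfolding KR_def by (rule module.span_add[OF module_vec])
  moreover have "\<exists>y\<in>KR f. x = a + y" if "x \<in> KR f" for x
    using module.span_diff[OF module_vec, of x _ a] a that unfolding KR_def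
    by (intro bexI[of _ "x - a"]) auto
  ultimately show ?thesis by (auto simp: elt_set_plus_def)
qed

theorem relations_koszul:
  fixes f :: "('n::{finite,linorder}) option mpoly"
  assumes f: "f \<in> homogeneous_part N" "N > 1" and iso: "only_isolated_singularities f"
    and \<tau>: "total_tjurina f = enat \<tau>" and m: "m + \<tau> \<le> CARD('n) * (N - 2)"
    and a: "a \<in> AR_part f m"
  shows "a \<in> KR f"
proof -
  define \<theta> where "\<theta> v = poly_partial v f" for v
  have N0: "N > 0" using f by simp
  have \<theta>: "\<theta> v \<in> homogeneous_part (N - 1)" for v unfolding \<theta>_def by (rule poly_partial_hom[OF f(1)])
  have fin: "finite (singular_points f)" by (rule finite_singular_points[OF f(1) N0 iso])
  have "\<forall>S\<in>singular_points f. \<exists>x. x \<noteq> 0 \<and> S = proj_point x"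
    by (auto simp: singular_points_def hypersurface_def proj_space_eq)
  from bchoice[OF this] obtain r where r': "\<forall>S\<in>singular_points f. r S \<noteq> 0 \<and> S = proj_point (r S)" ..
  note r = r'[rule_format]
  \<comment> \<open>The vector 1 is added so that \<open>l\<close> is nonzero even if there are no
    singular points.\<close>
  define F where "F = insert (1 :: complex ^ 'n option) (r ` singular_points f)"
  have "finite F" "0 \<notin> F" using fin r by (auto simp: F_def)
  then obtain l where l: "\<forall>x\<in>F. (\<Sum>v\<in>UNIV. l v * x $ v) \<noteq> 0" using avoiding_linear_form by blast
  define L where "L = linear_form l"
  have L1: "L \<in> homogeneous_part 1" unfolding L_def by (rule linear_form_hom)
  have evL: "poly_eval L x = (\<Sum>v\<in>UNIV. l v * x $ v)" for x
    by (simp add: L_def linear_form_def poly_eval_sum poly_eval_mult poly_eval_Const poly_eval_Var)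
  have "\<exists>i0. l i0 \<noteq> 0"
  proof (rule ccontr)
    assume "\<nexists>i0. l i0 \<noteq> 0"
    then show False using l by (auto simp: F_def)
  qed
  then obtain i0 where i0: "l i0 \<noteq> 0" by blast
  define J where "J = gen \<theta> UNIV (adjoin L {0})"
  have Jh: "homogeneous_ideal J" unfolding J_def
    by (rule homogeneous_ideal_gen[OF finite homogeneous_ideal_adjoin[OF homogeneous_ideal_0 L1] \<theta>])
  have "primary_mod J"
  proof (rule projective_nullstellensatz[OF Jh], rule ccontr)
    fix x :: "complex ^ 'n option" assume x: "x \<noteq> 0" and no: "\<not> (\<exists>p\<in>J. poly_eval p x \<noteq> 0)"
    have "\<theta> v \<in> J" for v unfolding J_def by (rule gen_mem[OF finite is_ideal_adjoin[OF is_ideal_0] UNIV_I])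
    then have "\<forall>v. poly_eval (poly_partial v f) x = 0" using no by (auto simp: \<theta>_def)
    then have S: "proj_point x \<in> singular_points f" using singular_points_iff[OF f(1) N0 x] by blast
    define y where "y = r (proj_point x)"
    have y: "y \<in> F" "proj_point x = proj_point y" using r[OF S] S by (auto simp: F_def y_def)
    then have "y \<in> proj_point x" using proj_point_self by auto
    then obtain c where c: "y = c *s x" by (auto simp: proj_point_def)
    have "L \<in> J" unfolding J_def using gen_subset adjoin_mem[OF is_ideal_0] by blast
    then have "poly_eval L x = 0" using no by blast
    then have "poly_eval L y = 0" unfolding c poly_eval_scale[OF L1] by simp
    then show False using l y(1) by (auto simp: evL)
  qed
  then have P: "primary_mod (gen \<theta> UNIV (adjoin (linear_form l) {0}))" by (simp add: J_def L_def)
  have d: "N - 1 \<ge> 1" using f by simp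
  have cN: "(CARD('n option) - 1) * (N - 1 - 1) = CARD('n) * (N - 2)" by (simp add: numeral_2_eq_2)
  obtain i \<mu> I where i: "\<mu> i = 0" and I: "I = gen (\<lambda>j. \<theta> j - Const (\<mu> j) * \<theta> i) (UNIV - {i}) {0}"
    and LI: "regular_mod L I" and K: "only_koszul (\<lambda>j. \<theta> j - Const (\<mu> j) * \<theta> i) (UNIV - {i}) {0}"
    and S: "socle_above (CARD('n) * (N - 2)) (adjoin L I)" and PI: "primary_mod (adjoin L I)"
    by (rule almost_complete_intersection[of l i0 "N - 1" \<theta>, OF i0 d \<theta> P, unfolded cN, folded L_def])
  let ?\<theta> = "\<lambda>j. \<theta> j - Const (\<mu> j) * \<theta> i"
  have \<theta>': "?\<theta> j \<in> homogeneous_part (N - 1)" for j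
    by (rule homogeneous_part_diff[OF \<theta> homogeneous_part_Const_mult[OF \<theta>]])
  have Ih: "homogeneous_ideal I" unfolding I by (rule homogeneous_ideal_gen[OF _ homogeneous_ideal_0 \<theta>']) simp
  note Ii = homogeneous_idealD[OF Ih]
  \<comment> \<open>Only the coefficient at \<open>i\<close> changes: \<open>b i\<close> is
    \<open>a $ i\<close> plus the sum of all \<open>a $ j * Const (\<mu> j)\<close>. It is the
    element called \<open>b\<close> in the overview.\<close>
  define b where "b = shear_coefficients UNIV i (\<lambda>j. Const (\<mu> j)) (\<lambda>j. a $ j)"
  have am: "a $ j \<in> homogeneous_part m" and rel: "(\<Sum>j\<in>UNIV. a $ j * \<theta> j) = 0" for j
    using a by (auto simp: AR_part_def AR_def \<theta>_def)
  have "(\<Sum>j\<in>UNIV. b j * ?\<theta> j) = 0"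
    unfolding b_def using shear_relation[of UNIV i "\<lambda>j. Const (\<mu> j)" "\<lambda>j. a $ j" \<theta>] i rel by simp
  then have rel': "b i * \<theta> i + (\<Sum>j\<in>UNIV - {i}. b j * ?\<theta> j) = 0"
    using i by (simp add: sum.remove[of UNIV i])
  have bi: "b i \<in> homogeneous_part m"
    unfolding b_def shear_coefficients_def
    by (simp, intro homogeneous_part_add homogeneous_part_sum am) (metis am homogeneous_part_Const_mult mult.commute)
  have gI: "?\<theta> j \<in> I" if "j \<noteq> i" for j
    unfolding I by (rule gen_mem[of "UNIV - {i}" "{0}" j ?\<theta>]) (use that is_ideal_0 in auto)
  have "(\<Sum>j\<in>UNIV - {i}. b j * ?\<theta> j) \<in> I"
    by (rule ideal_sum[OF Ii], rule ideal_mult[OF Ii], rule gI) simp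
  then have "- (\<Sum>j\<in>UNIV - {i}. b j * ?\<theta> j) \<in> I" by (rule ideal_uminus[OF Ii])
  \<comment> \<open>The relation makes \<open>\<theta> i\<close> annihilate \<open>b i\<close>
    modulo \<open>I\<close>; then so do all partial derivatives, as the differences
    \<open>?\<theta> j\<close> lie in \<open>I\<close>.\<close>
  then have bI: "\<theta> i * b i \<in> I" using rel' by (simp add: add_eq_0_iff2 mult.commute)
  have ann: "poly_partial v f * b i \<in> I" for v
  proof (cases "v = i")
    case False
    have "b i * ?\<theta> v + Const (\<mu> v) * (\<theta> i * b i) \<in> I"
      by (intro ideal_add[OF Ii] ideal_mult[OF Ii] gI bI False)
    then show ?thesis by (simp add: \<theta>_def algebra_simps)
  qed (use bI in \<open>simp add: \<theta>_def\<close>)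
  have "b i \<in> I"
  proof (rule ccontr)
    assume nb: "b i \<notin> I"
    let ?Q = "colon I (b i)"
    have Q: "is_ideal ?Q" "1 \<notin> ?Q" using is_ideal_colon[OF Ii] nb by (auto simp: colon_def)
    have LQ: "regular_mod L ?Q" using LI by (auto simp: regular_mod_def colon_def mult.assoc)
    obtain e b' j where b': "j \<le> m" "b' \<in> homogeneous_part j" "b i - L ^ e * b' \<in> I" "b' \<notin> adjoin L I"
      using divide_out[OF Ih L1 bi nb] by blast
    \<comment> \<open>The distance from \<open>b'\<close> to the socle degree. Since
      \<open>j \<le> m\<close>, the hypothesis gives \<open>\<tau> \<le> t\<close>, the range in
      which multiplication by \<open>L\<close> is onto.\<close>
    define t where "t = CARD('n) * (N - 2) - j"
    have t: "j + t \<le> CARD('n) * (N - 2)" "\<tau> \<le> t" using m b'(1) by (auto simp: t_def)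
    obtain c where c: "c \<in> homogeneous_part t" "c * b' \<notin> adjoin L I"
      using socle_multiple[OF S b'(2,4) t(1)] by blast
    have "t > 0 \<and> c \<in> adjoin L ?Q"
    proof (rule multiplication_stabilizes[OF Q L1 LQ _ t(2) c(1)])
      fix e :: "nat \<Rightarrow> 'n option mpoly" assume e: "\<And>t. t \<le> \<tau> \<Longrightarrow> e t \<in> homogeneous_part \<tau>"
      obtain x where x: "\<exists>t\<in>{..\<tau>}. x t \<noteq> 0"
        "\<And>S. S \<in> singular_points f \<Longrightarrow> \<exists>(z :: complex ^ 'n option) j. z \<in> S \<and> z $ j = 1 \<and>
          germ (\<lambda>y. poly_eval (\<Sum>t\<in>{..\<tau>}. Const (x t) * e t) (chart z j y)) \<in> tjurina_ideal (\<lambda>y. poly_eval f (chart z j y))"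
        using locally_jacobian_combination[OF f(1) N0 fin \<tau>, of "{..\<tau>}" e] by auto
      have "(\<Sum>t\<le>\<tau>. Const (x t) * e t) \<in> homogeneous_part \<tau>"
        by (intro homogeneous_part_sum homogeneous_part_Const_mult e) simp
      from local_to_global[OF f(1) N0 Ih L_def LI PI bi ann this x(2)]
      have "(\<Sum>t\<le>\<tau>. Const (x t) * e t) \<in> ?Q" by (simp add: colon_def)
      then show "\<exists>x. (\<exists>t\<le>\<tau>. x t \<noteq> 0) \<and> (\<Sum>t\<le>\<tau>. Const (x t) * e t) \<in> ?Q" using x(1) by auto
    qed
    \<comment> \<open>On \<open>b i\<close>, which is \<open>L ^ e * b'\<close> modulo
      \<open>I\<close>, the form \<open>c\<close> acts like \<open>h * L\<close>. Cancelling
      \<open>L ^ e\<close> puts \<open>c * b'\<close> into the ideal of \<open>I\<close> and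
      \<open>L\<close>, against its choice.\<close>
    then obtain h where "c - h * L \<in> ?Q" by (auto simp: adjoin_def)
    then have "(c - h * L) * b i \<in> I" by (simp add: colon_def)
    from ideal_diff[OF Ii this ideal_mult[OF Ii b'(3), of "c - h * L"]]
    have "L ^ e * ((c - h * L) * b') \<in> I" by (simp add: algebra_simps)
    then have "(c - h * L) * b' \<in> I" by (rule regular_mod_powerD[OF LI])
    then have "c * b' - (h * b') * L \<in> I" by (simp add: algebra_simps)
    then show False using c(2) by (auto simp: adjoin_def)
  qed
  \<comment> \<open>The relation is now Koszul for the sheared forms; transporting it back gives a
    skew matrix for the partial derivatives.\<close>
  then have mem: "b i \<in> gen ?\<theta> (UNIV - {i}) {0}" by (simp add: I)
  have ins: "insert i (UNIV - {i}) = UNIV" by auto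
  have "(\<Sum>j\<in>insert i (UNIV - {i}). b j * ?\<theta> j) \<in> {0}" unfolding ins using \<open>(\<Sum>j\<in>UNIV. b j * ?\<theta> j) = 0\<close> by simp
  then have "\<exists>B. (\<forall>i j. B i j = - B j i) \<and>
      (\<forall>p\<in>insert i (UNIV - {i}). b p - (\<Sum>j\<in>insert i (UNIV - {i}). B p j * ?\<theta> j) \<in> {0})"
    by (rule koszul_insert[of "UNIV - {i}" i "{0}" ?\<theta> b, OF _ _ is_ideal_0 K _ mem, rotated 2]) simp_all
  then have "\<exists>B. (\<forall>i j. B i j = - B j i) \<and> (\<forall>p\<in>UNIV. b p - (\<Sum>j\<in>UNIV. B p j * ?\<theta> j) \<in> {0})"
    unfolding ins .
  then have "\<exists>B. (\<forall>i j. B i j = - B j i) \<and> (\<forall>p\<in>UNIV. a $ p - (\<Sum>j\<in>UNIV. B p j * \<theta> j) \<in> {0})"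
    unfolding b_def
    by (rule koszul_shear[of UNIV i "{0}" "\<lambda>j. Const (\<mu> j)" "\<lambda>j. a $ j" \<theta>, OF finite UNIV_I is_ideal_0, rotated]) (simp add: i)
  then obtain B where B: "\<forall>i j. B i j = - B j i" "\<forall>p\<in>UNIV. a $ p - (\<Sum>j\<in>UNIV. B p j * \<theta> j) \<in> {0}" by blast
  show ?thesis
  proof (rule mem_KR_of_skew[of B])
    show "B i j = - B j i" for i j by (rule B(1)[rule_format])
    have "a $ p - (\<Sum>j\<in>UNIV. B p j * \<theta> j) = 0" for p using bspec[OF B(2) UNIV_I] by (rule singletonD)
    then show "a $ p = (\<Sum>j\<in>UNIV. B p j * poly_partial j f)" for p unfolding \<theta>_def by (rule right_minus_eq[THEN iffD1])
  qed
qed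

text \<open>The bound is stated additively in \<open>enat\<close>: this avoids truncated subtraction
  and forces the total Tjurina number to be finite.\<close>

theorem theorem1p1:
  fixes f :: "('n::{finite,linorder}) option mpoly" and N m :: nat
  assumes "f \<noteq> 0" and "f \<in> homogeneous_part N" and "N > 1"
    and "only_isolated_singularities f"
    and "enat m + total_tjurina f \<le> enat (CARD('n) * (N - 2))"
  shows "ER_part f m = {0 +o KR f}"
proof -
  obtain \<tau> where \<tau>: "total_tjurina f = enat \<tau>" using assms(5) by (cases "total_tjurina f") auto
  then have m: "m + \<tau> \<le> CARD('n) * (N - 2)" using assms(5) by simp
  have "a +o KR f = 0 +o KR f" if "a \<in> AR_part f m" for a
    by (rule KR_coset[OF relations_koszul[OF assms(2-4) \<tau> m that]])
  moreover have "0 \<in> AR_part f m" by (simp add: AR_part_def AR_def)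
  ultimately show ?thesis unfolding ER_part_def by auto
qed

end
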